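(* For every $\varepsilon>0$ let $\rho_\varepsilon:\mathbb{R}^d\to[0,\infty]$ be a measurable radial kernel with essential support $\overline{B_\varepsilon(0)}$ and $\int_{\mathbb{R}^d}\rho_\varepsilon(h)\,dh=1$. Then, with respect to the convergence in $\mathcal{M}_d$, $$\Gamma\text{-}\lim_{\varepsilon\to0}\mathbb{P}^c_\varepsilon=K_d\operatorname{P},\qquad K_d:=\frac{1}{|\mathbb{S}^{d-1}|}\int_{\mathbb{S}^{d-1}}|e_1\cdot\sigma|\,d\mathcal{H}^{d-1}(\sigma),$$ where $\operatorname{P}$ is the classical (Caccioppoli) perimeter.
   Context: $\mathcal{M}_d$ is the collection of Lebesgue measurable subsets of $\mathbb{R}^d$ (infinite measure allowed) with the convergence in measure: $E_n\to E$ iff $|E_n\Delta E|\to0$. For $E\in\mathcal{M}_d$, $$\mathbb{P}_\varepsilon(E):=\int_{\mathbb{R}^d}\int_{\mathbb{R}^d}\frac{|\mathbf{1}_E(x)-\mathbf{1}_E(y)|}{|x-y|}\rho_\varepsilon(x-y)\,dx\,dy .$$ A set $E$ with $\mathbb{P}_\varepsilon(E)<\infty$ is $\varepsilon$-decomposable if there is a partition $\{E_1,E_2\}$ of $E$ into sets of finite $\mathbb{P}_\varepsilon$-perimeter with $|E_1|,|E_2|>0$ and $\mathbb{P}_\varepsilon(E)=\mathbb{P}_\varepsilon(E_1)+\mathbb{P}_\varepsilon(E_2)$; otherwise $\varepsilon$-indecomposable. The connected perimeter $\mathbb{P}^c_\varepsilon:\mathcal{M}_d\to[0,\infty]$ is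 $\mathbb{P}^c_\varepsilon(E):=\mathbb{P}_\varepsilon(E)$ if $E$ is $\varepsilon$-indecomposable and $\mathbb{P}^c_\varepsilon(E):=\infty$ otherwise. The classical perimeter is $\operatorname{P}(E)=\sup\{\int_E\operatorname{div}p\,dx: p\in C_c^\infty(\mathbb{R}^d;\mathbb{R}^d),\|p\|_{L^\infty}\le1\}$. The $\Gamma$-limit as $\varepsilon\to0$ is understood along every sequence $\varepsilon_n\to0$, $\varepsilon_n>0$. *)

theory Defs
  imports "HOL-Analysis.Analysis"
begin

section \<open>Nonlocal and connected perimeter\<close>

text \<open>On the diagonal \<open>x = y\<close> the numerator vanishes, and Isabelle's \<open>0 / 0 = 0\<close> makes the
  integrand \<open>0\<close>.  \<open>(\<infinity>::ennreal) * 0 = 0\<close>, so infinite kernel values are harmless where the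
  difference of the indicators is zero.\<close>

definition nonlocal_perimeter :: "('a::euclidean_space \<Rightarrow> ennreal) \<Rightarrow> 'a set \<Rightarrow> ennreal" where
  "nonlocal_perimeter \<rho> E =
     (\<integral>\<^sup>+ y. (\<integral>\<^sup>+ x. ennreal (\<bar>indicator E x - indicator E y\<bar> / norm (x - y)) * \<rho> (x - y)
        \<partial>lebesgue) \<partial>lebesgue)"

definition decomposable :: "('a::euclidean_space \<Rightarrow> ennreal) \<Rightarrow> 'a set \<Rightarrow> bool" where
  "decomposable \<rho> E \<longleftrightarrow>
     nonlocal_perimeter \<rho> E < \<infinity> \<and>
     (\<exists>E1 E2. E1 \<in> sets lebesgue \<and> E2 \<in> sets lebesgue \<and> E1 \<union> E2 = E \<and> E1 \<inter> E2 = {} \<and>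
        nonlocal_perimeter \<rho> E1 < \<infinity> \<and> nonlocal_perimeter \<rho> E2 < \<infinity> \<and>
        emeasure lebesgue E1 > 0 \<and> emeasure lebesgue E2 > 0 \<and>
        nonlocal_perimeter \<rho> E = nonlocal_perimeter \<rho> E1 + nonlocal_perimeter \<rho> E2)"

text \<open>A set of infinite nonlocal perimeter gets the value \<open>\<infinity>\<close> in both branches.\<close>

definition connected_perimeter :: "('a::euclidean_space \<Rightarrow> ennreal) \<Rightarrow> 'a set \<Rightarrow> ennreal" where
  "connected_perimeter \<rho> E = (if decomposable \<rho> E then \<infinity> else nonlocal_perimeter \<rho> E)"

definition radial :: "('a::real_normed_vector \<Rightarrow> 'b) \<Rightarrow> bool" where
  "radial f \<longleftrightarrow> (\<forall>x y. norm x = norm y \<longrightarrow> f x = f y)"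

text \<open>The complement of the largest open set on which \<open>f\<close> vanishes almost everywhere.\<close>

definition ess_support :: "('a::euclidean_space \<Rightarrow> 'b::zero) \<Rightarrow> 'a set" where
  "ess_support f = - \<Union>{U. open U \<and> (AE x in lebesgue. x \<in> U \<longrightarrow> f x = 0)}"

section \<open>Classical perimeter\<close>

text \<open>\<open>C\<^sup>k\<close> on the whole space, by recursion on the directional derivatives.\<close>

primrec k_times_cont_diff ::
    "nat \<Rightarrow> ('a::euclidean_space \<Rightarrow> 'b::real_normed_vector) \<Rightarrow> bool" where
  "k_times_cont_diff 0 f \<longleftrightarrow> continuous_on UNIV f"
| "k_times_cont_diff (Suc k) f \<longleftrightarrow>
     (\<forall>x. f differentiable (at x)) \<and>
     (\<forall>v. k_times_cont_diff k (\<lambda>x. frechet_derivative f (at x) v))"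

definition smooth :: "('a::euclidean_space \<Rightarrow> 'b::real_normed_vector) \<Rightarrow> bool" where
  "smooth f \<longleftrightarrow> (\<forall>k. k_times_cont_diff k f)"

definition test_fields :: "('a::euclidean_space \<Rightarrow> 'a) set" where
  "test_fields = {p. smooth p \<and> compact (closure {x. p x \<noteq> 0})}"

definition divergence :: "('a::euclidean_space \<Rightarrow> 'a) \<Rightarrow> 'a \<Rightarrow> real" where
  "divergence p x = (\<Sum>b\<in>Basis. frechet_derivative p (at x) b \<bullet> b)"

text \<open>\<open>ennreal\<close> truncates negative integrals to \<open>0\<close>; this does not change the supremum, which is
  nonnegative because \<open>p = 0\<close> is admissible.  Since \<open>p\<close> is continuous, its essential supremum
  norm is at most \<open>1\<close> iff \<open>norm (p x) \<le> 1\<close> for every \<open>x\<close>.\<close>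

definition perimeter :: "'a::euclidean_space set \<Rightarrow> ennreal" where
  "perimeter E =
     (SUP p \<in> {p \<in> test_fields. \<forall>x. norm (p x) \<le> 1}.
        ennreal (LINT x:E|lebesgue. divergence p x))"

section \<open>Hausdorff measure and the constant\<close>

text \<open>The usual normalisation: \<open>unit_ball_vol s * (diam U / 2) ^ s\<close>, with the conventions
  \<open>diam U ^ 0 = 1\<close> for nonempty \<open>U\<close> (so that dimension \<open>0\<close> gives the counting measure)
  and \<open>0\<close> for the empty set.  Bounded sets are required because \<open>diameter\<close> is unspecified
  on unbounded ones.\<close>

definition hausdorff_gauge :: "nat \<Rightarrow> 'a::metric_space set \<Rightarrow> ennreal" where
  "hausdorff_gauge s U =
     (if U = {} then 0 else ennreal (unit_ball_vol (real s) * (diameter U / 2) ^ s))"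

definition hausdorff_pre :: "nat \<Rightarrow> real \<Rightarrow> 'a::metric_space set \<Rightarrow> ennreal" where
  "hausdorff_pre s \<delta> A =
     (INF U \<in> {U :: nat \<Rightarrow> 'a set. A \<subseteq> (\<Union>i. U i) \<and> (\<forall>i. bounded (U i) \<and> diameter (U i) \<le> \<delta>)}.
        (\<Sum>i. hausdorff_gauge s (U i)))"

definition hausdorff_outer :: "nat \<Rightarrow> 'a::metric_space set \<Rightarrow> ennreal" where
  "hausdorff_outer s A = (SUP \<delta> \<in> {0<..}. hausdorff_pre s \<delta> A)"

text \<open>The Hausdorff measure on the Borel sets.  \<open>hausdorff_outer s\<close> is a metric outer measure,
  hence countably additive on Borel sets, so \<open>measure_of\<close> does return a measure with these values.\<close>

definition hausdorff_measure :: "nat \<Rightarrow> 'a::metric_space measure" where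
  "hausdorff_measure s = measure_of UNIV (sets borel) (hausdorff_outer s)"

text \<open>The argument \<open>e\<close> stands for the first vector of the standard basis.\<close>

definition sphere_mean_const :: "'a::euclidean_space \<Rightarrow> real" where
  "sphere_mean_const e =
     (1 / measure (hausdorff_measure (DIM('a) - 1)) (sphere (0::'a) 1)) *
     (LINT \<sigma>:sphere 0 1|hausdorff_measure (DIM('a) - 1). \<bar>e \<bullet> \<sigma>\<bar>)"

section \<open>Gamma-convergence\<close>

text \<open>Sequential \<open>\<Gamma>\<close>-convergence of \<open>F n\<close> to \<open>G\<close> on the space \<open>X\<close>, where \<open>conv u x\<close> means that the
  sequence \<open>u\<close> in \<open>X\<close> converges to \<open>x\<close>.\<close>

definition Gamma_converges ::
    "'x set \<Rightarrow> ((nat \<Rightarrow> 'x) \<Rightarrow> 'x \<Rightarrow> bool) \<Rightarrow> (nat \<Rightarrow> 'x \<Rightarrow> ennreal) \<Rightarrow> ('x \<Rightarrow> ennreal) \<Rightarrow> bool" where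
  "Gamma_converges X conv F G \<longleftrightarrow>
     (\<forall>x\<in>X.
        (\<forall>u. (\<forall>n. u n \<in> X) \<and> conv u x \<longrightarrow> G x \<le> liminf (\<lambda>n. F n (u n))) \<and>
        (\<exists>u. (\<forall>n. u n \<in> X) \<and> conv u x \<and> limsup (\<lambda>n. F n (u n)) \<le> G x))"

definition Gamma_limit_at_0 ::
    "'x set \<Rightarrow> ((nat \<Rightarrow> 'x) \<Rightarrow> 'x \<Rightarrow> bool) \<Rightarrow> (real \<Rightarrow> 'x \<Rightarrow> ennreal) \<Rightarrow> ('x \<Rightarrow> ennreal) \<Rightarrow> bool" where
  "Gamma_limit_at_0 X conv F G \<longleftrightarrow>
     (\<forall>\<epsilon> :: nat \<Rightarrow> real. (\<forall>n. \<epsilon> n > 0) \<and> \<epsilon> \<longlonglongrightarrow> 0 \<longrightarrow> Gamma_converges X conv (\<lambda>n. F (\<epsilon> n)) G)"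

definition converges_in_measure :: "(nat \<Rightarrow> 'a::euclidean_space set) \<Rightarrow> 'a set \<Rightarrow> bool" where
  "converges_in_measure u E \<longleftrightarrow> (\<lambda>n. emeasure lebesgue (sym_diff (u n) E)) \<longlonglongrightarrow> 0"

end

theory Submission
  imports Defs
begin

text \<open>
  The limit constant comes from averaging: since \<open>\<rho>\<close> is radial with total mass \<open>1\<close>,
  \<open>\<integral> \<bar>h \<bullet> v\<bar> / \<bar>h\<bar> \<rho>(h) dh = K \<bar>v\<bar>\<close> for every vector \<open>v\<close>, where \<open>K\<close> is the mean of \<open>\<bar>e \<bullet> \<sigma>\<bar>\<close>
  over the unit sphere (\<open>spherical_mean_identity\<close>). This follows from Fubini's theorem on the product
  of the sphere and the whole space, as both Lebesgue measure and the Hausdorff measure are invariant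
  under orthogonal maps. It needs the sphere to have finite and positive Hausdorff measure.

  The nonlocal perimeter of \<open>E\<close> is the integral of \<open>\<rho>(h) / \<bar>h\<bar>\<close> against the measure \<open>D(h)\<close> of
  the symmetric difference of \<open>E\<close> and its translate by \<open>h\<close>. Let \<open>w = \<eta> * 1\<^sub>E\<close> be mollified with a
  smooth even bump \<open>\<eta>\<close>. Two facts link \<open>w\<close> to the classical perimeter: the integral of \<open>\<bar>\<nabla>w\<bar>\<close> is at
  most \<open>P(E)\<close> (test the perimeter with \<open>\<eta> * p\<close>, where \<open>p\<close> is the truncated unit field \<open>-\<nabla>w / \<bar>\<nabla>w\<bar>\<close>),
  and every value \<open>\<integral>\<^sub>E div p\<close> is almost attained by \<open>\<integral> \<bar>\<nabla>w\<bar>\<close> over a large ball if the bump is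
  narrow. Both rest on the duality \<open>\<integral>\<^sub>E div (\<eta> * p) = - \<integral> p \<bullet> \<nabla>w\<close>.

  Upper bound: \<open>\<integral> \<bar>w(x + h) - w(x)\<bar> dx \<le> \<integral> \<bar>h \<bullet> \<nabla>w\<bar>\<close>. Averaging over \<open>h\<close> gives the nonlocal
  energy bound \<open>K P(E)\<close> for \<open>w\<close>, and Fatou's lemma transfers it to \<open>E\<close>, for each fixed kernel
  (\<open>nonlocal_energy_le_perimeter\<close>).

  Lower bound: mollification does not increase \<open>D(h)\<close>. If \<open>E\<^sub>n\<close> is close to \<open>E\<close> in measure then the
  difference quotients of \<open>\<eta> * 1\<close> of \<open>E\<^sub>n\<close> are uniformly close to those of \<open>w\<close>, which for
  \<open>\<bar>h\<bar> \<le> \<epsilon>\<^sub>n\<close> are close to \<open>\<bar>h \<bullet> \<nabla>w\<bar> / \<bar>h\<bar>\<close>. Averaging over \<open>h\<close> bounds \<open>K \<integral> \<bar>\<nabla>w\<bar>\<close> on a ball by the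
  lower limit of the nonlocal energies (\<open>perimeter_le_liminf_nonlocal_energy\<close>).

  Recovery sequence: the constant sequence \<open>E\<close> would do for the nonlocal perimeter, but \<open>E\<close> may be
  decomposable. Add to \<open>E\<close> a countable union of tiny balls with dense centres. A small enough ball
  has arbitrarily small nonlocal perimeter for a fixed kernel, so the total cost is negligible. The
  new set has positive measure in every open set. If it were split into two parts with additive
  nonlocal perimeter, then the parts would not interact at distances below \<open>\<epsilon>\<close>; connectedness of
  the space yields a point near which both parts have positive measure, a contradiction
  (\<open>ubiquitous_set_indecomposable\<close>).
\<close>

section \<open>Hausdorff measure as a Borel measure\<close>

lemma hausdorff_pre_mono: "A \<subseteq> B \<Longrightarrow> hausdorff_pre s \<delta> A \<le> hausdorff_pre s \<delta> B"
  unfolding hausdorff_pre_def by (rule INF_superset_mono) auto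

lemma hausdorff_outer_mono: "A \<subseteq> B \<Longrightarrow> hausdorff_outer s A \<le> hausdorff_outer s B"
  unfolding hausdorff_outer_def by (rule SUP_mono) (auto intro: hausdorff_pre_mono)

lemma hausdorff_pre_antimono_scale: "\<delta> \<le> \<delta>' \<Longrightarrow> hausdorff_pre s \<delta>' A \<le> hausdorff_pre s \<delta> A"
  unfolding hausdorff_pre_def by (rule INF_superset_mono) (auto intro: order_trans)

lemma suminf_half_powers: "e > 0 \<Longrightarrow> (\<Sum>i. ennreal (e * (1/2)^Suc i)) = ennreal e"
  using sums_mult[OF power_half_series, of e]
  by (intro sums_unique[symmetric]) (auto simp: sums_ennreal)

text \<open>
  Near-optimal covers of the pieces, with errors \<open>e/2, e/4, \<dots>\<close>, together cover the union.
\<close>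

lemma hausdorff_pre_UN:
  assumes "\<delta> > 0"
  shows "hausdorff_pre s \<delta> (\<Union>i. A i) \<le> (\<Sum>i. hausdorff_pre s \<delta> (A i))"
proof (rule ennreal_le_epsilon)
  fix e :: real
  assume "e > 0" and fin: "(\<Sum>i. hausdorff_pre s \<delta> (A i)) < top"
  let ?C = "\<lambda>i. {U :: nat \<Rightarrow> 'a set. A i \<subseteq> (\<Union>j. U j) \<and> (\<forall>j. bounded (U j) \<and> diameter (U j) \<le> \<delta>)}"
  have "\<exists>U\<in>?C i. (\<Sum>j. hausdorff_gauge s (U j)) \<le> hausdorff_pre s \<delta> (A i) + ennreal (e * (1/2)^Suc i)" for i
  proof -
    have "hausdorff_pre s \<delta> (A i) < top"
      using ennreal_suminf_lessD[OF fin] by auto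
    then have "hausdorff_pre s \<delta> (A i) < hausdorff_pre s \<delta> (A i) + ennreal (e * (1/2)^Suc i)"
      using \<open>e > 0\<close> by (auto simp: less_top ennreal_zero_less_mult_iff)
    then show ?thesis
      unfolding hausdorff_pre_def INF_less_iff by (auto intro: less_imp_le)
  qed
  then have "\<forall>i. \<exists>U. U \<in> ?C i \<and>
      (\<Sum>j. hausdorff_gauge s (U j)) \<le> hausdorff_pre s \<delta> (A i) + ennreal (e * (1/2)^Suc i)"
    by blast
  from choice[OF this] obtain U where U: "\<And>i. U i \<in> ?C i"
    and le: "\<And>i. (\<Sum>j. hausdorff_gauge s (U i j)) \<le> hausdorff_pre s \<delta> (A i) + ennreal (e * (1/2)^Suc i)"
    by blast
  define V where "V n = U (fst (prod_decode n)) (snd (prod_decode n))" for n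
  have "hausdorff_pre s \<delta> (\<Union>i. A i) \<le> (\<Sum>n. hausdorff_gauge s (V n))"
    unfolding hausdorff_pre_def
  proof (rule INF_lower, safe)
    fix x i assume "x \<in> A i"
    then obtain j where "x \<in> U i j" using U by blast
    then have "x \<in> V (prod_encode (i, j))" by (simp add: V_def)
    then show "x \<in> (\<Union>n. V n)" by blast
  next
    fix n show "bounded (V n)" "diameter (V n) \<le> \<delta>" using U unfolding V_def by auto
  qed
  also have "\<dots> = (\<Sum>i. \<Sum>j. hausdorff_gauge s (U i j))"
    using suminf_ennreal_2dimen[of "\<lambda>i. \<Sum>j. hausdorff_gauge s (U i j)" "\<lambda>(i, j). hausdorff_gauge s (U i j)"]
    by (simp add: V_def case_prod_beta comp_def)
  also have "\<dots> \<le> (\<Sum>i. hausdorff_pre s \<delta> (A i) + ennreal (e * (1/2)^Suc i))"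
    by (intro suminf_le le) auto
  also have "\<dots> = (\<Sum>i. hausdorff_pre s \<delta> (A i)) + (\<Sum>i. ennreal (e * (1/2)^Suc i))"
    by (rule suminf_add[symmetric]) auto
  also have "(\<Sum>i. ennreal (e * (1/2)^Suc i)) = ennreal e"
    by (rule suminf_half_powers) fact
  finally show "hausdorff_pre s \<delta> (\<Union>i. A i) \<le> (\<Sum>i. hausdorff_pre s \<delta> (A i)) + ennreal e" .
qed

lemma hausdorff_outer_empty: "hausdorff_outer s ({} :: 'a::metric_space set) = 0"
proof -
  have "hausdorff_pre s \<delta> ({} :: 'a set) = 0" if "\<delta> > 0" for \<delta>
  proof -
    have "hausdorff_pre s \<delta> ({} :: 'a set) \<le> (\<Sum>i. hausdorff_gauge s ({} :: 'a set))"
      unfolding hausdorff_pre_def using that by (intro INF_lower) auto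
    then show ?thesis by (simp add: hausdorff_gauge_def)
  qed
  then show ?thesis unfolding hausdorff_outer_def by simp
qed

lemma hausdorff_outer_UN: "hausdorff_outer s (\<Union>i. A i) \<le> (\<Sum>i. hausdorff_outer s (A i))"
  unfolding hausdorff_outer_def[of s "\<Union>i. A i"]
proof (rule SUP_least)
  fix \<delta> :: real assume "\<delta> \<in> {0<..}"
  then have "hausdorff_pre s \<delta> (\<Union>i. A i) \<le> (\<Sum>i. hausdorff_pre s \<delta> (A i))"
    by (intro hausdorff_pre_UN) simp
  also have "\<dots> \<le> (\<Sum>i. hausdorff_outer s (A i))"
    unfolding hausdorff_outer_def using \<open>\<delta> \<in> {0<..}\<close> by (intro suminf_le SUP_upper) auto
  finally show "hausdorff_pre s \<delta> (\<Union>i. A i) \<le> (\<Sum>i. hausdorff_outer s (A i))" .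
qed

text \<open>
  At scales below the distance of \<open>A\<close> and \<open>B\<close> a member of a cover meets at most one of them,
  so a cover of the union splits into a cover of each.
\<close>

lemma hausdorff_outer_separated:
  assumes "d > 0" and sep: "\<And>x y. x \<in> A \<Longrightarrow> y \<in> B \<Longrightarrow> d \<le> dist x y"
  shows "hausdorff_outer s A + hausdorff_outer s B \<le> hausdorff_outer s (A \<union> B)"
proof -
  have pre: "hausdorff_pre s \<delta> A + hausdorff_pre s \<delta> B \<le> hausdorff_pre s \<delta> (A \<union> B)"
    if "0 < \<delta>" "\<delta> < d" for \<delta>
    unfolding hausdorff_pre_def[of s \<delta> "A \<union> B"]
  proof (rule INF_greatest, safe)
    fix U :: "nat \<Rightarrow> 'a set"
    assume cov: "A \<union> B \<subseteq> (\<Union>j. U j)" and U: "\<forall>j. bounded (U j) \<and> diameter (U j) \<le> \<delta>"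
    have one: "U j \<inter> A = {} \<or> U j \<inter> B = {}" for j
    proof (rule ccontr)
      assume "\<not> ?thesis"
      then obtain x y where "x \<in> U j" "x \<in> A" "y \<in> U j" "y \<in> B" by blast
      then have "d \<le> dist x y" "dist x y \<le> diameter (U j)"
        using sep diameter_bounded_bound U by blast+
      then show False using U \<open>\<delta> < d\<close> by (meson leD le_less_trans order_trans)
    qed
    have "hausdorff_pre s \<delta> A \<le> (\<Sum>j. hausdorff_gauge s (if U j \<inter> A = {} then {} else U j))"
      unfolding hausdorff_pre_def using cov U \<open>0 < \<delta>\<close>
      by (intro INF_lower) (auto split: if_splits, blast)
    moreover have "hausdorff_pre s \<delta> B \<le> (\<Sum>j. hausdorff_gauge s (if U j \<inter> B = {} then {} else U j))"
      unfolding hausdorff_pre_def using cov U \<open>0 < \<delta>\<close>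
      by (intro INF_lower) (auto split: if_splits, blast)
    ultimately have "hausdorff_pre s \<delta> A + hausdorff_pre s \<delta> B
      \<le> (\<Sum>j. hausdorff_gauge s (if U j \<inter> A = {} then {} else U j) + hausdorff_gauge s (if U j \<inter> B = {} then {} else U j))"
      by (subst suminf_add[symmetric]) (auto intro: add_mono)
    also have "\<dots> \<le> (\<Sum>j. hausdorff_gauge s (U j))"
      using one by (intro suminf_le) (auto simp: hausdorff_gauge_def)
    finally show "hausdorff_pre s \<delta> A + hausdorff_pre s \<delta> B \<le> (\<Sum>j. hausdorff_gauge s (U j))" .
  qed
  have "hausdorff_pre s a A + hausdorff_pre s b B \<le> hausdorff_outer s (A \<union> B)" if "a > 0" "b > 0" for a b
  proof -
    let ?m = "min (min a b) (d/2)"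
    have "hausdorff_pre s a A + hausdorff_pre s b B \<le> hausdorff_pre s ?m A + hausdorff_pre s ?m B"
      by (intro add_mono hausdorff_pre_antimono_scale) auto
    also have "\<dots> \<le> hausdorff_pre s ?m (A \<union> B)" using that \<open>d > 0\<close> by (intro pre) auto
    also have "\<dots> \<le> hausdorff_outer s (A \<union> B)"
      unfolding hausdorff_outer_def using that \<open>d > 0\<close> by (intro SUP_upper) auto
    finally show ?thesis .
  qed
  then have "hausdorff_pre s a A + hausdorff_outer s B \<le> hausdorff_outer s (A \<union> B)" if "a > 0" for a
    unfolding hausdorff_outer_def[of s B] using that
    by (subst ennreal_SUP_add_right) (auto intro!: SUP_least)
  then show ?thesis
    unfolding hausdorff_outer_def[of s A]
    by (subst ennreal_SUP_add_left[symmetric]) (auto intro!: SUP_least)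
qed

lemma outer_measure_binary_subadditive:
  fixes f :: "'a set \<Rightarrow> ennreal"
  assumes f0: "f {} = 0" and csub: "\<And>A :: nat \<Rightarrow> 'a set. f (\<Union>i. A i) \<le> (\<Sum>i. f (A i))"
  shows "f (A \<union> B) \<le> f A + f B"
proof -
  have "A \<union> B = (\<Union>i::nat. if i = 0 then A else if i = 1 then B else {})"
    by (auto split: if_splits intro: exI[of _ 0] exI[of _ 1])
  then have "f (A \<union> B) \<le> (\<Sum>i::nat. f (if i = 0 then A else if i = 1 then B else {}))"
    using csub by metis
  also have "\<dots> = (\<Sum>i\<in>{0,1::nat}. f (if i = 0 then A else if i = 1 then B else {}))"
    by (rule suminf_finite) (auto simp: f0)
  finally show ?thesis by simp
qed

text \<open>
  The hard half of Caratheodory's criterion. Exhaust \<open>T - F\<close> by the points at distance at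
  least \<open>1 / (k + 1)\<close> from \<open>F\<close>; these are separated from \<open>T \<inter> F\<close>. What is left over is a union
  of thin layers. The total measure of the layers is finite, because those with even index are
  mutually separated, and likewise those with odd index, so the tail is negligible.
\<close>

lemma metric_outer_measure_closed:
  fixes f :: "'a::metric_space set \<Rightarrow> ennreal"
  assumes f0: "f {} = 0" and mono: "\<And>A B. A \<subseteq> B \<Longrightarrow> f A \<le> f B"
    and csub: "\<And>A :: nat \<Rightarrow> 'a set. f (\<Union>i. A i) \<le> (\<Sum>i. f (A i))"
    and sep: "\<And>A B d. d > 0 \<Longrightarrow> (\<And>x y. x \<in> A \<Longrightarrow> y \<in> B \<Longrightarrow> d \<le> dist x y) \<Longrightarrow> f A + f B \<le> f (A \<union> B)"
    and "closed F"
  shows "f (T \<inter> F) + f (T - F) \<le> f T"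
proof (cases "F = {} \<or> f T = top")
  case True
  then show ?thesis by (auto simp: f0)
next
  case False
  then have "F \<noteq> {}" and fin: "f T < top" by (auto simp: less_top)
  note sub2 = outer_measure_binary_subadditive[of f, OF f0 csub]
  define a where "a k = 1 / (real k + 1)" for k
  have a_anti: "i \<le> j \<Longrightarrow> a j \<le> a i" for i j by (simp add: a_def frac_le)
  have a_less: "a (Suc i) < a i" for i by (simp add: a_def divide_strict_left_mono)
  define S where "S k = {x \<in> T. a k \<le> infdist x F}" for k
  define R where "R k = {x \<in> T. a (Suc k) \<le> infdist x F \<and> infdist x F < a k}" for k
  (* Layers whose indices differ by at least 2 lie at a positive distance from each other. *)
  have sepR: "f (\<Union>j\<in>{..<n}. R (2*j+c)) \<ge> (\<Sum>j<n. f (R (2*j+c)))" for n c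
  proof (induction n)
    case (Suc n)
    have "f (\<Union>j\<in>{..<n}. R (2*j+c)) + f (R (2*n+c)) \<le> f ((\<Union>j\<in>{..<n}. R (2*j+c)) \<union> R (2*n+c))"
    proof (cases n)
      case 0 then show ?thesis by (simp add: f0)
    next
      case (Suc m)
      show ?thesis
      proof (rule sep)
        show "0 < a (2*m+c+1) - a (2*n+c)" using a_less[of "2*m+c+1"] Suc by simp
        fix x y assume "x \<in> (\<Union>j\<in>{..<n}. R (2*j+c))" "y \<in> R (2*n+c)"
        then obtain j where j: "j \<le> m" "x \<in> R (2*j+c)" using Suc by (auto simp: less_Suc_eq_le)
        then have "a (2*m+c+1) \<le> infdist x F" unfolding R_def
          using a_anti[of "Suc (2*j+c)" "2*m+c+1"] by auto
        moreover have "infdist y F < a (2*n+c)" using \<open>y \<in> _\<close> by (auto simp: R_def)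
        moreover have "infdist x F \<le> infdist y F + dist x y" by (rule infdist_triangle)
        ultimately show "a (2*m+c+1) - a (2*n+c) \<le> dist x y" by linarith
      qed
    qed
    moreover have "(\<Union>j\<in>{..<n}. R (2*j+c)) \<union> R (2*n+c) = (\<Union>j\<in>{..<Suc n}. R (2*j+c))"
      by (auto simp: less_Suc_eq)
    ultimately show ?case using Suc.IH by (auto simp: add.commute intro: order_trans add_left_mono)
  qed (simp add: f0)
  have half: "(\<Sum>j<n. f (R (2*j+c))) \<le> f T" for n c
    by (rule order_trans[OF sepR mono]) (auto simp: R_def)
  have "(\<Sum>j<n. f (R j)) \<le> 2 * f T" for n
  proof -
    have "(\<Sum>j<n. f (R j)) \<le> (\<Sum>j<2*n. f (R j))" by (intro sum_mono2) auto
    also have "\<dots> = (\<Sum>j<n. f (R (2*j+0)) + f (R (2*j+1)))"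
      by (induction n) (auto simp: algebra_simps)
    also have "\<dots> \<le> f T + f T" unfolding sum.distrib by (intro add_mono half)
    finally show ?thesis by (simp add: mult_2)
  qed
  then have "(\<Sum>j. f (R j)) \<le> 2 * f T" by (intro suminf_le_const) auto
  then have tot: "(\<Sum>j. f (R j)) < top"
    using fin by (auto simp: ennreal_mult_less_top intro: le_less_trans)
  define r where "r j = enn2real (f (R j))" for j
  have r: "f (R j) = ennreal (r j)" for j
    unfolding r_def using ennreal_suminf_lessD[OF tot] by (simp add: less_top)
  have r0: "r j \<ge> 0" for j by (simp add: r_def)
  have sr: "summable r" using tot r0 unfolding r by (metis summable_suminf_not_top less_top)
  show ?thesis
  proof (rule ennreal_le_epsilon)
    fix e :: real assume "e > 0"
    then obtain N where N: "norm (\<Sum>j. r (j + N)) < e"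
      using suminf_exist_split[OF _ sr] by blast
    have tail: "(\<Sum>j. f (R (j + N))) \<le> ennreal e"
      unfolding r using N r0 sr summable_iff_shift[of r N]
      by (subst suminf_ennreal2) (auto intro!: ennreal_leI)
    have "T - F \<subseteq> S N \<union> (\<Union>j. R (j + N))"
    proof
      fix x assume x: "x \<in> T - F"
      then have pos: "infdist x F > 0"
        using \<open>closed F\<close> \<open>F \<noteq> {}\<close> by (simp add: infdist_pos_not_in_closed)
      show "x \<in> S N \<union> (\<Union>j. R (j + N))"
      proof (cases "a N \<le> infdist x F")
        case False
        have ex: "\<exists>k. a k \<le> infdist x F"
        proof -
          obtain k where "inverse (real (Suc k)) < infdist x F"
            using reals_Archimedean[OF pos] by blast
          then show ?thesis by (intro exI[of _ k]) (simp add: a_def inverse_eq_divide add.commute)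
        qed
        define k where "k = (LEAST k. a k \<le> infdist x F)"
        have k: "a k \<le> infdist x F" unfolding k_def by (rule LeastI_ex[OF ex])
        have "k > N" using k False a_anti[of k N] by (meson leI order_trans)
        then obtain m where m: "k = Suc m" "m \<ge> N" by (cases k) auto
        have "\<not> a m \<le> infdist x F" using m not_less_Least[of m] unfolding k_def[symmetric]
          by (metis k_def lessI)
        then have "x \<in> R m" using k m x by (auto simp: R_def)
        then show ?thesis using m(2) by (auto intro!: exI[of _ "m - N"])
      qed (use x in \<open>auto simp: S_def\<close>)
    qed
    then have "f (T - F) \<le> f (S N) + f (\<Union>j. R (j + N))" using mono sub2 order_trans by blast
    also have "\<dots> \<le> f (S N) + ennreal e" using csub[of "\<lambda>j. R (j+N)"] tail by (meson add_left_mono order_trans)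
    finally have "f (T \<inter> F) + f (T - F) \<le> f (T \<inter> F) + f (S N) + ennreal e"
      by (metis add.assoc add_left_mono)
    also have "f (T \<inter> F) + f (S N) \<le> f ((T \<inter> F) \<union> S N)"
    proof (rule sep)
      show "a N > 0" by (simp add: a_def)
      fix x y assume "x \<in> T \<inter> F" "y \<in> S N"
      then show "a N \<le> dist x y"
        using infdist_le[of x F y] by (auto simp: S_def dist_commute)
    qed
    also have "f ((T \<inter> F) \<union> S N) \<le> f T" by (rule mono) (auto simp: S_def)
    finally show "f (T \<inter> F) + f (T - F) \<le> f T + ennreal e" by (simp add: add_right_mono)
  qed
qed

text \<open>
  Closed sets satisfy Caratheodory's criterion, and the sets that satisfy it form a
  \<open>\<sigma>\<close>-algebra.
\<close>

lemma metric_outer_measure_space: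
  fixes f :: "'a::metric_space set \<Rightarrow> ennreal"
  assumes f0: "f {} = 0" and mono: "\<And>A B. A \<subseteq> B \<Longrightarrow> f A \<le> f B"
    and csub: "\<And>A :: nat \<Rightarrow> 'a set. f (\<Union>i. A i) \<le> (\<Sum>i. f (A i))"
    and sep: "\<And>A B d. d > 0 \<Longrightarrow> (\<And>x y. x \<in> A \<Longrightarrow> y \<in> B \<Longrightarrow> d \<le> dist x y) \<Longrightarrow> f A + f B \<le> f (A \<union> B)"
  shows "measure_space UNIV (sets borel) f"
proof -
  interpret P: sigma_algebra UNIV "Pow UNIV :: 'a set set" by (rule sigma_algebra_Pow)
  let ?L = "lambda_system UNIV (Pow UNIV) f"
  have ms: "measure_space UNIV ?L f" by (rule P.caratheodory_lemma)
       (auto simp: outer_measure_space_def positive_def increasing_def countably_subadditive_def f0 intro: mono csub)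
  note sub2 = outer_measure_binary_subadditive[of f, OF f0 csub]
  have "F \<in> ?L" if "closed F" for F
    unfolding P.lambda_system_eq
  proof safe
    fix T :: "'a set"
    have "f T \<le> f (T \<inter> F) + f (T - F)" using sub2[of "T \<inter> F" "T - F"] by (simp add: Int_Diff_Un)
    moreover have "f (T \<inter> F) + f (T - F) \<le> f T"
      by (rule metric_outer_measure_closed[of f F T]) (fact f0, fact mono, fact csub, fact sep, fact that)
    ultimately show "f (T \<inter> F) + f (T - F) = f T" by (rule antisym[rotated])
  qed auto
  then have "sigma_sets UNIV {S. closed S} \<subseteq> ?L"
    using ms by (intro sigma_algebra.sigma_sets_subset) (auto simp: measure_space_def)
  then have sub: "sets borel \<subseteq> ?L" by (simp add: borel_eq_closed sets_measure_of)
  then show ?thesis using ms unfolding measure_space_def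
    by (auto simp: sets.sigma_algebra_axioms[of borel, simplified] positive_def countably_additive_def subset_iff)
qed

lemma sets_hausdorff_measure [simp, measurable_cong]: "sets (hausdorff_measure s) = sets borel"
  unfolding hausdorff_measure_def by (metis sets.sets_measure_of_eq space_borel)

lemma space_hausdorff_measure [simp]: "space (hausdorff_measure s) = UNIV"
  using sets_eq_imp_space_eq[OF sets_hausdorff_measure] by simp

text \<open>
  \<open>measure_of\<close> yields the null measure when its argument is not countably additive, so this
  identity is what gives the definition its intended meaning.
\<close>

lemma emeasure_hausdorff_measure:
  assumes "A \<in> sets borel"
  shows "emeasure (hausdorff_measure s) A = hausdorff_outer s A"
proof -
  have "measure_space UNIV (sets borel) (hausdorff_outer s :: 'a set \<Rightarrow> ennreal)"
    by (rule metric_outer_measure_space[OF hausdorff_outer_empty hausdorff_outer_mono hausdorff_outer_UN hausdorff_outer_separated])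
  then show ?thesis
    using assms unfolding hausdorff_measure_def measure_space_def
    by (intro emeasure_measure_of_sigma) auto
qed

section \<open>Invariance under orthogonal maps\<close>

lemma diameter_isometry_image:
  assumes "\<And>x y. dist (T x) (T y) = dist x y"
  shows "diameter (T ` U) = diameter U"
proof -
  have "(\<lambda>(x, y). dist x y) ` (T ` U \<times> T ` U) = (\<lambda>(x, y). dist x y) ` (U \<times> U)"
    using assms by (auto simp: image_iff) (metis, blast)
  then show ?thesis by (simp add: diameter_def)
qed

lemma hausdorff_outer_isometry_image_le:
  assumes T: "\<And>x y. dist (T x) (T y) = dist x y"
  shows "hausdorff_outer s (T ` A) \<le> hausdorff_outer s A"
  unfolding hausdorff_outer_def
proof (rule SUP_mono, rule bexI)
  fix \<delta> :: real assume "\<delta> \<in> {0<..}"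
  show "hausdorff_pre s \<delta> (T ` A) \<le> hausdorff_pre s \<delta> A"
    unfolding hausdorff_pre_def[of _ _ A]
  proof (rule INF_greatest, safe)
    fix U :: "nat \<Rightarrow> 'a set"
    assume U: "A \<subseteq> (\<Union>j. U j)" "\<forall>j. bounded (U j) \<and> diameter (U j) \<le> \<delta>"
    have diam: "diameter (T ` U j) = diameter (U j)" for j
      by (rule diameter_isometry_image) (rule T)
    have "bounded (T ` U j)" for j
      using U(2) T unfolding bounded_def by (metis (no_types, opaque_lifting) image_iff)
    then have "hausdorff_pre s \<delta> (T ` A) \<le> (\<Sum>j. hausdorff_gauge s (T ` U j))"
      unfolding hausdorff_pre_def using U
      by (intro INF_lower) (auto simp: diam, blast)
    also have "\<dots> = (\<Sum>j. hausdorff_gauge s (U j))"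
      by (simp add: hausdorff_gauge_def diam cong: if_cong)
    finally show "hausdorff_pre s \<delta> (T ` A) \<le> (\<Sum>j. hausdorff_gauge s (U j))" .
  qed
qed

lemma hausdorff_outer_orthogonal_vimage:
  fixes T :: "'a::euclidean_space \<Rightarrow> 'a"
  assumes T: "orthogonal_transformation T"
  shows "hausdorff_outer s (T -` A) = hausdorff_outer s A"
proof (rule antisym)
  have iso: "dist (S x) (S y) = dist x y" if "orthogonal_transformation S" for S :: "'a \<Rightarrow> 'a" and x y
    using that by (metis dist_norm linear_diff orthogonal_transformation)
  have vim: "T -` A = inv T ` A"
    using orthogonal_transformation_bij[OF T] by (simp add: bij_vimage_eq_inv_image)
  show "hausdorff_outer s (T -` A) \<le> hausdorff_outer s A"
    unfolding vim using iso[OF orthogonal_transformation_inv[OF T]]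
    by (rule hausdorff_outer_isometry_image_le)
  have "T ` (T -` A) = A"
    using orthogonal_transformation_surj[OF T] by (rule surj_image_vimage_eq)
  then show "hausdorff_outer s A \<le> hausdorff_outer s (T -` A)"
    using hausdorff_outer_isometry_image_le[of T s "T -` A"] iso[OF T] by simp
qed

lemma borel_measurable_orthogonal:
  fixes T :: "'a::euclidean_space \<Rightarrow> 'a"
  assumes "orthogonal_transformation T"
  shows "T \<in> borel_measurable borel"
  by (intro borel_measurable_continuous_onI linear_continuous_on)
     (use assms in \<open>simp add: orthogonal_transformation_linear linear_conv_bounded_linear[symmetric]\<close>)

lemma distr_hausdorff_orthogonal:
  fixes T :: "'a::euclidean_space \<Rightarrow> 'a"
  assumes T: "orthogonal_transformation T"
  shows "distr (hausdorff_measure s) borel T = hausdorff_measure s"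
proof (rule measure_eqI)
  have [measurable]: "T \<in> borel_measurable borel" by (rule borel_measurable_orthogonal[OF T])
  fix A assume "A \<in> sets (distr (hausdorff_measure s) borel T)"
  then have A: "A \<in> sets borel" by simp
  then have "T -` A \<in> sets borel" using measurable_sets_borel[of T borel A] by simp
  then show "emeasure (distr (hausdorff_measure s) borel T) A = emeasure (hausdorff_measure s) A"
    using A by (simp add: emeasure_distr emeasure_hausdorff_measure hausdorff_outer_orthogonal_vimage[OF T])
qed simp

lemma nn_integral_lborel_shift:
  fixes f :: "'a::euclidean_space \<Rightarrow> ennreal"
  assumes [measurable]: "f \<in> borel_measurable borel"
  shows "(\<integral>\<^sup>+x. f (a + x) \<partial>lborel) = (\<integral>\<^sup>+x. f x \<partial>lborel)"
  by (subst (2) lborel_distr_plus[of a, symmetric]) (simp add: nn_integral_distr)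

lemma nn_integral_lborel_reflect:
  fixes f :: "'a::euclidean_space \<Rightarrow> ennreal"
  assumes [measurable]: "f \<in> borel_measurable borel"
  shows "(\<integral>\<^sup>+x. f (a - x) \<partial>lborel) = (\<integral>\<^sup>+x. f x \<partial>lborel)"
  by (subst (2) lborel_affine[of "-1" a]) (simp_all add: nn_integral_distr density_1)

text \<open>
  Uniqueness of the translation invariant measure, by integrating \<open>1\<^sub>A(y) 1\<^sub>B(x + y)\<close> in both
  orders. This gives the orthogonal invariance of Lebesgue measure on an arbitrary Euclidean
  space without matrices.
\<close>

lemma translation_invariant_measure_eq_lborel:
  fixes N :: "'a::euclidean_space measure"
  assumes sets [simp, measurable_cong]: "sets N = sets borel" and "sigma_finite_measure N"
    and trans: "\<And>c. distr N borel ((+) c) = N"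
    and B: "emeasure N (ball 0 1) = emeasure lborel (ball (0::'a) 1)"
  shows "N = lborel"
proof (rule measure_eqI)
  interpret N: sigma_finite_measure N by fact
  interpret P: pair_sigma_finite lborel N ..
  fix A assume "A \<in> sets N"
  then have A [measurable]: "A \<in> sets borel" by simp
  have Nshift: "(\<integral>\<^sup>+y. f (c + y) \<partial>N) = (\<integral>\<^sup>+y. f y \<partial>N)" if [measurable]: "f \<in> borel_measurable borel" for f c
    by (subst (2) trans[of c, symmetric]) (simp add: nn_integral_distr)
  let ?B = "ball (0::'a) 1"
  have [measurable]: "?B \<in> sets borel" by simp
  (* Both sides below are values of the same double integral; on the way y is replaced by y - x in the
     inner integral over N, and x by y - x in the one over Lebesgue measure. *)
  have "emeasure N A * emeasure lborel ?B
      = (\<integral>\<^sup>+y. indicator A y * (\<integral>\<^sup>+x. indicator ?B (y + x) \<partial>lborel) \<partial>N)"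
    using nn_integral_lborel_shift[of "indicator ?B", OF borel_measurable_indicator]
    by (simp add: nn_integral_multc \<open>A \<in> sets N\<close>)
  also have "\<dots> = (\<integral>\<^sup>+y. (\<integral>\<^sup>+x. indicator A y * indicator ?B (y + x) \<partial>lborel) \<partial>N)"
    by (intro nn_integral_cong nn_integral_cmult[symmetric]) measurable
  also have "\<dots> = (\<integral>\<^sup>+x. (\<integral>\<^sup>+y. indicator A y * indicator ?B (y + x) \<partial>N) \<partial>lborel)"
    by (rule P.Fubini') simp
  also have "\<dots> = (\<integral>\<^sup>+x. (\<integral>\<^sup>+y. indicator A (y - x) * indicator ?B y \<partial>N) \<partial>lborel)"
  proof (rule nn_integral_cong)
    fix x
    show "(\<integral>\<^sup>+y. indicator A y * indicator ?B (y + x) \<partial>N) = (\<integral>\<^sup>+y. indicator A (y - x) * indicator ?B y \<partial>N)"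
      using Nshift[of "\<lambda>y. indicator A (y - x) * indicator ?B y" x] by (simp add: add.commute)
  qed
  also have "\<dots> = (\<integral>\<^sup>+y. (\<integral>\<^sup>+x. indicator A (y - x) * indicator ?B y \<partial>lborel) \<partial>N)"
    by (rule P.Fubini'[symmetric]) simp
  also have "\<dots> = (\<integral>\<^sup>+y. emeasure lborel A * indicator ?B y \<partial>N)"
    by (simp add: nn_integral_multc nn_integral_lborel_reflect[of "indicator A"])
  also have "\<dots> = emeasure lborel A * emeasure N ?B" by (simp add: nn_integral_cmult)
  finally have "emeasure N A * emeasure lborel ?B = emeasure lborel A * emeasure lborel ?B"
    by (simp add: B)
  moreover have "emeasure lborel ?B \<noteq> 0" "emeasure lborel ?B \<noteq> top"
    using emeasure_lborel_ball_finite[of "0::'a" 1]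
    by (auto simp: emeasure_ball less_top unit_ball_vol_def Gamma_eq_zero_iff)
  ultimately show "emeasure N A = emeasure lborel A"
    by (simp add: mult.commute[of _ "emeasure lborel ?B"] ennreal_mult_cancel_left)
qed (simp add: sets)

lemma distr_lborel_orthogonal:
  fixes T :: "'a::euclidean_space \<Rightarrow> 'a"
  assumes T: "orthogonal_transformation T"
  shows "distr lborel borel T = lborel"
proof (rule translation_invariant_measure_eq_lborel)
  have [measurable]: "T \<in> borel_measurable borel" by (rule borel_measurable_orthogonal[OF T])
  have vim: "T -` ball 0 r = ball 0 r" for r
    using orthogonal_transformation_norm[OF T] by (auto simp: dist_norm)
  have em: "emeasure (distr lborel borel T) (ball 0 r) = emeasure lborel (ball (0::'a) r)" for r
    by (simp add: emeasure_distr vim)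
  show "emeasure (distr lborel borel T) (ball 0 1) = emeasure lborel (ball (0::'a) 1)" by (rule em)
  show "sets (distr lborel borel T) = sets borel" by simp
  show "sigma_finite_measure (distr lborel borel T)"
  proof
    let ?A = "range (\<lambda>n::nat. ball (0::'a) (real n))"
    have "\<Union> ?A = UNIV" by (auto simp: reals_Archimedean2)
    then show "\<exists>A. countable A \<and> A \<subseteq> sets (distr lborel borel T) \<and> \<Union> A = space (distr lborel borel T) \<and>
          (\<forall>a\<in>A. emeasure (distr lborel borel T) a \<noteq> \<infinity>)"
      using emeasure_lborel_ball_finite
      by (intro exI[of _ ?A]) (auto simp: em less_top)
  qed
  fix c
  have "distr (distr lborel borel T) borel ((+) c) = distr lborel borel (\<lambda>x. c + T x)"
    by (simp add: distr_distr comp_def)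
  also have "(\<lambda>x. c + T x) = (\<lambda>x. T (inv T c + x))"
    using orthogonal_transformation_linear[OF T] orthogonal_transformation_surj[OF T]
    by (simp add: linear_add surj_f_inv_f)
  also have "distr lborel borel (\<lambda>x. T (inv T c + x)) = distr (distr lborel borel ((+) (inv T c))) borel T"
    by (simp add: distr_distr comp_def)
  finally show "distr (distr lborel borel T) borel ((+) c) = distr lborel borel T"
    by (simp add: lborel_distr_plus)
qed

text \<open>
  The reflection that exchanges \<open>u\<close> and \<open>v\<close>.
\<close>

lemma orthogonal_transformation_between_unit_vectors:
  fixes u v :: "'a::euclidean_space"
  assumes "norm u = 1" "norm v = 1"
  obtains T where "orthogonal_transformation T" "T u = v"
proof (cases "u = v")
  case True
  then show ?thesis using that[of "\<lambda>x. x"] by simp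
next
  case False
  define w where "w = u - v"
  define T where "T x = x - (2 * (x \<bullet> w) / (w \<bullet> w)) *\<^sub>R w" for x
  have w: "w \<bullet> w \<noteq> 0" using False by (simp add: w_def)
  have uv: "u \<bullet> u = 1" "v \<bullet> v = 1" using assms by (simp_all add: dot_square_norm)
  show ?thesis
  proof
    show "orthogonal_transformation T"
      unfolding orthogonal_transformation_def
    proof (intro conjI allI)
      show "linear T"
        by (rule linearI) (auto simp: T_def algebra_simps inner_add_left add_divide_distrib scaleR_add_left)
      fix x y show "T x \<bullet> T y = x \<bullet> y"
        using w by (simp add: T_def inner_diff_left inner_diff_right inner_commute field_simps)
    qed
    have ww: "w \<bullet> w = 2 * (u \<bullet> w)" using uv by (simp add: w_def inner_diff_left inner_diff_right inner_commute)
    have eq1: "2 * (u \<bullet> w) / (w \<bullet> w) = 1" using w unfolding ww[symmetric] by (rule divide_self)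
    have "T u = u - w" unfolding T_def eq1 by simp
    then show "T u = v" by (simp add: w_def)
  qed
qed

section \<open>The Hausdorff measure of the unit sphere\<close>

lemma power_diff_le:
  fixes a b :: real
  assumes "0 \<le> b" "b \<le> a" "a \<le> 2"
  shows "a ^ n - b ^ n \<le> (a - b) * (real n * 2 ^ (n - 1))"
proof -
  have "a ^ n - b ^ n = (a - b) * (\<Sum>i<n. b ^ (n - Suc i) * a ^ i)" by (rule power_diff_sumr2)
  also have "\<dots> \<le> (a - b) * (\<Sum>i<n. 2 ^ (n - 1))"
  proof (intro mult_left_mono sum_mono)
    fix i assume "i \<in> {..<n}"
    have "b ^ (n - Suc i) * a ^ i \<le> 2 ^ (n - Suc i) * 2 ^ i"
      using assms by (intro mult_mono power_mono) auto
    also have "\<dots> = 2 ^ (n - 1)" using \<open>i \<in> {..<n}\<close> by (simp flip: power_add)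
    finally show "b ^ (n - Suc i) * a ^ i \<le> 2 ^ (n - 1)" .
  qed (use assms in auto)
  finally show ?thesis by simp
qed

lemma unit_ball_vol_nat_pos: "unit_ball_vol (real n) > 0"
  by (simp add: unit_ball_vol_def Gamma_real_pos)

text \<open>
  Balls of radius \<open>\<delta>/2\<close> around the points are disjoint and lie in a shell of width \<open>\<delta>\<close> around
  the sphere; compare volumes.
\<close>

lemma card_separated_sphere_le:
  fixes X :: "'a::euclidean_space set"
  assumes X: "finite X" "X \<subseteq> sphere 0 1" and sep: "\<And>x y. x \<in> X \<Longrightarrow> y \<in> X \<Longrightarrow> x \<noteq> y \<Longrightarrow> \<delta> \<le> dist x y"
    and \<delta>: "0 < \<delta>" "\<delta> \<le> 1"
  shows "real (card X) * \<delta> ^ (DIM('a) - 1) \<le> real DIM('a) * 2 ^ (DIM('a) - 1) * 2 ^ DIM('a)"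
proof -
  let ?d = "DIM('a)" let ?V = "unit_ball_vol (real DIM('a))"
  have V: "?V > 0" by (rule unit_ball_vol_nat_pos)
  let ?B = "\<Union>x\<in>X. ball x (\<delta>/2)"
  have disj: "disjoint_family_on (\<lambda>x. ball x (\<delta>/2)) X"
    unfolding disjoint_family_on_def
  proof safe
    fix x y z assume "x \<in> X" "y \<in> X" "x \<noteq> y" and z: "z \<in> ball x (\<delta>/2)" "z \<in> ball y (\<delta>/2)"
    then have "\<delta> \<le> dist x y" using sep by blast
    moreover have "dist x y \<le> dist x z + dist y z" by (rule dist_triangle2)
    ultimately show "z \<in> {}" using z by (auto simp: dist_commute)
  qed
  have sub: "?B \<subseteq> cball 0 (1 + \<delta>/2) - ball 0 (1 - \<delta>/2)"
  proof safe
    fix x z assume "x \<in> X" and z: "z \<in> ball x (\<delta>/2)"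
    then have x: "norm x = 1" using X by auto
    have "norm (x - z) < \<delta>/2" using z by (simp add: dist_norm)
    then show "z \<in> cball 0 (1 + \<delta>/2)" using norm_triangle_ineq3[of z x] x by (simp add: norm_minus_commute)
    assume "z \<in> ball 0 (1 - \<delta>/2)"
    then show False using norm_triangle_ineq2[of x z] x \<open>norm (x - z) < \<delta>/2\<close> by simp
  qed
  have "real (card X) * (?V * (\<delta>/2)^?d) = (\<Sum>x\<in>X. measure lborel (ball x (\<delta>/2)))"
    using \<delta> by (simp add: content_ball)
  also have "\<dots> = measure lborel ?B"
    using disj X(1) emeasure_lborel_ball_finite by (intro measure_finite_Union[symmetric]) (auto simp: less_top)
  also have "\<dots> \<le> measure lborel (cball 0 (1 + \<delta>/2) - ball (0::'a) (1 - \<delta>/2))"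
    using sub emeasure_lborel_cball_finite[of "0::'a" "1+\<delta>/2"]
      emeasure_lborel_ball_finite[of "0::'a" "1-\<delta>/2"]
    by (intro measure_mono_fmeasurable fmeasurable.Diff) (auto simp: fmeasurable_def intro!: borel_open open_UN)
  also have "\<dots> = measure lborel (cball (0::'a) (1 + \<delta>/2)) - measure lborel (ball (0::'a) (1 - \<delta>/2))"
    using emeasure_lborel_cball_finite[of "0::'a" "1+\<delta>/2"] \<delta> by (intro measure_Diff) (auto simp: less_top)
  also have "\<dots> = ?V * ((1 + \<delta>/2)^?d - (1 - \<delta>/2)^?d)"
    using \<delta> by (simp add: content_ball content_cball algebra_simps)
  also have "\<dots> \<le> ?V * (((1 + \<delta>/2) - (1 - \<delta>/2)) * (real ?d * 2 ^ (?d - 1)))"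
    using \<delta> V by (intro mult_left_mono power_diff_le) auto
  finally have "?V * (real (card X) * (\<delta>/2)^?d) \<le> ?V * (\<delta> * (real ?d * 2 ^ (?d - 1)))"
    by (simp add: algebra_simps)
  then have "real (card X) * (\<delta>/2)^?d \<le> \<delta> * (real ?d * 2 ^ (?d - 1))" using V by simp
  then have "real (card X) * \<delta>^?d \<le> \<delta> * (real ?d * 2 ^ (?d - 1) * 2 ^ ?d)"
    by (simp add: power_divide field_simps)
  moreover have "\<delta>^?d = \<delta> * \<delta>^(?d - 1)" by (simp add: power_eq_if)
  ultimately have "\<delta> * (real (card X) * \<delta>^(?d - 1)) \<le> \<delta> * (real ?d * 2 ^ (?d - 1) * 2 ^ ?d)"
    by (simp add: algebra_simps)
  then show ?thesis using \<delta> by simp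
qed

text \<open>
  A separated set of maximal cardinality is a \<open>\<delta>\<close>-net.
\<close>

lemma sphere_cover_finite_balls:
  assumes \<delta>: "0 < \<delta>" "\<delta> \<le> 1"
  obtains X :: "'a::euclidean_space set" where "finite X" "sphere 0 1 \<subseteq> (\<Union>x\<in>X. ball x \<delta>)"
    "real (card X) * \<delta> ^ (DIM('a) - 1) \<le> real DIM('a) * 2 ^ (DIM('a) - 1) * 2 ^ DIM('a)"
proof -
  define C where "C = real DIM('a) * 2 ^ (DIM('a) - 1) * 2 ^ DIM('a)"
  define P where "P X \<longleftrightarrow> finite X \<and> X \<subseteq> sphere (0::'a) 1 \<and> (\<forall>x\<in>X. \<forall>y\<in>X. x \<noteq> y \<longrightarrow> \<delta> \<le> dist x y)" for X
  have card: "real (card X) * \<delta> ^ (DIM('a) - 1) \<le> C" if "P X" for X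
    using that \<delta> unfolding P_def C_def by (intro card_separated_sphere_le) auto
  define b where "b = nat \<lceil>C / \<delta> ^ (DIM('a) - 1)\<rceil>"
  have bound: "\<forall>X. P X \<longrightarrow> card X \<le> b"
  proof safe
    fix X assume "P X"
    then have "real (card X) \<le> C / \<delta> ^ (DIM('a) - 1)"
      using card \<delta> by (simp add: field_simps)
    then show "card X \<le> b" unfolding b_def by linarith
  qed
  have "P {}" by (simp add: P_def)
  then obtain X where X: "P X" and max: "\<forall>Y. P Y \<longrightarrow> card Y \<le> card X"
    using Lattices_Big.ex_has_greatest_nat[of P "{}" card "Suc b"] bound by (auto simp: less_Suc_eq_le)
  have "sphere 0 1 \<subseteq> (\<Union>x\<in>X. ball x \<delta>)"
  proof
    fix y :: 'a assume y: "y \<in> sphere 0 1"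
    show "y \<in> (\<Union>x\<in>X. ball x \<delta>)"
    proof (rule ccontr)
      assume n: "y \<notin> (\<Union>x\<in>X. ball x \<delta>)"
      then have "P (insert y X)" using X y unfolding P_def by (auto simp: dist_commute)
      moreover have "y \<notin> X" using n \<delta> by auto
      moreover have "finite X" using X by (simp add: P_def)
      ultimately show False using max[rule_format, of "insert y X"] by simp
    qed
  qed
  moreover have "finite X" using X by (simp add: P_def)
  ultimately show ?thesis using that card[OF X] unfolding C_def by blast
qed

lemma hausdorff_outer_sphere_finite:
  "hausdorff_outer (DIM('a) - 1) (sphere (0::'a::euclidean_space) 1) < top"
proof -
  let ?d = "DIM('a) - 1"
  define C where "C = unit_ball_vol (real ?d) * (real DIM('a) * 2 ^ (DIM('a) - 1) * 2 ^ DIM('a))"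
  have V: "unit_ball_vol (real ?d) > 0" by (rule unit_ball_vol_nat_pos)
  have pre: "hausdorff_pre ?d \<delta> (sphere (0::'a) 1) \<le> ennreal C" if "\<delta> > 0" for \<delta>
  proof -
    define r where "r = min 1 (\<delta>/2)"
    have r: "0 < r" "r \<le> 1" "2 * r \<le> \<delta>" using that by (auto simp: r_def)
    obtain X :: "'a set" where X: "finite X" "sphere 0 1 \<subseteq> (\<Union>x\<in>X. ball x r)"
      and card: "real (card X) * r ^ ?d \<le> real DIM('a) * 2 ^ (DIM('a) - 1) * 2 ^ DIM('a)"
      using sphere_cover_finite_balls[OF r(1,2)] by metis
    obtain g where g: "bij_betw g {..<card X} X"
      using ex_bij_betw_nat_finite[OF X(1)] by (auto simp: atLeast0LessThan)
    define U where "U i = (if i < card X then ball (g i) r else {})" for i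
    have "hausdorff_pre ?d \<delta> (sphere (0::'a) 1) \<le> (\<Sum>i. hausdorff_gauge ?d (U i))"
      unfolding hausdorff_pre_def
    proof (rule INF_lower, safe)
      fix x :: 'a assume "x \<in> sphere 0 1"
      then obtain p where p: "p \<in> X" "x \<in> ball p r" using X by blast
      then obtain i where "i < card X" "g i = p" using bij_betw_imp_surj_on[OF g] by (metis imageE lessThan_iff)
      then have "x \<in> U i" using p by (simp add: U_def)
      then show "x \<in> (\<Union>i. U i)" by blast
    next
      fix i show "bounded (U i)" "diameter (U i) \<le> \<delta>" using r that by (auto simp: U_def)
    qed
    also have "\<dots> = (\<Sum>i<card X. hausdorff_gauge ?d (U i))"
      by (rule suminf_finite) (auto simp: U_def hausdorff_gauge_def)
    also have "\<dots> = (\<Sum>i<card X. ennreal (unit_ball_vol (real ?d) * r ^ ?d))"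
      using r by (intro sum.cong) (auto simp: U_def hausdorff_gauge_def)
    also have "\<dots> = ennreal (unit_ball_vol (real ?d) * (real (card X) * r ^ ?d))"
      using V r by (subst sum_ennreal) (auto simp: algebra_simps)
    also have "\<dots> \<le> ennreal C"
      unfolding C_def using card V by (intro ennreal_leI mult_left_mono) auto
    finally show ?thesis .
  qed
  have "hausdorff_outer ?d (sphere (0::'a) 1) \<le> ennreal C"
    unfolding hausdorff_outer_def by (rule SUP_least, rule pre) simp
  then show ?thesis by (simp add: le_less_trans)
qed

text \<open>
  The part of the cone over a set of diameter \<open>r\<close> on the sphere at heights in \<open>[1, 2]\<close> is
  covered by about \<open>1/r\<close> balls of radius \<open>3 r\<close>, hence has volume of order \<open>r\<close> to the power
  \<open>d - 1\<close>. This compares the gauge of a cover of the sphere with the volume of a spherical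
  shell.
\<close>

lemma cone_over_small_set:
  fixes U :: "'a::euclidean_space set"
  assumes U: "bounded U" "diameter U \<le> r" and r: "0 < r" "r \<le> 1"
  obtains B where "B \<in> sets borel" "{t *\<^sub>R x | t x. 1 \<le> t \<and> t \<le> 2 \<and> x \<in> U \<inter> sphere 0 1} \<subseteq> B"
    "emeasure lborel B \<le> ennreal (3 * 3 ^ DIM('a) * unit_ball_vol (real DIM('a)) * r ^ (DIM('a) - 1))"
proof (cases "U \<inter> sphere 0 1 = {}")
  case True
  then show ?thesis by (intro that[of "{}"]) auto
next
  case False
  then obtain p where p: "p \<in> U" "norm p = 1" by auto
  let ?V = "unit_ball_vol (real DIM('a))"
  have V: "?V > 0" by (rule unit_ball_vol_nat_pos)
  define N where "N = nat \<lceil>1 / r\<rceil>"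
  have "real N \<le> 1 / r + 1" using r by (simp add: N_def)
  also have "\<dots> \<le> 2 / r" using r by (simp add: field_simps)
  finally have N: "real (Suc N) \<le> 3 / r" using r by (simp add: field_simps)
  let ?B = "\<Union>j\<le>N. cball ((1 + real j * r) *\<^sub>R p) (3 * r)"
  show ?thesis
  proof (rule that[of ?B])
    show "?B \<in> sets borel" by auto
    have "emeasure lborel ?B \<le> (\<Sum>j\<le>N. emeasure lborel (cball ((1 + real j * r) *\<^sub>R p) (3 * r)))"
      by (rule emeasure_subadditive_finite) auto
    also have "\<dots> = ennreal (real (Suc N) * (?V * (3 * r) ^ DIM('a)))"
      using r V by (simp add: emeasure_cball ennreal_mult' ennreal_of_nat_eq_real_of_nat)
    also have "\<dots> \<le> ennreal (3 / r * (?V * (3 * r) ^ DIM('a)))"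
      using N V r by (intro ennreal_leI mult_right_mono) auto
    also have "r ^ DIM('a) = r * r ^ (DIM('a) - 1)" by (simp add: power_eq_if)
    then have "3 / r * (?V * (3 * r) ^ DIM('a)) = 3 * 3 ^ DIM('a) * ?V * r ^ (DIM('a) - 1)"
      using r by (simp add: power_mult_distrib)
    finally show "emeasure lborel ?B \<le> ennreal (3 * 3 ^ DIM('a) * ?V * r ^ (DIM('a) - 1))" .
    show "{t *\<^sub>R x | t x. 1 \<le> t \<and> t \<le> 2 \<and> x \<in> U \<inter> sphere 0 1} \<subseteq> ?B"
    proof safe
      fix t :: real and x assume t: "1 \<le> t" "t \<le> 2" and x: "x \<in> U" "x \<in> sphere 0 1"
      define j where "j = nat \<lfloor>(t - 1) / r\<rfloor>"
      have j: "real j \<le> (t - 1) / r" "(t - 1) / r < real j + 1" using t r by (auto simp: j_def)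
      have "(t - 1) / r \<le> 1 / r" using t r by (simp add: divide_right_mono)
      then have "j \<le> N" using t r unfolding j_def N_def
        by (intro nat_mono) linarith
      have h1: "\<bar>t - (1 + real j * r)\<bar> \<le> r" using j r by (simp add: field_simps)
      have h2: "norm (x - p) \<le> r"
        using diameter_bounded_bound[OF U(1) x(1) p(1)] U(2) by (simp add: dist_norm)
      have "(1 + real j * r) *\<^sub>R p - t *\<^sub>R x = ((1 + real j * r) - t) *\<^sub>R p - t *\<^sub>R (x - p)"
        by (simp add: algebra_simps)
      then have h3: "norm ((1 + real j * r) *\<^sub>R p - t *\<^sub>R x) \<le> \<bar>t - (1 + real j * r)\<bar> + t * norm (x - p)"
        using norm_triangle_ineq4[of "((1 + real j * r) - t) *\<^sub>R p" "t *\<^sub>R (x - p)"] p t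
        by (simp add: abs_minus_commute)
      have h4: "t * norm (x - p) \<le> 2 * r" using t h2 by (intro mult_mono) auto
      have "norm ((1 + real j * r) *\<^sub>R p - t *\<^sub>R x) \<le> r + 2 * r"
        by (rule order_trans[OF h3 add_mono[OF h1 h4]])
      then show "t *\<^sub>R x \<in> ?B" using \<open>j \<le> N\<close> by (auto simp: dist_norm)
    qed
  qed
qed

text \<open>
  The cones over the members of a cover of the sphere cover the shell between the radii \<open>1\<close>
  and \<open>2\<close>, whose volume is positive.
\<close>

lemma hausdorff_outer_sphere_pos:
  "hausdorff_outer (DIM('a) - 1) (sphere (0::'a::euclidean_space) 1) > 0"
proof -
  let ?d = "DIM('a) - 1" and ?V = "unit_ball_vol (real DIM('a))"
  (* C bounds the volume of a cone over a set of diameter r by C times r to the power d - 1;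
     the constant c expresses the same bound through the gauge. *)
  define \<omega> where "\<omega> = unit_ball_vol (real ?d)"
  define C where "C = 3 * 3 ^ DIM('a) * ?V"
  define c where "c = C * 2 ^ ?d / \<omega>"
  have V: "?V > 0" "\<omega> > 0" unfolding \<omega>_def by (rule unit_ball_vol_nat_pos)+
  then have C: "C > 0" "c > 0" by (auto simp: C_def c_def)
  let ?S = "sphere (0::'a) 1"
  let ?K = "\<lambda>U. {t *\<^sub>R x | t x. 1 \<le> t \<and> t \<le> 2 \<and> x \<in> U \<inter> ?S}"
  have shell: "ennreal ?V \<le> emeasure lborel (cball (0::'a) 2 - ball 0 1)"
  proof -
    have "emeasure lborel (cball (0::'a) 2 - ball 0 1) = ennreal (?V * 2 ^ DIM('a)) - ennreal ?V"
      using emeasure_lborel_ball_finite[of "0::'a" 1] V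
      by (subst emeasure_Diff) (auto simp: emeasure_cball emeasure_ball less_top ennreal_mult')
    also have "\<dots> = ennreal (?V * 2 ^ DIM('a) - ?V)" using V by (simp add: ennreal_minus)
    finally have "emeasure lborel (cball (0::'a) 2 - ball 0 1) = ennreal (?V * 2 ^ DIM('a) - ?V)" .
    moreover have "(2::real) ^ 1 \<le> 2 ^ DIM('a)" by (rule power_increasing) auto
    then have "?V * 2 \<le> ?V * 2 ^ DIM('a)" using V by simp
    ultimately show ?thesis by (simp add: ennreal_leI)
  qed
  have "ennreal (?V / c) \<le> hausdorff_pre ?d (1/2) ?S"
    unfolding hausdorff_pre_def
  proof (rule INF_greatest, safe)
    fix U :: "nat \<Rightarrow> 'a set"
    assume cov: "?S \<subseteq> (\<Union>j. U j)" and U: "\<forall>j. bounded (U j) \<and> diameter (U j) \<le> 1/2"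
    have "ennreal ?V \<le> ennreal c * (\<Sum>j. hausdorff_gauge ?d (U j))"
    proof (rule ennreal_le_epsilon)
      fix e :: real assume "e > 0"
      have "\<exists>B. B \<in> sets borel \<and> ?K (U j) \<subseteq> B \<and>
          emeasure lborel B \<le> ennreal c * hausdorff_gauge ?d (U j) + ennreal (e * (1/2)^Suc j)" for j
      proof (cases "U j = {}")
        case True then show ?thesis by (intro exI[of _ "{}"]) auto
      next
        case False
        (* The diameter may be 0, so the cone estimate is applied with a slightly larger radius r. *)
        let ?t = "e * (1/2)^Suc j / C" and ?\<delta> = "diameter (U j)"
        have "?t > 0" using \<open>e > 0\<close> C by simp
        have "((\<lambda>r. r ^ ?d) \<longlongrightarrow> ?\<delta> ^ ?d) (at_right ?\<delta>)" by (intro tendsto_intros)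
        then have "\<forall>\<^sub>F r in at_right ?\<delta>. r ^ ?d < ?\<delta> ^ ?d + ?t"
          by (rule order_tendstoD) (use \<open>?t > 0\<close> in simp)
        moreover have "\<forall>\<^sub>F r in at_right ?\<delta>. ?\<delta> < r \<and> r < 1"
          using U[rule_format, of j] by (intro eventually_at_rightI[of _ 1]) auto
        ultimately have "\<forall>\<^sub>F r in at_right ?\<delta>. ?\<delta> < r \<and> r < 1 \<and> r ^ ?d < ?\<delta> ^ ?d + ?t"
          by eventually_elim auto
        then obtain r where r: "?\<delta> < r" "r < 1" "r ^ ?d < ?\<delta> ^ ?d + ?t"
          using eventually_happens' trivial_limit_at_right_real by blast
        have d0: "?\<delta> \<ge> 0" using U by (intro diameter_ge_0) auto
        have rr: "bounded (U j)" "?\<delta> \<le> r" "0 < r" "r \<le> 1" using U r d0 by auto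
        obtain B where B: "B \<in> sets borel" "?K (U j) \<subseteq> B"
          "emeasure lborel B \<le> ennreal (C * r ^ ?d)"
          using cone_over_small_set[OF rr] unfolding C_def by blast
        have "C * r ^ ?d \<le> C * (?\<delta> ^ ?d + ?t)" using r C by (intro mult_left_mono) auto
        also have "\<dots> = c * (\<omega> * (?\<delta> / 2) ^ ?d) + e * (1/2)^Suc j"
          using C V unfolding c_def by (simp add: power_divide field_simps)
        finally have "ennreal (C * r ^ ?d) \<le> ennreal (c * (\<omega> * (?\<delta> / 2) ^ ?d) + e * (1/2)^Suc j)"
          by (rule ennreal_leI)
        also have "\<dots> = ennreal c * hausdorff_gauge ?d (U j) + ennreal (e * (1/2)^Suc j)"
          using C V d0 False \<open>e > 0\<close> by (subst ennreal_plus) (auto simp: hausdorff_gauge_def ennreal_mult \<omega>_def)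
        finally show ?thesis using B by (intro exI[of _ B]) (auto intro: order_trans)
      qed
      then have "\<forall>j. \<exists>B. B \<in> sets borel \<and> ?K (U j) \<subseteq> B \<and>
          emeasure lborel B \<le> ennreal c * hausdorff_gauge ?d (U j) + ennreal (e * (1/2)^Suc j)" by blast
      from choice[OF this] obtain B where B: "\<And>j. B j \<in> sets borel" "\<And>j. ?K (U j) \<subseteq> B j"
         and emB: "\<And>j. emeasure lborel (B j) \<le> ennreal c * hausdorff_gauge ?d (U j) + ennreal (e * (1/2)^Suc j)"
        by blast
      have "cball (0::'a) 2 - ball 0 1 \<subseteq> (\<Union>j. B j)"
      proof
        fix x :: 'a assume "x \<in> cball 0 2 - ball 0 1"
        then have x: "1 \<le> norm x" "norm x \<le> 2" by auto
        define y where "y = x /\<^sub>R norm x"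
        have "norm x \<noteq> 0" using x by linarith
        then have y: "y \<in> ?S" "x = norm x *\<^sub>R y" by (auto simp: y_def)
        obtain j where "y \<in> U j" using y(1) cov by blast
        then have "x \<in> ?K (U j)" using x y by blast
        then show "x \<in> (\<Union>j. B j)" using B(2) by blast
      qed
      then have "ennreal ?V \<le> emeasure lborel (\<Union>j. B j)"
        using B(1) by (intro order_trans[OF shell] emeasure_mono) auto
      also have "\<dots> \<le> (\<Sum>j. emeasure lborel (B j))"
        using B(1) by (intro emeasure_subadditive_countably) auto
      also have "\<dots> \<le> (\<Sum>j. ennreal c * hausdorff_gauge ?d (U j) + ennreal (e * (1/2)^Suc j))"
        by (intro suminf_le emB) auto
      also have "\<dots> = ennreal c * (\<Sum>j. hausdorff_gauge ?d (U j)) + (\<Sum>j. ennreal (e * (1/2)^Suc j))"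
        by (simp add: suminf_add[symmetric])
      also have "(\<Sum>i. ennreal (e * (1/2)^Suc i)) = ennreal e"
        by (rule suminf_half_powers) fact
      finally show "ennreal ?V \<le> ennreal c * (\<Sum>j. hausdorff_gauge ?d (U j)) + ennreal e" .
    qed
    then have "ennreal (1/c) * ennreal ?V \<le> ennreal (1/c) * (ennreal c * (\<Sum>j. hausdorff_gauge ?d (U j)))"
      by (rule mult_left_mono) simp
    then show "ennreal (?V / c) \<le> (\<Sum>j. hausdorff_gauge ?d (U j))"
      using C V by (simp add: mult.assoc[symmetric] ennreal_mult[symmetric])
  qed
  moreover have "0 < ennreal (?V / c)" using V C by simp
  moreover have "hausdorff_pre ?d (1/2) ?S \<le> hausdorff_outer ?d ?S"
    unfolding hausdorff_outer_def by (rule SUP_upper) simp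
  ultimately show ?thesis by (meson less_le_trans)
qed

section \<open>Directional means of radial kernels\<close>

lemma nn_integral_lborel_orthogonal:
  fixes T :: "'a::euclidean_space \<Rightarrow> 'a"
  assumes T: "orthogonal_transformation T" and [measurable]: "f \<in> borel_measurable borel"
  shows "(\<integral>\<^sup>+x. f (T x) \<partial>lborel) = (\<integral>\<^sup>+x. f x \<partial>lborel)"
proof -
  have [measurable]: "T \<in> borel_measurable borel" by (rule borel_measurable_orthogonal[OF T])
  show ?thesis by (subst (2) distr_lborel_orthogonal[OF T, symmetric]) (simp add: nn_integral_distr)
qed

lemma AE_lborel_nonzero: "AE x in lborel. x \<noteq> (0::'a::euclidean_space)"
  by (rule AE_I[of _ _ "{0}"]) auto

text \<open>
  Integrate \<open>\<bar>x \<bullet> \<sigma>\<bar> / \<bar>x\<bar> \<rho>(x)\<close> over \<open>x\<close> and \<open>\<sigma>\<close>. By orthogonal invariance the integral over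
  \<open>x\<close>, the directional mean of the kernel, does not depend on \<open>\<sigma>\<close>, while the integral over \<open>\<sigma>\<close>
  is \<open>\<rho>(x)\<close> times the unnormalised spherical mean. Radial symmetry is assumed up to null sets,
  so that \<open>\<rho>\<close> may be a Borel representative.
\<close>

lemma spherical_mean_identity:
  fixes \<rho> :: "'a::euclidean_space \<Rightarrow> ennreal" and e v :: 'a
  assumes [measurable]: "\<rho> \<in> borel_measurable borel"
    and rad: "\<And>T. orthogonal_transformation T \<Longrightarrow> AE x in lborel. \<rho> (T x) = \<rho> x"
    and one: "(\<integral>\<^sup>+x. \<rho> x \<partial>lborel) = 1" and e: "e \<in> Basis"
  shows "(\<integral>\<^sup>+x. ennreal (\<bar>x \<bullet> v\<bar> / norm x) * \<rho> x \<partial>lborel) = ennreal (sphere_mean_const e * norm v)"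
    and "sphere_mean_const e > 0"
proof -
  let ?S = "sphere (0::'a) 1"
  define H where "H = (hausdorff_measure (DIM('a) - 1) :: 'a measure)"
  have [simp, measurable_cong]: "sets H = sets borel" "space H = UNIV" by (simp_all add: H_def)
  define N where "N = density H (indicator ?S)"
  have [simp, measurable_cong]: "sets N = sets borel" "space N = UNIV" by (simp_all add: N_def)
  have HS: "emeasure H ?S < top" "emeasure H ?S > 0"
    unfolding H_def by (simp_all add: emeasure_hausdorff_measure hausdorff_outer_sphere_finite hausdorff_outer_sphere_pos del: One_nat_def)
  define h where "h = measure H ?S"
  have h1: "emeasure H ?S = ennreal h"
    unfolding h_def using HS(1) by (intro emeasure_eq_ennreal_measure) simp
  moreover have "h > 0" using HS(2) unfolding h1 by simp
  ultimately have h: "emeasure H ?S = ennreal h" "h > 0" .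
  have [measurable]: "?S \<in> sets borel" by simp
  have emN: "emeasure N UNIV = emeasure H ?S"
    unfolding N_def by (subst emeasure_density) simp_all
  interpret N: finite_measure N
    by (rule finite_measureI) (simp add: emN h)
  interpret P: pair_sigma_finite lborel N ..
  have Nint: "(\<integral>\<^sup>+\<sigma>. g \<sigma> \<partial>N) = (\<integral>\<^sup>+\<sigma>. g \<sigma> * indicator ?S \<sigma> \<partial>H)" if [measurable]: "g \<in> borel_measurable borel" for g
    unfolding N_def by (subst nn_integral_density) (auto intro!: nn_integral_cong simp: mult.commute)
  define m where "m y = (\<integral>\<^sup>+\<sigma>. ennreal \<bar>y \<bullet> \<sigma>\<bar> \<partial>N)" for y
  have m_inv: "m (T y) = m y" if T: "orthogonal_transformation T" for T y
  proof -
    have [measurable]: "T \<in> borel_measurable borel" by (rule borel_measurable_orthogonal[OF T])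
    have "m (T y) = (\<integral>\<^sup>+\<sigma>. ennreal \<bar>T y \<bullet> \<sigma>\<bar> * indicator ?S \<sigma> \<partial>H)"
      unfolding m_def by (rule Nint) simp
    also have "\<dots> = (\<integral>\<^sup>+\<sigma>. ennreal \<bar>T y \<bullet> T \<sigma>\<bar> * indicator ?S (T \<sigma>) \<partial>H)"
      unfolding H_def by (subst distr_hausdorff_orthogonal[OF T, symmetric]) (simp add: nn_integral_distr)
    also have "\<dots> = (\<integral>\<^sup>+\<sigma>. ennreal \<bar>y \<bullet> \<sigma>\<bar> * indicator ?S \<sigma> \<partial>H)"
      using T by (intro nn_integral_cong) (auto simp: orthogonal_transformation_def orthogonal_transformation_norm[OF T] indicator_def)
    also have "\<dots> = m y" unfolding m_def by (rule Nint[symmetric]) simp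
    finally show ?thesis .
  qed
  have ne: "norm e = 1" using e by simp
  have m_eq: "m x = ennreal (norm x) * m e" if "x \<noteq> 0" for x
  proof -
    have "norm (x /\<^sub>R norm x) = 1" using that by simp
    then obtain T where T: "orthogonal_transformation T" "T e = x /\<^sub>R norm x"
      using orthogonal_transformation_between_unit_vectors[OF ne] by metis
    have "m x = (\<integral>\<^sup>+\<sigma>. ennreal (norm x) * ennreal \<bar>(x /\<^sub>R norm x) \<bullet> \<sigma>\<bar> \<partial>N)"
      unfolding m_def using that by (intro nn_integral_cong) (auto simp: ennreal_mult[symmetric] abs_mult)
    also have "\<dots> = ennreal (norm x) * m (T e)" unfolding m_def T by (rule nn_integral_cmult) simp
    finally show ?thesis using m_inv[OF T(1)] by simp
  qed
  have mK: "m e = ennreal (h * sphere_mean_const e)"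
  proof -
    have le1: "\<bar>e \<bullet> \<sigma>\<bar> \<le> 1" if "norm \<sigma> = 1" for \<sigma>
      using Cauchy_Schwarz_ineq2[of e \<sigma>] ne that by simp
    have fin: "integrable H (\<lambda>\<sigma>. indicator ?S \<sigma> *\<^sub>R \<bar>e \<bullet> \<sigma>\<bar>)"
    proof (rule Bochner_Integration.integrable_bound)
      show "integrable H (indicator ?S :: 'a \<Rightarrow> real)" using HS by simp
    qed (use le1 in \<open>auto simp: indicator_def\<close>)
    have "m e = (\<integral>\<^sup>+\<sigma>. ennreal \<bar>e \<bullet> \<sigma>\<bar> * indicator ?S \<sigma> \<partial>H)" unfolding m_def by (rule Nint) simp
    also have "\<dots> = (\<integral>\<^sup>+\<sigma>. ennreal (indicator ?S \<sigma> *\<^sub>R \<bar>e \<bullet> \<sigma>\<bar>) \<partial>H)"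
      by (intro nn_integral_cong) (auto simp: indicator_def)
    also have "\<dots> = ennreal (LINT \<sigma>:?S|H. \<bar>e \<bullet> \<sigma>\<bar>)"
      unfolding set_lebesgue_integral_def by (rule nn_integral_eq_integral[OF fin]) auto
    finally show ?thesis using h by (simp add: sphere_mean_const_def H_def[symmetric] h_def[symmetric] del: One_nat_def)
  qed
  define c where "c u = (\<integral>\<^sup>+x. ennreal (\<bar>x \<bullet> u\<bar> / norm x) * \<rho> x \<partial>lborel)" for u
  have c_inv: "c (T u) = c u" if T: "orthogonal_transformation T" for T u
  proof -
    have "c (T u) = (\<integral>\<^sup>+x. ennreal (\<bar>T x \<bullet> T u\<bar> / norm (T x)) * \<rho> (T x) \<partial>lborel)"
      unfolding c_def by (subst nn_integral_lborel_orthogonal[OF T]) auto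
    also have "\<dots> = c u"
      unfolding c_def using rad[OF T] T
      by (intro nn_integral_cong_AE) (auto simp: orthogonal_transformation_def orthogonal_transformation_norm[OF T])
    finally show ?thesis .
  qed
  have c_unit: "c u = c e" if u: "norm u = 1" for u
    using orthogonal_transformation_between_unit_vectors[OF ne u] c_inv by metis
  (* The double integral, first over x for fixed direction, then over the sphere for fixed x. *)
  have "c e * ennreal h = (\<integral>\<^sup>+\<sigma>. c e * indicator ?S \<sigma> \<partial>H)" by (simp add: nn_integral_cmult h)
  also have "\<dots> = (\<integral>\<^sup>+\<sigma>. c \<sigma> * indicator ?S \<sigma> \<partial>H)"
    using c_unit by (intro nn_integral_cong) (auto simp: indicator_def)
  also have "\<dots> = (\<integral>\<^sup>+\<sigma>. c \<sigma> \<partial>N)"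
    unfolding c_def by (intro Nint[symmetric]) measurable
  also have "\<dots> = (\<integral>\<^sup>+x. (\<integral>\<^sup>+\<sigma>. ennreal (\<bar>x \<bullet> \<sigma>\<bar> / norm x) * \<rho> x \<partial>N) \<partial>lborel)"
    unfolding c_def by (rule P.Fubini') measurable
  also have "\<dots> = (\<integral>\<^sup>+x. m e * \<rho> x \<partial>lborel)"
  proof (rule nn_integral_cong_AE, use AE_lborel_nonzero in eventually_elim)
    fix x :: 'a assume x: "x \<noteq> 0"
    have "(\<integral>\<^sup>+\<sigma>. ennreal (\<bar>x \<bullet> \<sigma>\<bar> / norm x) * \<rho> x \<partial>N)
        = (\<integral>\<^sup>+\<sigma>. ennreal \<bar>x \<bullet> \<sigma>\<bar> * (ennreal (1 / norm x) * \<rho> x) \<partial>N)"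
      by (intro nn_integral_cong) (simp add: mult.assoc[symmetric] ennreal_mult[symmetric])
    also have "\<dots> = m x * (ennreal (1 / norm x) * \<rho> x)" unfolding m_def by (rule nn_integral_multc) simp
    also have "\<dots> = (ennreal (norm x) * ennreal (1 / norm x)) * (m e * \<rho> x)"
      unfolding m_eq[OF x] by (simp add: ac_simps)
    also have "ennreal (norm x) * ennreal (1 / norm x) = 1" using x by (simp add: ennreal_mult[symmetric])
    finally show "(\<integral>\<^sup>+\<sigma>. ennreal (\<bar>x \<bullet> \<sigma>\<bar> / norm x) * \<rho> x \<partial>N) = m e * \<rho> x" by simp
  qed
  also have "\<dots> = m e" by (simp add: nn_integral_cmult one)
  finally have ch: "c e * ennreal h = ennreal (h * sphere_mean_const e)" using mK by simp
  have K0: "sphere_mean_const e \<ge> 0" unfolding sphere_mean_const_def set_lebesgue_integral_def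
    by (intro mult_nonneg_nonneg integral_nonneg_AE) auto
  have ce: "c e = ennreal (sphere_mean_const e)"
  proof -
    have "c e = c e * ennreal h * ennreal (1 / h)" using h by (simp add: mult.assoc ennreal_mult[symmetric])
    also have "\<dots> = ennreal (sphere_mean_const e)"
      unfolding ch using h K0 by (simp add: ennreal_mult[symmetric])
    finally show ?thesis .
  qed
  show "(\<integral>\<^sup>+x. ennreal (\<bar>x \<bullet> v\<bar> / norm x) * \<rho> x \<partial>lborel) = ennreal (sphere_mean_const e * norm v)"
  proof (cases "v = 0")
    case False
    have "c v = (\<integral>\<^sup>+x. ennreal (norm v) * (ennreal (\<bar>x \<bullet> (v /\<^sub>R norm v)\<bar> / norm x) * \<rho> x) \<partial>lborel)"
      unfolding c_def using False
      by (intro nn_integral_cong) (auto simp: ennreal_mult[symmetric] mult.assoc[symmetric] abs_mult)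
    also have "\<dots> = ennreal (norm v) * c (v /\<^sub>R norm v)" unfolding c_def by (rule nn_integral_cmult) measurable
    also have "c (v /\<^sub>R norm v) = ennreal (sphere_mean_const e)" using c_unit[of "v /\<^sub>R norm v"] False ce by simp
    finally show ?thesis using K0 by (simp add: c_def ennreal_mult[symmetric] mult.commute)
  qed simp
  show "sphere_mean_const e > 0"
  proof (rule ccontr)
    assume "\<not> sphere_mean_const e > 0"
    then have "c e = 0" using ce by (simp add: ennreal_neg)
    then have "AE x in lborel. ennreal (\<bar>x \<bullet> e\<bar> / norm x) * \<rho> x = 0"
      unfolding c_def by (subst (asm) nn_integral_0_iff_AE) auto
    moreover have "AE x in lborel. x \<bullet> e \<noteq> 0"
    proof -
      have "negligible {x. e \<bullet> x = 0}" using e by (intro negligible_hyperplane) auto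
      then have "{x. e \<bullet> x = 0} \<in> null_sets lborel"
        using negligible_iff_null_sets null_sets_completion_iff[of "{x. e \<bullet> x = 0}" lborel] by auto
      from AE_not_in[OF this] show ?thesis by eventually_elim (simp add: inner_commute)
    qed
    ultimately have "AE x in lborel. \<rho> x = 0"
      using AE_lborel_nonzero by eventually_elim auto
    then have "(\<integral>\<^sup>+x. \<rho> x \<partial>lborel) = 0" by (subst nn_integral_0_iff_AE) auto
    then show False using one by simp
  qed
qed

section \<open>Smooth functions and bump functions\<close>

lemma k_times_cont_diff_SucI:
  assumes "\<And>x. (f has_derivative f' x) (at x)" "\<And>v. k_times_cont_diff k (\<lambda>x. f' x v)"
  shows "k_times_cont_diff (Suc k) f"
proof -
  have "frechet_derivative f (at x) = f' x" for x
    using frechet_derivative_at[OF assms(1)] by simp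
  then show ?thesis using assms by (auto simp: differentiable_def)
qed

lemma k_times_cont_diff_SucD:
  "k_times_cont_diff (Suc k) f \<Longrightarrow> k_times_cont_diff k f"
proof (induction k arbitrary: f)
  case 0
  then show ?case
    by (simp add: continuous_on_eq_continuous_at differentiable_imp_continuous_within)
qed simp

lemma k_times_cont_diff_le:
  assumes "k \<le> n" "k_times_cont_diff n f" shows "k_times_cont_diff k f"
  using assms by (induction n rule: dec_induct) (blast dest: k_times_cont_diff_SucD)+

lemma k_times_cont_diff_has_derivative:
  "k_times_cont_diff (Suc k) f \<Longrightarrow> (f has_derivative frechet_derivative f (at x)) (at x)"
  by (simp add: frechet_derivative_works[symmetric])

lemma k_times_cont_diff_const: "k_times_cont_diff k (\<lambda>x. c)"
  by (induction k arbitrary: c) (auto simp: frechet_derivative_const)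

lemma k_times_cont_diff_bounded_linear:
  assumes "bounded_linear L" shows "k_times_cont_diff k L"
proof (cases k)
  case 0 then show ?thesis using assms by (simp add: linear_continuous_on)
next
  case (Suc n)
  show ?thesis unfolding Suc
    by (rule k_times_cont_diff_SucI[where f' = "\<lambda>_. L"])
       (auto intro: bounded_linear_imp_has_derivative assms k_times_cont_diff_const)
qed

lemma k_times_cont_diff_add:
  "k_times_cont_diff k f \<Longrightarrow> k_times_cont_diff k g \<Longrightarrow> k_times_cont_diff k (\<lambda>x. f x + g x)"
proof (induction k arbitrary: f g)
  case 0 then show ?case by (auto intro: continuous_intros)
next
  case (Suc k)
  show ?case
  proof (rule k_times_cont_diff_SucI)
    show "((\<lambda>x. f x + g x) has_derivative
        (\<lambda>v. frechet_derivative f (at x) v + frechet_derivative g (at x) v)) (at x)" for x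
      using Suc.prems by (intro has_derivative_add k_times_cont_diff_has_derivative)
    show "k_times_cont_diff k (\<lambda>x. frechet_derivative f (at x) v + frechet_derivative g (at x) v)" for v
      using Suc.prems by (intro Suc.IH) auto
  qed
qed

lemma k_times_cont_diff_sum:
  "(\<And>i. i \<in> I \<Longrightarrow> k_times_cont_diff k (f i)) \<Longrightarrow> k_times_cont_diff k (\<lambda>x. \<Sum>i\<in>I. f i x)"
  by (induction I rule: infinite_finite_induct) (auto intro: k_times_cont_diff_const k_times_cont_diff_add)

lemma k_times_cont_diff_linear_comp:
  assumes "bounded_linear L"
  shows "k_times_cont_diff k f \<Longrightarrow> k_times_cont_diff k (\<lambda>x. L (f x))"
proof (induction k arbitrary: f)
  case 0 then show ?case by (auto intro: bounded_linear.continuous_on[OF assms])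
next
  case (Suc k)
  show ?case
  proof (rule k_times_cont_diff_SucI)
    show "((\<lambda>x. L (f x)) has_derivative (\<lambda>v. L (frechet_derivative f (at x) v))) (at x)" for x
      using Suc.prems by (intro bounded_linear.has_derivative[OF assms] k_times_cont_diff_has_derivative)
    show "k_times_cont_diff k (\<lambda>x. L (frechet_derivative f (at x) v))" for v
      using Suc.prems by (intro Suc.IH) auto
  qed
qed

lemma k_times_cont_diff_mult:
  fixes f g :: "'a::euclidean_space \<Rightarrow> real"
  shows "k_times_cont_diff k f \<Longrightarrow> k_times_cont_diff k g \<Longrightarrow> k_times_cont_diff k (\<lambda>x. f x * g x)"
proof (induction k arbitrary: f g)
  case 0 then show ?case by (auto intro: continuous_intros)
next
  case (Suc k)
  show ?case
  proof (rule k_times_cont_diff_SucI)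
    show "((\<lambda>x. f x * g x) has_derivative
        (\<lambda>v. f x * frechet_derivative g (at x) v + frechet_derivative f (at x) v * g x)) (at x)" for x
      using Suc.prems by (intro has_derivative_mult k_times_cont_diff_has_derivative)
    show "k_times_cont_diff k (\<lambda>x. f x * frechet_derivative g (at x) v + frechet_derivative f (at x) v * g x)" for v
      using Suc.prems by (intro k_times_cont_diff_add Suc.IH) (auto intro: k_times_cont_diff_SucD)
  qed
qed

text \<open>
  For the constant polynomial \<open>1\<close> this is the flat function \<open>exp (-1/t)\<close>, extended by \<open>0\<close> to
  \<open>t \<le> 0\<close>. The polynomial factor makes the family closed under differentiation.
\<close>

definition flat_exp :: "real poly \<Rightarrow> real \<Rightarrow> real" where
  "flat_exp P t = (if t \<le> 0 then 0 else poly P (1 / t) * exp (- (1 / t)))"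

lemma tendsto_poly_times_exp_neg: "((\<lambda>s::real. poly P s * exp (- s)) \<longlongrightarrow> 0) at_top"
proof -
  have "((\<lambda>s. \<Sum>i\<le>degree P. coeff P i * (s ^ i / exp s)) \<longlongrightarrow> (\<Sum>i\<le>degree P. coeff P i * 0)) at_top"
    by (intro tendsto_sum tendsto_mult tendsto_const tendsto_power_div_exp_0)
  then show ?thesis by (simp add: poly_altdef sum_distrib_right exp_minus divide_inverse mult.assoc)
qed

text \<open>
  At \<open>t = 0\<close> the difference quotient is \<open>s P(s) exp (-s)\<close> with \<open>s = 1/t\<close>, which tends to \<open>0\<close>.
\<close>

lemma DERIV_flat_exp:
  "(flat_exp P has_real_derivative flat_exp (monom 1 2 * (P - pderiv P)) t) (at t)"
proof -
  consider "t < 0" | "t = 0" | "t > 0" by linarith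
  then show ?thesis
  proof cases
    case 1
    have "((\<lambda>_. 0) has_real_derivative 0) (at t)" by simp
    then have "(flat_exp P has_real_derivative 0) (at t)"
      by (rule has_field_derivative_transform_within_open[of _ _ _ "{..<0}"]) (use 1 in \<open>auto simp: flat_exp_def\<close>)
    then show ?thesis using 1 by (simp add: flat_exp_def)
  next
    case 3
    have "((\<lambda>t. poly P (1 / t) * exp (- (1 / t))) has_real_derivative
        poly (pderiv P) (1/t) * (- (1 / t^2)) * exp (- (1/t)) + exp (- (1/t)) * (1 / t^2) * poly P (1/t)) (at t)"
      using 3 by (auto intro!: derivative_eq_intros DERIV_chain2[OF poly_DERIV] simp: power2_eq_square field_simps)
    then have "(flat_exp P has_real_derivative
        poly (pderiv P) (1/t) * (- (1 / t^2)) * exp (- (1/t)) + exp (- (1/t)) * (1 / t^2) * poly P (1/t)) (at t)"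
      by (rule has_field_derivative_transform_within_open[of _ _ _ "{0<..}"]) (use 3 in \<open>auto simp: flat_exp_def\<close>)
    then show ?thesis using 3 by (simp add: flat_exp_def poly_monom algebra_simps power_divide)
  next
    case 2
    have "((\<lambda>h. (flat_exp P (0 + h) - flat_exp P 0) / h) \<longlongrightarrow> 0) (at 0)"
    proof (rule filterlim_split_at)
      show "((\<lambda>h. (flat_exp P (0 + h) - flat_exp P 0) / h) \<longlongrightarrow> 0) (at_left 0)"
        by (rule tendsto_eventually) (auto simp: flat_exp_def eventually_at_filter)
      have "((\<lambda>s. poly (pCons 0 P) s * exp (- s)) \<longlongrightarrow> 0) at_top" by (rule tendsto_poly_times_exp_neg)
      then have "((\<lambda>h. poly (pCons 0 P) (inverse h) * exp (- inverse h)) \<longlongrightarrow> 0) (at_right 0)"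
        by (rule filterlim_compose[OF _ filterlim_inverse_at_top_right])
      then show "((\<lambda>h. (flat_exp P (0 + h) - flat_exp P 0) / h) \<longlongrightarrow> 0) (at_right 0)"
        by (rule Lim_transform_eventually)
           (auto simp: flat_exp_def eventually_at_filter inverse_eq_divide)
    qed
    then show ?thesis using 2 by (simp add: DERIV_def flat_exp_def)
  qed
qed

text \<open>
  The derivative in direction \<open>v\<close> is a member of the same family times the linear function
  \<open>-2 (x \<bullet> v)\<close>, so induction over the order of differentiability applies to all polynomials at
  once.
\<close>

lemma k_times_cont_diff_flat_exp_comp:
  fixes c :: real
  shows "k_times_cont_diff k (\<lambda>x::'a::euclidean_space. flat_exp P (c - x \<bullet> x))"
proof (induction k arbitrary: P)
  case 0
  have "continuous_on UNIV (flat_exp P)"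
    using DERIV_flat_exp DERIV_isCont continuous_at_imp_continuous_on by blast
  then show ?case by (auto intro!: continuous_on_compose2[of UNIV "flat_exp P"] continuous_intros)
next
  case (Suc k)
  let ?Q = "monom 1 2 * (P - pderiv P)"
  show ?case
  proof (rule k_times_cont_diff_SucI)
    show "((\<lambda>x. flat_exp P (c - x \<bullet> x)) has_derivative (\<lambda>v. flat_exp ?Q (c - x \<bullet> x) * (- 2 * (x \<bullet> v)))) (at x)" for x :: 'a
    proof -
      have "((\<lambda>x. c - x \<bullet> x) has_derivative (\<lambda>v. - 2 * (x \<bullet> v))) (at x)"
        by (auto intro!: derivative_eq_intros simp: inner_commute)
      from has_derivative_compose[OF this, of "flat_exp P" "\<lambda>r. flat_exp ?Q (c - x \<bullet> x) * r"]
      show ?thesis using DERIV_flat_exp[of P "c - x \<bullet> x"] by (simp add: has_field_derivative_def)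
    qed
    show "k_times_cont_diff k (\<lambda>x::'a. flat_exp ?Q (c - x \<bullet> x) * (- 2 * (x \<bullet> v)))" for v
      by (intro k_times_cont_diff_mult Suc.IH k_times_cont_diff_bounded_linear)
         (intro bounded_linear_intros)
  qed
qed

lemma integral_bounded_support:
  fixes g :: "'a::euclidean_space \<Rightarrow> real"
  assumes [measurable]: "g \<in> borel_measurable borel"
    and B: "\<And>y. \<bar>g y\<bar> \<le> B" and supp: "\<And>y. y \<notin> cball c R \<Longrightarrow> g y = 0"
  shows "integrable lborel g" "\<bar>LINT y|lborel. g y\<bar> \<le> B * measure lborel (cball c R)"
proof -
  have [measurable]: "cball c R \<in> sets borel" by simp
  have i: "integrable lborel (\<lambda>y. B * indicator (cball c R) y)"
    using emeasure_lborel_cball_finite[of c R] by (intro integrable_mult_right integrable_real_indicator) auto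
  have le: "\<bar>g y\<bar> \<le> B * indicator (cball c R) y" for y
    using B[of y] supp[of y] by (auto simp: indicator_def)
  show int: "integrable lborel g"
    by (rule Bochner_Integration.integrable_bound[OF i]) (use le in \<open>auto intro!: AE_I2 intro: order_trans[OF _ abs_ge_self]\<close>)
  have "\<bar>LINT y|lborel. g y\<bar> \<le> (LINT y|lborel. B * indicator (cball c R) y)"
    using integral_abs_bound[of lborel g] integral_mono[OF integrable_abs[OF int] i le] by linarith
  then show "\<bar>LINT y|lborel. g y\<bar> \<le> B * measure lborel (cball c R)" by simp
qed

definition bounded_support :: "('a::real_normed_vector \<Rightarrow> 'b::zero) \<Rightarrow> bool" where
  "bounded_support f \<longleftrightarrow> (\<exists>R. \<forall>x. norm x > R \<longrightarrow> f x = 0)"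

lemma continuous_bounded_support_bounded:
  fixes f :: "'a::euclidean_space \<Rightarrow> real"
  assumes "continuous_on UNIV f" "bounded_support f"
  obtains B where "\<And>x. \<bar>f x\<bar> \<le> B" "B \<ge> 0"
proof -
  obtain R where R: "\<And>x. norm x > R \<Longrightarrow> f x = 0" using assms(2) by (auto simp: bounded_support_def)
  have "bounded (f ` cball 0 R)"
    by (intro compact_imp_bounded compact_continuous_image continuous_on_subset[OF assms(1)]) auto
  then have "\<exists>B. \<forall>x\<in>cball 0 R. \<bar>f x\<bar> \<le> B" by (auto simp: bounded_iff)
  then obtain B where B: "\<And>x. x \<in> cball 0 R \<Longrightarrow> \<bar>f x\<bar> \<le> B" by blast
  show ?thesis
    by (rule that[of "max B 0"]) (use B R in \<open>fastforce simp: not_less[symmetric] max_def\<close>)+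
qed

lemma continuous_bounded_support_uniform:
  fixes f :: "'a::euclidean_space \<Rightarrow> real"
  assumes f: "continuous_on UNIV f" "bounded_support f" and e: "e > 0"
  obtains d where "d > 0" "\<And>x y. dist x y < d \<Longrightarrow> \<bar>f x - f y\<bar> < e"
proof -
  obtain R where R: "\<And>x. norm x > R \<Longrightarrow> f x = 0" using f(2) by (auto simp: bounded_support_def)
  have "uniformly_continuous_on (cball 0 (R+1)) f"
    by (intro compact_uniformly_continuous continuous_on_subset[OF f(1)]) auto
  then obtain d where d: "d > 0" "\<And>x y. x \<in> cball 0 (R+1) \<Longrightarrow> y \<in> cball 0 (R+1) \<Longrightarrow> dist y x < d \<Longrightarrow> dist (f y) (f x) < e"
    using e unfolding uniformly_continuous_on_def by metis
  show ?thesis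
  proof (rule that[of "min d 1"])
    show "min d 1 > 0" using d by simp
    fix x y :: 'a assume xy: "dist x y < min d 1"
    have tri: "norm x \<le> norm y + dist x y" "norm y \<le> norm x + dist x y"
      by (metis dist_commute dist_norm norm_triangle_sub add.commute)+
    show "\<bar>f x - f y\<bar> < e"
    proof (cases "norm x \<le> R + 1 \<and> norm y \<le> R + 1")
      case True then show ?thesis using d(2)[of y x] xy by (simp add: dist_real_def)
    next
      case False
      then have "norm x > R" "norm y > R" using tri xy by auto
      then show ?thesis using R e by simp
    qed
  qed
qed

lemma integral_lborel_reflect:
  fixes f :: "'a::euclidean_space \<Rightarrow> real"
  assumes [measurable]: "f \<in> borel_measurable borel"
  shows "(LINT x|lborel. f (a - x)) = (LINT x|lborel. f x)"
  by (subst (2) lborel_affine[of "-1" a]) (simp_all add: integral_distr density_1)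

lemma mollifier_exists:
  assumes "\<delta> > 0"
  obtains \<eta> :: "'a::euclidean_space \<Rightarrow> real" where "smooth \<eta>" "\<And>x. 0 \<le> \<eta> x" "\<And>x. \<eta> (- x) = \<eta> x"
    "\<And>x. norm x > \<delta> \<Longrightarrow> \<eta> x = 0" "(LINT x|lborel. \<eta> x) = 1"
proof -
  define g where "g x = flat_exp [:1:] (\<delta>\<^sup>2 - x \<bullet> x)" for x :: 'a
  have sm: "k_times_cont_diff k g" for k unfolding g_def by (rule k_times_cont_diff_flat_exp_comp)
  from sm[of 0] have cont: "continuous_on UNIV g" by simp
  have [measurable]: "g \<in> borel_measurable borel" by (rule borel_measurable_continuous_onI[OF cont])
  have nonneg: "g x \<ge> 0" for x by (simp add: g_def flat_exp_def)
  have supp: "g x = 0" if "norm x > \<delta>" for x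
  proof -
    have "\<delta>\<^sup>2 \<le> (norm x)\<^sup>2" using that assms by (intro power_mono) auto
    then show ?thesis by (simp add: g_def flat_exp_def dot_square_norm)
  qed
  have pos: "g x > 0" if "norm x < \<delta>" for x
  proof -
    have "(norm x)\<^sup>2 < \<delta>\<^sup>2" using that by (intro power_strict_mono) auto
    then show ?thesis by (simp add: g_def flat_exp_def dot_square_norm)
  qed
  obtain B where B: "\<And>x. \<bar>g x\<bar> \<le> B"
    using continuous_bounded_support_bounded[OF cont] supp unfolding bounded_support_def by metis
  have int: "integrable lborel g"
    by (rule integral_bounded_support[of g B 0 \<delta>]) (use B supp in auto)
  define c where "c = (LINT x|lborel. g x)"
  have "c \<ge> 0" unfolding c_def by (intro integral_nonneg_AE) (auto simp: nonneg)
  moreover have "c \<noteq> 0"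
  proof
    assume "c = 0"
    then have "AE x in lborel. g x = 0"
      unfolding c_def using integral_nonneg_eq_0_iff_AE[OF int] nonneg by auto
    then have "AE x in lborel. x \<notin> ball (0::'a) \<delta>" by (rule AE_mp) (rule AE_I2, use pos in force)
    then have "emeasure lborel (ball (0::'a) \<delta>) = 0"
      by (subst (asm) AE_iff_measurable[OF _ refl]) (auto simp: ball_def)
    then show False using assms content_ball_gt_0_iff[of "0::'a" \<delta>] by (simp add: measure_def)
  qed
  ultimately have c: "c > 0" by simp
  show ?thesis
  proof (rule that[of "\<lambda>x. inverse c * g x"])
    show "smooth (\<lambda>x. inverse c * g x)"
      unfolding smooth_def using sm by (auto intro: k_times_cont_diff_mult k_times_cont_diff_const)
    show "(LINT x|lborel. inverse c * g x) = 1" using c by (simp add: c_def[symmetric])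
  qed (use c nonneg supp in \<open>auto simp: g_def\<close>)
qed

section \<open>Convolution with compactly supported functions\<close>

definition cont_diff_bounded_support :: "('a::euclidean_space \<Rightarrow> real) \<Rightarrow> bool" where
  "cont_diff_bounded_support f \<longleftrightarrow> k_times_cont_diff 1 f \<and> bounded_support f"

definition convolve :: "('a::euclidean_space \<Rightarrow> real) \<Rightarrow> ('a \<Rightarrow> real) \<Rightarrow> 'a \<Rightarrow> real" where
  "convolve f k x = (LINT y|lborel. f (x - y) * k y)"

lemma frechet_derivative_zero_outside:
  fixes f :: "'a::euclidean_space \<Rightarrow> 'b::real_normed_vector"
  assumes R: "\<And>x. norm x > R \<Longrightarrow> f x = 0" and x: "norm x > R"
  shows "frechet_derivative f (at x) v = 0"
proof -
  have op: "open {x::'a. norm x > R}" by (intro open_Collect_less continuous_intros)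
  have "((\<lambda>x. 0) has_derivative (\<lambda>v. 0)) (at x)" by simp
  then have "(f has_derivative (\<lambda>v. 0)) (at x)"
    by (rule has_derivative_transform_within_open[OF _ op]) (use x R in auto)
  then show ?thesis using frechet_derivative_at by metis
qed

lemma bounded_support_frechet_derivative:
  fixes f :: "'a::euclidean_space \<Rightarrow> 'b::real_normed_vector"
  shows "bounded_support f \<Longrightarrow> bounded_support (\<lambda>x. frechet_derivative f (at x) v)"
  unfolding bounded_support_def using frechet_derivative_zero_outside by metis

lemma cont_diff_bounded_supportD:
  assumes "cont_diff_bounded_support f"
  shows "continuous_on UNIV f" "bounded_support f"
    "(f has_derivative frechet_derivative f (at x)) (at x)"
    "continuous_on UNIV (\<lambda>x. frechet_derivative f (at x) v)"
    "bounded_support (\<lambda>x. frechet_derivative f (at x) v)"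
proof -
  have "k_times_cont_diff (Suc 0) f" using assms by (simp add: cont_diff_bounded_support_def)
  from k_times_cont_diff_SucD[OF this] k_times_cont_diff_has_derivative[OF this] this
  show "continuous_on UNIV f" "(f has_derivative frechet_derivative f (at x)) (at x)"
    "continuous_on UNIV (\<lambda>x. frechet_derivative f (at x) v)" by simp_all
  show "bounded_support f" using assms by (simp add: cont_diff_bounded_support_def)
  then show "bounded_support (\<lambda>x. frechet_derivative f (at x) v)" by (rule bounded_support_frechet_derivative)
qed

lemma frechet_derivative_basis_expansion:
  fixes f :: "'a::euclidean_space \<Rightarrow> real"
  assumes "f differentiable at x"
  shows "frechet_derivative f (at x) v = (\<Sum>b\<in>Basis. (v \<bullet> b) * frechet_derivative f (at x) b)"
proof -
  have lin: "linear (frechet_derivative f (at x))" by (rule linear_frechet_derivative[OF assms])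
  have "frechet_derivative f (at x) v = frechet_derivative f (at x) (\<Sum>b\<in>Basis. (v \<bullet> b) *\<^sub>R b)"
    by (simp add: euclidean_representation)
  also have "\<dots> = (\<Sum>b\<in>Basis. (v \<bullet> b) * frechet_derivative f (at x) b)"
    using lin by (simp add: linear_sum linear_scale)
  finally show ?thesis .
qed

text \<open>
  The partial derivatives are uniformly continuous, so the mean value theorem gives a
  remainder that is small uniformly in the base point.
\<close>

lemma uniform_first_order_expansion:
  fixes f :: "'a::euclidean_space \<Rightarrow> real"
  assumes f: "cont_diff_bounded_support f" and e: "e > 0"
  obtains d where "d > 0" "\<And>x h. norm h < d \<Longrightarrow> \<bar>f (x + h) - f x - frechet_derivative f (at x) h\<bar> \<le> e * norm h"
proof -
  define e' where "e' = e / real DIM('a)"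
  have e': "e' > 0" using e by (simp add: e'_def)
  note D = cont_diff_bounded_supportD[OF f]
  have "\<exists>d>0. \<forall>x y. dist x y < d \<longrightarrow> \<bar>frechet_derivative f (at x) b - frechet_derivative f (at y) b\<bar> < e'" for b
    using continuous_bounded_support_uniform[OF D(4,5) e'] by metis
  then obtain d where d: "\<And>b. d b > 0"
    "\<And>b x y. dist x y < d b \<Longrightarrow> \<bar>frechet_derivative f (at x) b - frechet_derivative f (at y) b\<bar> < e'"
    by metis
  define m where "m = Min (d ` Basis)"
  have m: "m > 0" "\<And>b. b \<in> Basis \<Longrightarrow> m \<le> d b" using d by (auto simp: m_def)
  show ?thesis
  proof (rule that[OF m(1)])
    fix x h :: 'a assume h: "norm h < m"
    have "norm (f (x + h) - f x - frechet_derivative f (at x) (x + h - x)) \<le> norm (x + h - x) * e"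
    proof (rule differentiable_bound_linearization[where S = "ball x m" and f' = "\<lambda>y. frechet_derivative f (at y)"])
      fix t :: real assume "t \<in> {0..1}"
      then have "\<bar>t\<bar> * norm h \<le> 1 * norm h" by (intro mult_right_mono) auto
      then show "x + t *\<^sub>R (x + h - x) \<in> ball x m" using h by (simp add: dist_norm)
    next
      fix y show "(f has_derivative frechet_derivative f (at y)) (at y within ball x m)"
        by (rule has_derivative_at_withinI[OF D(3)])
    next
      fix y assume y: "y \<in> ball x m"
      have "onorm (\<lambda>v. frechet_derivative f (at y) v - frechet_derivative f (at x) v)
          \<le> (\<Sum>b\<in>Basis. norm (frechet_derivative f (at y) b - frechet_derivative f (at x) b))"
        by (rule onorm_componentwise) (intro bounded_linear_sub has_derivative_bounded_linear[OF D(3)])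
      also have "\<dots> \<le> (\<Sum>b\<in>(Basis :: 'a set). e')"
      proof (rule sum_mono)
        fix b :: 'a assume "b \<in> Basis"
        then have "dist y x < d b" using y m(2)[of b] by (simp add: dist_commute)
        from less_imp_le[OF d(2)[OF this]]
        show "norm (frechet_derivative f (at y) b - frechet_derivative f (at x) b) \<le> e'" by simp
      qed
      also have "\<dots> = e" by (simp add: e'_def)
      finally show "onorm (frechet_derivative f (at y) - frechet_derivative f (at x)) \<le> e"
        by (simp add: fun_diff_def)
    qed (use m in auto)
    then show "\<bar>f (x + h) - f x - frechet_derivative f (at x) h\<bar> \<le> e * norm h" by (simp add: mult.commute)
  qed
qed

lemma measure_lborel_cball_eq: "measure lborel (cball (x::'a::euclidean_space) r) = measure lborel (cball (0::'a) r)"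
  by (cases "r \<ge> 0") (auto simp: content_cball)

lemma convolve_integrable:
  fixes f k :: "'a::euclidean_space \<Rightarrow> real"
  assumes f: "continuous_on UNIV f" "bounded_support f"
    and [measurable]: "k \<in> borel_measurable borel" and k: "\<And>y. \<bar>k y\<bar> \<le> M"
  shows "integrable lborel (\<lambda>y. f (x - y) * k y)"
proof -
  obtain B where B: "\<And>x. \<bar>f x\<bar> \<le> B" "B \<ge> 0" using continuous_bounded_support_bounded[OF f] by metis
  obtain R where R: "\<And>x. norm x > R \<Longrightarrow> f x = 0" using f(2) by (auto simp: bounded_support_def)
  have [measurable]: "f \<in> borel_measurable borel" by (rule borel_measurable_continuous_onI[OF f(1)])
  have M: "M \<ge> 0" using k[of 0] by linarith
  show ?thesis
  proof (rule integral_bounded_support(1)[where B = "B * M" and c = x and R = R])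
    show "\<bar>f (x - y) * k y\<bar> \<le> B * M" for y
      unfolding abs_mult using B k M by (intro mult_mono) auto
    show "f (x - y) * k y = 0" if "y \<notin> cball x R" for y
      using that R[of "x - y"] by (simp add: dist_norm)
  qed measurable
qed

text \<open>
  The remainder is uniform in \<open>x\<close> because \<open>k\<close> is bounded and only the part of \<open>k\<close> in a ball of
  fixed radius enters. Boundedness is the right assumption on \<open>k\<close>, which will be the indicator
  of a set of possibly infinite measure.
\<close>

lemma convolve_uniform_expansion:
  fixes f k :: "'a::euclidean_space \<Rightarrow> real"
  assumes f: "cont_diff_bounded_support f"
    and [measurable]: "k \<in> borel_measurable borel" and k: "\<And>y. \<bar>k y\<bar> \<le> M" and "e > 0"
  obtains d where "d > 0" "\<And>x h. norm h < d \<Longrightarrow>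
    \<bar>convolve f k (x + h) - convolve f k x - convolve (\<lambda>x. frechet_derivative f (at x) h) k x\<bar> \<le> e * norm h"
proof -
  note D = cont_diff_bounded_supportD[OF f]
  let ?D = "\<lambda>v x. frechet_derivative f (at x) v"
  have [measurable]: "f \<in> borel_measurable borel" "\<And>v. ?D v \<in> borel_measurable borel"
    by (intro borel_measurable_continuous_onI D)+
  have iD: "integrable lborel (\<lambda>y. ?D v (x - y) * k y)" for v x
    by (rule convolve_integrable[OF D(4,5) _ k]) measurable
  have if': "integrable lborel (\<lambda>y. f (x - y) * k y)" for x
    by (rule convolve_integrable[OF D(1,2) _ k]) measurable
  have M: "M \<ge> 0" using k[of 0] by linarith
  obtain R where R: "\<And>x. norm x > R \<Longrightarrow> f x = 0" using D(2) by (auto simp: bounded_support_def)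
  note RD = frechet_derivative_zero_outside[of R f, OF R]
  define V where "V = measure lborel (cball (0::'a) (R + 1))"
  have V: "V \<ge> 0" by (simp add: V_def)
  define e' where "e' = e / (M * V + 1)"
  have MV: "M * V + 1 > 0" using M V by (simp add: add_nonneg_pos)
  then have "e' > 0" using \<open>e > 0\<close> by (simp add: e'_def)
  then obtain d where d: "d > 0"
    "\<And>x h. norm h < d \<Longrightarrow> \<bar>f (x + h) - f x - ?D h x\<bar> \<le> e' * norm h"
    using uniform_first_order_expansion[OF f] by metis
  show ?thesis
  proof (rule that[of "min d 1"])
    show "min d 1 > 0" using d by simp
    fix x h :: 'a assume "norm h < min d 1"
    then have h: "norm h < d" "norm h < 1" by auto
    let ?g = "\<lambda>z. (f (x + h - z) - f (x - z) - ?D h (x - z)) * k z"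
    have "convolve f k (x + h) - convolve f k x - convolve (?D h) k x = (LINT z|lborel. ?g z)"
      unfolding convolve_def using if' iD by (simp add: left_diff_distrib)
    moreover have "\<bar>LINT z|lborel. ?g z\<bar> \<le> (e' * norm h * M) * measure lborel (cball x (R + 1))"
    proof (rule integral_bounded_support(2))
      fix z
      show "\<bar>?g z\<bar> \<le> e' * norm h * M"
        unfolding abs_mult using d(2)[OF h(1), of "x - z"] k M \<open>e' > 0\<close>
        by (intro mult_mono) (auto simp: algebra_simps)
      assume "z \<notin> cball x (R + 1)"
      then have "norm (x - z) > R + 1" by (simp add: dist_norm)
      moreover have "norm (x - z) \<le> norm (x + h - z) + norm h"
        using norm_triangle_ineq4[of "x + h - z" h] by (simp add: algebra_simps)
      ultimately have "norm (x - z) > R" "norm (x + h - z) > R" using h(2) by auto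
      then show "?g z = 0" using R RD by simp
    qed measurable
    moreover have "measure lborel (cball x (R + 1)) = V"
      unfolding V_def by (rule measure_lborel_cball_eq)
    moreover have "(e' * norm h * M) * V \<le> e * norm h"
    proof -
      have "e' * (M * V) \<le> e' * (M * V + 1)" using \<open>e' > 0\<close> by simp
      also have "\<dots> = e" using MV by (simp add: e'_def)
      finally have "e' * (M * V) * norm h \<le> e * norm h" by (rule mult_right_mono) simp
      then show ?thesis by (simp add: algebra_simps)
    qed
    ultimately show "\<bar>convolve f k (x + h) - convolve f k x - convolve (?D h) k x\<bar> \<le> e * norm h"
      by simp
  qed
qed

lemma convolve_has_derivative:
  fixes f k :: "'a::euclidean_space \<Rightarrow> real"
  assumes f: "cont_diff_bounded_support f"
    and [measurable]: "k \<in> borel_measurable borel" and k: "\<And>y. \<bar>k y\<bar> \<le> M"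
  shows "(convolve f k has_derivative (\<lambda>v. convolve (\<lambda>x. frechet_derivative f (at x) v) k x)) (at x)"
proof -
  note D = cont_diff_bounded_supportD[OF f]
  let ?D = "\<lambda>v x. frechet_derivative f (at x) v"
  have diff: "f differentiable at x" for x using D(3) by (auto simp: differentiable_def)
  have iD: "integrable lborel (\<lambda>y. ?D v (x - y) * k y)" for v x
    by (rule convolve_integrable[OF D(4,5) _ k]) measurable
  show ?thesis
    unfolding has_derivative_at_alt
  proof (intro conjI allI impI)
    show "bounded_linear (\<lambda>v. convolve (?D v) k x)"
    proof (subst linear_conv_bounded_linear[symmetric], rule linearI)
      fix u v :: 'a and c :: real
      have "?D (u + v) z = ?D u z + ?D v z" "?D (c *\<^sub>R u) z = c * ?D u z" for z
        using linear_frechet_derivative[OF diff] by (auto simp: linear_add linear_scale)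
      then show "convolve (?D (u + v)) k x = convolve (?D u) k x + convolve (?D v) k x"
          "convolve (?D (c *\<^sub>R u)) k x = c *\<^sub>R convolve (?D u) k x"
        unfolding convolve_def using iD by (simp_all add: distrib_right mult.assoc)
    qed
    fix e :: real assume "e > 0"
    show "\<exists>d>0. \<forall>y. norm (y - x) < d \<longrightarrow>
        norm (convolve f k y - convolve f k x - convolve (?D (y - x)) k x) \<le> e * norm (y - x)"
      using convolve_uniform_expansion[OF assms \<open>e > 0\<close>]
      by (metis add.commute diff_add_cancel real_norm_def)
  qed
qed

lemma convolve_continuous:
  fixes f k :: "'a::euclidean_space \<Rightarrow> real"
  assumes f: "continuous_on UNIV f" "bounded_support f"
    and [measurable]: "k \<in> borel_measurable borel" and k: "\<And>y. \<bar>k y\<bar> \<le> M"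
  shows "continuous_on UNIV (convolve f k)"
proof -
  obtain R where R: "\<And>x. norm x > R \<Longrightarrow> f x = 0" using f(2) by (auto simp: bounded_support_def)
  have [measurable]: "f \<in> borel_measurable borel" by (rule borel_measurable_continuous_onI[OF f(1)])
  have M: "M \<ge> 0" using k[of 0] by linarith
  define V where "V = measure lborel (cball (0::'a) (R + 1))"
  have V: "V \<ge> 0" by (simp add: V_def)
  have MV: "M * V + 1 > 0" using M V by (simp add: add_nonneg_pos)
  show ?thesis
    unfolding continuous_on_iff
  proof safe
    fix x :: 'a and e :: real assume "e > 0"
    then have "e / (M * V + 1) > 0" using MV by simp
    then obtain d where d: "d > 0" "\<And>x y. dist x y < d \<Longrightarrow> \<bar>f x - f y\<bar> < e / (M * V + 1)"
      using continuous_bounded_support_uniform[OF f] by metis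
    show "\<exists>d>0. \<forall>y\<in>UNIV. dist y x < d \<longrightarrow> dist (convolve f k y) (convolve f k x) < e"
    proof (intro exI conjI ballI impI)
      show "min d 1 > 0" using d by simp
      fix y assume y: "dist y x < min d 1"
      let ?g = "\<lambda>z. (f (y - z) - f (x - z)) * k z"
      have "convolve f k y - convolve f k x = (LINT z|lborel. ?g z)"
        unfolding convolve_def using convolve_integrable[OF f _ k] by (simp add: left_diff_distrib)
      moreover have "\<bar>LINT z|lborel. ?g z\<bar> \<le> (e / (M * V + 1) * M) * measure lborel (cball x (R + 1))"
      proof (rule integral_bounded_support(2))
        fix z
        show "\<bar>?g z\<bar> \<le> e / (M * V + 1) * M"
          unfolding abs_mult using less_imp_le[OF d(2)[of "y - z" "x - z"]] y k M \<open>e / (M * V + 1) > 0\<close>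
          by (intro mult_mono) (auto simp: dist_norm)
        assume "z \<notin> cball x (R + 1)"
        then have "norm (x - z) > R + 1" by (simp add: dist_norm)
        moreover have "norm (x - z) \<le> norm (y - z) + norm (y - x)"
          using norm_triangle_ineq4[of "y - z" "y - x"] by (simp add: algebra_simps)
        ultimately have "norm (x - z) > R" "norm (y - z) > R" using y by (auto simp: dist_norm)
        then show "?g z = 0" using R by simp
      qed measurable
      moreover have "measure lborel (cball x (R + 1)) = V"
        unfolding V_def by (rule measure_lborel_cball_eq)
      moreover have "(e / (M * V + 1) * M) * V < e"
        using \<open>e > 0\<close> MV by (simp add: field_simps)
      ultimately show "dist (convolve f k y) (convolve f k x) < e" by (simp add: dist_real_def)
    qed
  qed
qed

text \<open>
  Derivatives may be put on the smooth factor, which keeps its bounded support.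
\<close>

lemma convolve_smooth:
  fixes \<eta> k :: "'a::euclidean_space \<Rightarrow> real"
  assumes [measurable]: "k \<in> borel_measurable borel" and k: "\<And>y. \<bar>k y\<bar> \<le> M"
  shows "k_times_cont_diff j \<eta> \<Longrightarrow> bounded_support \<eta> \<Longrightarrow> k_times_cont_diff j (convolve \<eta> k)"
proof (induction j arbitrary: \<eta>)
  case 0 then show ?case by (auto intro: convolve_continuous[OF _ _ _ k])
next
  case (Suc j)
  have "k_times_cont_diff 1 \<eta>" by (rule k_times_cont_diff_le[OF _ Suc.prems(1)]) simp
  show ?case
  proof (rule k_times_cont_diff_SucI)
    show "(convolve \<eta> k has_derivative (\<lambda>v. convolve (\<lambda>x. frechet_derivative \<eta> (at x) v) k x)) (at x)" for x
      using \<open>k_times_cont_diff 1 \<eta>\<close> Suc.prems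
      by (intro convolve_has_derivative[OF _ _ k]) (auto simp: cont_diff_bounded_support_def)
    show "k_times_cont_diff j (\<lambda>x. convolve (\<lambda>x. frechet_derivative \<eta> (at x) v) k x)" for v
      using Suc.prems by (intro Suc.IH bounded_support_frechet_derivative) auto
  qed
qed

lemma convolve_commute:
  fixes f k :: "'a::euclidean_space \<Rightarrow> real"
  assumes [measurable]: "f \<in> borel_measurable borel" "k \<in> borel_measurable borel"
  shows "convolve f k = convolve k f"
proof
  fix x
  have "(LINT y|lborel. f (x - y) * k y) = (LINT y|lborel. f (x - (x - y)) * k (x - y))"
    by (rule integral_lborel_reflect[symmetric]) measurable
  then show "convolve f k x = convolve k f x" by (simp add: convolve_def mult.commute)
qed

section \<open>Mollified sets and the classical perimeter\<close>

definition gradient :: "('a::euclidean_space \<Rightarrow> real) \<Rightarrow> 'a \<Rightarrow> 'a" where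
  "gradient f x = (\<Sum>b\<in>Basis. frechet_derivative f (at x) b *\<^sub>R b)"

definition mollifier :: "real \<Rightarrow> ('a::euclidean_space \<Rightarrow> real) \<Rightarrow> bool" where
  "mollifier \<delta> \<eta> \<longleftrightarrow> smooth \<eta> \<and> (\<forall>x. 0 \<le> \<eta> x) \<and> (\<forall>x. \<eta> (- x) = \<eta> x) \<and>
     (\<forall>x. norm x > \<delta> \<longrightarrow> \<eta> x = 0) \<and> (LINT x|lborel. \<eta> x) = 1"

lemma frechet_derivative_eq_inner_gradient:
  fixes f :: "'a::euclidean_space \<Rightarrow> real"
  assumes "f differentiable at x"
  shows "frechet_derivative f (at x) v = gradient f x \<bullet> v"
  unfolding gradient_def frechet_derivative_basis_expansion[OF assms, of v]
  by (simp add: inner_sum_left) (simp add: inner_commute mult.commute)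

context
  fixes \<delta> :: real and \<eta> :: "'a::euclidean_space \<Rightarrow> real"
  assumes \<eta>: "mollifier \<delta> \<eta>"
begin

lemma mollifier_smooth: "k_times_cont_diff k \<eta>"
  and mollifier_nonneg: "0 \<le> \<eta> x"
  and mollifier_even: "\<eta> (- x) = \<eta> x"
  and mollifier_support: "norm x > \<delta> \<Longrightarrow> \<eta> x = 0"
  and mollifier_integral: "(LINT x|lborel. \<eta> x) = 1"
  using \<eta> by (auto simp: mollifier_def smooth_def)

lemma mollifier_bounded_support: "bounded_support \<eta>"
  using mollifier_support unfolding bounded_support_def by blast

lemma mollifier_cont_diff: "cont_diff_bounded_support \<eta>"
  using mollifier_smooth mollifier_bounded_support by (simp only: cont_diff_bounded_support_def)

lemma mollifier_continuous: "continuous_on UNIV \<eta>"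
  using mollifier_smooth[of 0] by simp

lemma mollifier_measurable: "\<eta> \<in> borel_measurable borel"
  by (rule borel_measurable_continuous_onI[OF mollifier_continuous])

lemma mollifier_integrable: "integrable lborel \<eta>"
  using convolve_integrable[OF mollifier_continuous mollifier_bounded_support, of "\<lambda>_. 1" 1 0]
  by (simp add: mollifier_even)

lemma mollifier_nn_integral: "(\<integral>\<^sup>+x. ennreal (\<eta> x) \<partial>lborel) = 1"
  using nn_integral_eq_integral[OF mollifier_integrable] mollifier_nonneg mollifier_integral by simp

text \<open>
  The reason for using even bumps: moving the convolution from the test field to the set
  produces \<open>D\<eta>(x - y)\<close> in place of \<open>D\<eta>(y - x)\<close>.
\<close>

lemma mollifier_derivative_odd: "frechet_derivative \<eta> (at (- x)) v = - frechet_derivative \<eta> (at x) v"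
proof -
  have "((\<lambda>x. \<eta> (- x)) has_derivative (\<lambda>v. frechet_derivative \<eta> (at (- x)) (- v))) (at x)"
    by (rule has_derivative_compose[where f = uminus and f' = uminus])
       (auto intro!: derivative_eq_intros cont_diff_bounded_supportD[OF mollifier_cont_diff])
  then have "(\<eta> has_derivative (\<lambda>v. frechet_derivative \<eta> (at (- x)) (- v))) (at x)"
    by (simp add: mollifier_even)
  from frechet_derivative_at[OF this] have "frechet_derivative \<eta> (at x) v = frechet_derivative \<eta> (at (- x)) (- v)"
    by metis
  moreover have "linear (frechet_derivative \<eta> (at (- x)))"
    using cont_diff_bounded_supportD(3)[OF mollifier_cont_diff] has_derivative_linear by blast
  ultimately show ?thesis by (simp add: linear_neg)
qed

lemma mollifier_bound:
  assumes "\<And>x. \<bar>k x\<bar> \<le> M" and [measurable]: "k \<in> borel_measurable borel"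
  shows "\<bar>convolve \<eta> k x\<bar> \<le> M"
proof -
  note [measurable] = mollifier_measurable
  have M: "M \<ge> 0" using assms(1)[of 0] by linarith
  have i: "integrable lborel (\<lambda>y. \<eta> (x - y) * k y)"
    by (rule convolve_integrable[OF mollifier_continuous mollifier_bounded_support _ assms(1)]) measurable
  have i1: "integrable lborel (\<lambda>y. \<eta> (x - y) * M)"
    by (rule convolve_integrable[OF mollifier_continuous mollifier_bounded_support]) auto
  have "\<bar>convolve \<eta> k x\<bar> \<le> (LINT y|lborel. \<bar>\<eta> (x - y) * k y\<bar>)"
    unfolding convolve_def by (rule integral_abs_bound)
  also have "\<dots> \<le> (LINT y|lborel. \<eta> (x - y) * M)"
    using assms mollifier_nonneg by (intro integral_mono integrable_abs i i1) (auto simp: abs_mult intro: mult_left_mono)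
  also have "\<dots> = M" using integral_lborel_reflect[of \<eta> x] mollifier_integral by simp
  finally show ?thesis .
qed

text \<open>
  \<open>k\<close> is an indicator function or a component of a bounded vector field in the applications.
\<close>

lemma convolve_mollifier_derivative:
  assumes "\<And>x. \<bar>k x\<bar> \<le> M" and [measurable]: "k \<in> borel_measurable borel"
  shows "(convolve \<eta> k has_derivative (\<lambda>v. convolve (\<lambda>x. frechet_derivative \<eta> (at x) v) k x)) (at x)"
    and "convolve \<eta> k differentiable at x"
    and "frechet_derivative (convolve \<eta> k) (at x) = (\<lambda>v. convolve (\<lambda>x. frechet_derivative \<eta> (at x) v) k x)"
    and "continuous_on UNIV (gradient (convolve \<eta> k))"
    and "k_times_cont_diff j (convolve \<eta> k)"
proof -
  note [measurable] = mollifier_measurable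
  show D: "(convolve \<eta> k has_derivative (\<lambda>v. convolve (\<lambda>x. frechet_derivative \<eta> (at x) v) k x)) (at x)" for x
    by (rule convolve_has_derivative[OF mollifier_cont_diff _ assms(1)]) measurable
  then show "convolve \<eta> k differentiable at x" by (auto simp: differentiable_def)
  show F: "frechet_derivative (convolve \<eta> k) (at x) = (\<lambda>v. convolve (\<lambda>x. frechet_derivative \<eta> (at x) v) k x)" for x
    using frechet_derivative_at[OF D] by simp
  have *: "continuous_on UNIV (convolve (\<lambda>x. frechet_derivative \<eta> (at x) v) k)" for v
    by (rule convolve_continuous[OF cont_diff_bounded_supportD(4,5)[OF mollifier_cont_diff] _ assms(1)]) measurable
  show "continuous_on UNIV (gradient (convolve \<eta> k))"
    unfolding gradient_def F by (intro continuous_intros *)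
  show "k_times_cont_diff j (convolve \<eta> k)"
    by (rule convolve_smooth[OF _ assms(1)]) (auto intro: mollifier_smooth mollifier_bounded_support)
qed

definition mollify_field :: "('a \<Rightarrow> 'a) \<Rightarrow> 'a \<Rightarrow> 'a" where
  "mollify_field p x = (\<Sum>b\<in>Basis. convolve \<eta> (\<lambda>y. p y \<bullet> b) x *\<^sub>R b)"

context
  fixes p :: "'a \<Rightarrow> 'a" and R :: real
  assumes p_meas [measurable]: "p \<in> borel_measurable borel"
    and p_le: "\<And>x. norm (p x) \<le> 1" and p_supp: "\<And>x. norm x > R \<Longrightarrow> p x = 0"
begin

lemma field_component_le: "b \<in> Basis \<Longrightarrow> \<bar>p y \<bullet> b\<bar> \<le> 1"
  using Basis_le_norm[of b "p y"] p_le[of y] by linarith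

lemma mollify_field_support: "norm x > R + \<delta> \<Longrightarrow> mollify_field p x = 0"
proof -
  assume x: "norm x > R + \<delta>"
  have "\<eta> (x - y) * (p y \<bullet> b) = 0" for y b
  proof (cases "norm y > R")
    case False
    have "norm x \<le> norm (x - y) + norm y" using norm_triangle_ineq[of "x - y" y] by simp
    then have "norm (x - y) > \<delta>" using False x by linarith
    then show ?thesis using mollifier_support by simp
  qed (use p_supp in simp)
  then have *: "(\<lambda>y. \<eta> (x - y) * (p y \<bullet> b)) = (\<lambda>_. 0)" for b by (intro ext)
  show ?thesis unfolding mollify_field_def convolve_def * by simp
qed

text \<open>
  \<open>\<bar>q\<bar>\<^sup>2 = q \<bullet> (\<eta> * p) = \<eta> * (q \<bullet> p) \<le> \<bar>q\<bar>\<close> at the point where \<open>q = \<eta> * p\<close> is evaluated.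
\<close>

lemma mollify_field_le: "norm (mollify_field p x) \<le> 1"
proof -
  note [measurable] = mollifier_measurable
  let ?q = "mollify_field p x"
  have int: "integrable lborel (\<lambda>y. \<eta> (x - y) * (p y \<bullet> b))" if "b \<in> Basis" for b
    by (rule convolve_integrable[OF mollifier_continuous mollifier_bounded_support _ field_component_le[OF that]]) measurable
  have qz: "?q \<bullet> z = (\<Sum>b\<in>Basis. convolve \<eta> (\<lambda>y. p y \<bullet> b) x * (b \<bullet> z))" for z
    by (simp add: mollify_field_def inner_sum_left)
  have "?q \<bullet> ?q = (\<Sum>b\<in>Basis. convolve \<eta> (\<lambda>y. p y \<bullet> b) x * (b \<bullet> ?q))"
    by (rule qz)
  also have "\<dots> = (LINT y|lborel. (\<Sum>b\<in>Basis. \<eta> (x - y) * (p y \<bullet> b) * (b \<bullet> ?q)))"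
    unfolding convolve_def using int by (subst Bochner_Integration.integral_sum) auto
  also have "\<dots> = convolve \<eta> (\<lambda>y. p y \<bullet> ?q) x"
    unfolding convolve_def
    by (intro Bochner_Integration.integral_cong refl) (subst (3) euclidean_inner, simp add: sum_distrib_left mult.assoc inner_commute)
  also have "\<dots> \<le> norm ?q"
  proof -
    have "\<bar>p y \<bullet> ?q\<bar> \<le> norm ?q" for y
      using Cauchy_Schwarz_ineq2[of "p y" ?q] mult_right_mono[OF p_le[of y], of "norm ?q"] by simp
    then have "\<bar>convolve \<eta> (\<lambda>y. p y \<bullet> ?q) x\<bar> \<le> norm ?q" by (rule mollifier_bound) measurable
    then show ?thesis by simp
  qed
  finally have "(norm ?q)\<^sup>2 \<le> norm ?q" by (simp add: dot_square_norm)
  moreover have "norm ?q * 1 < norm ?q * norm ?q" if "norm ?q > 1"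
    using that by (intro mult_strict_left_mono) auto
  ultimately show ?thesis by (fastforce simp: power2_eq_square)
qed

lemma mollify_field_test: "mollify_field p \<in> test_fields"
proof -
  note [measurable] = mollifier_measurable
  have "k_times_cont_diff k (mollify_field p)" for k
    unfolding mollify_field_def[abs_def]
    by (intro k_times_cont_diff_sum k_times_cont_diff_linear_comp[where L = "\<lambda>r. r *\<^sub>R _"] bounded_linear_scaleR_left
          convolve_mollifier_derivative(5)[OF field_component_le]) auto
  moreover have "bounded {x. mollify_field p x \<noteq> 0}"
    by (rule bounded_subset[OF bounded_cball[of 0 "R + \<delta>"]]) (use mollify_field_support in force)
  ultimately show ?thesis by (simp add: test_fields_def smooth_def compact_closure)
qed

lemma mollify_field_divergence:
  "divergence (mollify_field p) x = (\<Sum>b\<in>Basis. frechet_derivative (convolve \<eta> (\<lambda>y. p y \<bullet> b)) (at x) b)"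
proof -
  note [measurable] = mollifier_measurable
  have "(mollify_field p has_derivative (\<lambda>v. \<Sum>b\<in>Basis. frechet_derivative (convolve \<eta> (\<lambda>y. p y \<bullet> b)) (at x) v *\<^sub>R b)) (at x)"
    unfolding mollify_field_def[abs_def]
    by (intro has_derivative_sum bounded_linear.has_derivative[OF bounded_linear_scaleR_left])
       (use convolve_mollifier_derivative(2)[OF field_component_le] in \<open>auto simp: frechet_derivative_works\<close>)
  from frechet_derivative_at[OF this, symmetric] show ?thesis
    by (simp add: divergence_def inner_sum_left inner_Basis if_distrib cong: if_cong)
qed

text \<open>
  The duality between the perimeter and the mollified gradient. Fubini's theorem moves the
  derivative of \<open>\<eta>\<close> from \<open>p\<close> to the indicator of \<open>E\<close>. The field \<open>p\<close> is merely measurable, so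
  that it can be chosen pointwise.
\<close>

lemma integral_divergence_mollify_field:
  assumes [measurable]: "E \<in> sets borel"
  shows "(LINT x:E|lebesgue. divergence (mollify_field p) x) =
    - (LINT y|lborel. p y \<bullet> gradient (convolve \<eta> (indicator E)) y)"
proof -
  note [measurable] = mollifier_measurable
  let ?D = "\<lambda>v x. frechet_derivative \<eta> (at x) v"
  note D = cont_diff_bounded_supportD[OF mollifier_cont_diff]
  have [measurable]: "?D v \<in> borel_measurable borel" for v
    by (intro borel_measurable_continuous_onI D)
  have supp: "?D b x = 0" if "norm x > \<delta>" for x b
    by (rule frechet_derivative_zero_outside[OF mollifier_support that])
  have pair: "integrable (lborel \<Otimes>\<^sub>M lborel) (\<lambda>(x, y). indicator E x * (?D b (x - y) * (p y \<bullet> b)))" if "b \<in> Basis" for b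
  proof -
    obtain B where B: "\<And>x. \<bar>?D b x\<bar> \<le> B" "B \<ge> 0" using continuous_bounded_support_bounded[OF D(4,5)] by metis
    have [measurable]: "cball (0::'a) r \<in> sets borel" for r by simp
    have "integrable (lborel \<Otimes>\<^sub>M lborel) (\<lambda>z. B * indicator (cball (0::'a) (R + \<delta>) \<times> cball (0::'a) R) z)"
      using emeasure_lborel_cball_finite[of "0::'a" R] emeasure_lborel_cball_finite[of "0::'a" "R+\<delta>"]
      by (intro integrable_mult_right integrable_real_indicator)
         (auto simp: lborel.emeasure_pair_measure_Times ennreal_mult_less_top)
    then show ?thesis
    proof (rule Bochner_Integration.integrable_bound)
      show "AE z in lborel \<Otimes>\<^sub>M lborel. norm (case z of (x, y) \<Rightarrow> indicator E x * (?D b (x - y) * (p y \<bullet> b)))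
          \<le> norm (B * indicator (cball (0::'a) (R + \<delta>) \<times> cball (0::'a) R) z)"
      proof (intro AE_I2, clarify)
        fix x y :: 'a
        have *: "\<bar>indicator E x * (?D b (x - y) * (p y \<bullet> b))\<bar> \<le> B"
          using mult_mono[OF B(1)[of "x - y"] field_component_le[OF that, of y]] B(2)
          by (auto simp: indicator_def abs_mult)
        have "indicator E x * (?D b (x - y) * (p y \<bullet> b)) = 0" if "\<not> (norm x \<le> R + \<delta> \<and> norm y \<le> R)"
        proof (cases "norm y > R")
          case False
          have "norm x \<le> norm (x - y) + norm y" using norm_triangle_ineq[of "x - y" y] by simp
          then have "norm (x - y) > \<delta>" using False that by linarith
          then show ?thesis using supp by simp
        qed (use p_supp in simp)
        then show "norm (indicator E x * (?D b (x - y) * (p y \<bullet> b)))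
          \<le> norm (B * indicator (cball (0::'a) (R + \<delta>) \<times> cball (0::'a) R) (x, y))"
          using * B(2) by (auto simp: indicator_def)
      qed
    qed measurable
  qed
  have grad: "p y \<bullet> gradient (convolve \<eta> (indicator E)) y
      = (\<Sum>b\<in>Basis. (p y \<bullet> b) * convolve (?D b) (indicator E) y)" for y
    using convolve_mollifier_derivative(3)[of "indicator E" 1]
    by (simp add: gradient_def inner_sum_right mult.commute indicator_def)
  have inner: "(LINT x|lborel. indicator E x * (?D b (x - y) * (p y \<bullet> b))) = - ((p y \<bullet> b) * convolve (?D b) (indicator E) y)"
    for b y
  proof -
    have "?D b (x - y) = - ?D b (y - x)" for x using mollifier_derivative_odd[of "y - x" b] by simp
    then have "(LINT x|lborel. indicator E x * (?D b (x - y) * (p y \<bullet> b)))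
        = (LINT x|lborel. - (p y \<bullet> b) * (?D b (y - x) * indicator E x))"
      by (intro Bochner_Integration.integral_cong refl) (simp add: mult_ac)
    also have "\<dots> = - ((p y \<bullet> b) * convolve (?D b) (indicator E) y)"
      unfolding convolve_def by (subst integral_mult_right_zero) simp
    finally show ?thesis .
  qed
  have "(LINT x:E|lebesgue. divergence (mollify_field p) x)
      = (LINT x|lebesgue. (\<Sum>b\<in>Basis. indicator E x * convolve (?D b) (\<lambda>y. p y \<bullet> b) x))"
    unfolding set_lebesgue_integral_def mollify_field_divergence
    by (intro Bochner_Integration.integral_cong refl)
       (simp add: sum_distrib_left convolve_mollifier_derivative(3)[OF field_component_le])
  also have "\<dots> = (LINT x|lborel. (\<Sum>b\<in>Basis. indicator E x * convolve (?D b) (\<lambda>y. p y \<bullet> b) x))"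
    unfolding convolve_def by (intro integral_completion) measurable
  also have "\<dots> = (LINT x|lborel. (\<Sum>b\<in>Basis. (LINT y|lborel. indicator E x * (?D b (x - y) * (p y \<bullet> b)))))"
    by (simp add: convolve_def)
  also have "\<dots> = (\<Sum>b\<in>Basis. LINT x|lborel. (LINT y|lborel. indicator E x * (?D b (x - y) * (p y \<bullet> b))))"
    using lborel_pair.integrable_fst[OF pair] by (intro Bochner_Integration.integral_sum) simp
  also have "\<dots> = (\<Sum>b\<in>Basis. LINT y|lborel. (LINT x|lborel. indicator E x * (?D b (x - y) * (p y \<bullet> b))))"
    using pair by (intro sum.cong refl lborel_pair.Fubini_integral[symmetric])
  also have "\<dots> = (\<Sum>b\<in>Basis. LINT y|lborel. - ((p y \<bullet> b) * convolve (?D b) (indicator E) y))"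
    by (simp only: inner)
  also have "\<dots> = (LINT y|lborel. (\<Sum>b\<in>Basis. - ((p y \<bullet> b) * convolve (?D b) (indicator E) y)))"
  proof (rule Bochner_Integration.integral_sum[symmetric])
    fix b :: 'a assume b: "b \<in> Basis"
    show "integrable lborel (\<lambda>y. - ((p y \<bullet> b) * convolve (?D b) (indicator E) y))"
      using lborel_pair.integrable_snd[of "\<lambda>x y. indicator E x * (?D b (x - y) * (p y \<bullet> b))"] pair[OF b]
      unfolding inner by simp
  qed
  also have "\<dots> = - (LINT y|lborel. p y \<bullet> gradient (convolve \<eta> (indicator E)) y)"
    by (simp add: grad sum_negf)
  finally show ?thesis .
qed

end

end

lemma nn_integral_le_of_balls:
  fixes f :: "'a::euclidean_space \<Rightarrow> ennreal"
  assumes [measurable]: "f \<in> borel_measurable borel"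
    and le: "\<And>R. (\<integral>\<^sup>+x. f x * indicator (cball 0 R) x \<partial>lborel) \<le> C"
  shows "(\<integral>\<^sup>+x. f x \<partial>lborel) \<le> C"
proof -
  have [measurable]: "cball (0::'a) R \<in> sets borel" for R by simp
  have "(SUP n. f x * indicator (cball 0 (real n)) x) = f x" for x
  proof (rule antisym)
    show "(SUP n. f x * indicator (cball 0 (real n)) x) \<le> f x"
      by (rule SUP_least) (auto simp: indicator_def)
    obtain n where "norm x \<le> real n" using real_arch_simple by blast
    then show "f x \<le> (SUP n. f x * indicator (cball 0 (real n)) x)"
      by (intro SUP_upper2[of n]) (auto simp: indicator_def)
  qed
  then have "(\<integral>\<^sup>+x. f x \<partial>lborel) = (\<integral>\<^sup>+x. (SUP n. f x * indicator (cball 0 (real n)) x) \<partial>lborel)" by simp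
  also have "\<dots> = (SUP n. \<integral>\<^sup>+x. f x * indicator (cball 0 (real n)) x \<partial>lborel)"
    by (intro nn_integral_monotone_convergence_SUP)
       (auto simp: incseq_def le_fun_def indicator_def)
  also have "\<dots> \<le> C" by (rule SUP_least) (rule le)
  finally show ?thesis .
qed

context
  fixes \<delta> :: real and \<eta> :: "'a::euclidean_space \<Rightarrow> real" and E :: "'a set"
  assumes \<eta>: "mollifier \<delta> \<eta>" and E [measurable]: "E \<in> sets borel"
begin

lemma mollified_gradient_continuous: "continuous_on UNIV (gradient (convolve \<eta> (indicator E)))"
  by (rule convolve_mollifier_derivative(4)[OF \<eta>, of _ 1]) (auto simp: indicator_def)

lemma mollified_gradient_measurable:
  "gradient (convolve \<eta> (indicator E)) \<in> borel_measurable borel"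
  by (rule borel_measurable_continuous_onI[OF mollified_gradient_continuous])

lemma mollified_gradient_integrable_cball:
  "integrable lborel (\<lambda>x. norm (gradient (convolve \<eta> (indicator E)) x) * indicator (cball 0 R) x)"
proof -
  note [measurable] = mollified_gradient_measurable
  let ?g = "gradient (convolve \<eta> (indicator E))"
  have "compact (cball (0::'a) R)" by simp
  then have "integrable lborel (\<lambda>x. indicator (cball 0 R) x *\<^sub>R norm (?g x))"
    by (intro borel_integrable_compact continuous_intros continuous_on_subset[OF mollified_gradient_continuous]) auto
  then show ?thesis by (simp add: mult.commute)
qed

text \<open>
  Duality with the field \<open>p = - \<nabla>w / \<bar>\<nabla>w\<bar>\<close>, truncated to a ball.
\<close>

lemma mollified_gradient_le_perimeter:
  "(\<integral>\<^sup>+x. ennreal (norm (gradient (convolve \<eta> (indicator E)) x)) \<partial>lborel) \<le> perimeter E"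
proof (rule nn_integral_le_of_balls)
  note [measurable] = mollified_gradient_measurable
  let ?g = "gradient (convolve \<eta> (indicator E))"
  show "(\<lambda>x. ennreal (norm (?g x))) \<in> borel_measurable borel" by measurable
  fix R
  have [measurable]: "cball (0::'a) R \<in> sets borel" by simp
  define p where "p y = - (indicator (cball 0 R) y / norm (?g y)) *\<^sub>R ?g y" for y
  have p: "p \<in> borel_measurable borel" "\<And>y. norm (p y) \<le> 1" "\<And>y. norm y > R \<Longrightarrow> p y = 0"
  proof -
    show "p \<in> borel_measurable borel" unfolding p_def[abs_def] by measurable
  qed (auto simp: p_def indicator_def)
  have pg: "p y \<bullet> ?g y = - (norm (?g y) * indicator (cball 0 R) y)" for y
    by (auto simp: p_def dot_square_norm power2_eq_square)
  have "(LINT x:E|lebesgue. divergence (mollify_field \<eta> p) x) = - (LINT y|lborel. p y \<bullet> ?g y)"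
    by (rule integral_divergence_mollify_field[OF \<eta> p E])
  also have "\<dots> = (LINT y|lborel. norm (?g y) * indicator (cball 0 R) y)" unfolding pg by simp
  finally have eq: "(LINT x:E|lebesgue. divergence (mollify_field \<eta> p) x) = (LINT y|lborel. norm (?g y) * indicator (cball 0 R) y)" .
  have "(\<integral>\<^sup>+x. ennreal (norm (?g x)) * indicator (cball 0 R) x \<partial>lborel)
      = (\<integral>\<^sup>+x. ennreal (norm (?g x) * indicator (cball 0 R) x) \<partial>lborel)"
    by (intro nn_integral_cong) (auto simp: indicator_def)
  also have "\<dots> = ennreal (LINT y|lborel. norm (?g y) * indicator (cball 0 R) y)"
    by (rule nn_integral_eq_integral[OF mollified_gradient_integrable_cball]) (rule AE_I2, simp)
  also have "\<dots> \<le> perimeter E"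
    unfolding perimeter_def eq[symmetric]
    by (rule SUP_upper) (use mollify_field_test[OF \<eta> p] mollify_field_le[OF \<eta> p] in blast)
  finally show "(\<integral>\<^sup>+x. ennreal (norm (?g x)) * indicator (cball 0 R) x \<partial>lborel) \<le> perimeter E" .
qed

end

lemma convolve_mollifier_close:
  fixes g :: "'a::euclidean_space \<Rightarrow> real"
  assumes \<eta>: "mollifier \<delta> \<eta>" and g: "continuous_on UNIV g" "bounded_support g"
    and close: "\<And>y. norm y \<le> \<delta> \<Longrightarrow> \<bar>g (x - y) - g x\<bar> \<le> e"
  shows "\<bar>convolve g \<eta> x - g x\<bar> \<le> e"
proof -
  note [measurable] = mollifier_measurable[OF \<eta>]
  have [measurable]: "g \<in> borel_measurable borel" by (rule borel_measurable_continuous_onI[OF g(1)])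
  obtain B where B: "\<And>x. \<bar>\<eta> x\<bar> \<le> B"
    using continuous_bounded_support_bounded[OF mollifier_continuous[OF \<eta>] mollifier_bounded_support[OF \<eta>]] by metis
  have i1: "integrable lborel (\<lambda>y. g (x - y) * \<eta> y)" by (rule convolve_integrable[OF g _ B]) measurable
  have i2: "integrable lborel \<eta>" by (rule mollifier_integrable[OF \<eta>])
  have "convolve g \<eta> x - g x = (LINT y|lborel. (g (x - y) - g x) * \<eta> y)"
    unfolding convolve_def using i1 i2 mollifier_integral[OF \<eta>] by (simp add: left_diff_distrib)
  also have "\<bar>\<dots>\<bar> \<le> (LINT y|lborel. \<bar>(g (x - y) - g x) * \<eta> y\<bar>)" by (rule integral_abs_bound)
  also have "\<dots> \<le> (LINT y|lborel. e * \<eta> y)"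
  proof (intro integral_mono integrable_abs)
    show "integrable lborel (\<lambda>y. (g (x - y) - g x) * \<eta> y)" using i1 i2 by (simp add: left_diff_distrib)
    fix y show "\<bar>(g (x - y) - g x) * \<eta> y\<bar> \<le> e * \<eta> y"
      using close[of y] mollifier_nonneg[OF \<eta>, of y] mollifier_support[OF \<eta>, of y]
      by (cases "norm y \<le> \<delta>") (auto simp: abs_mult intro: mult_right_mono)
  qed (use i2 in simp)
  also have "\<dots> = e" using mollifier_integral[OF \<eta>] by simp
  finally show ?thesis .
qed

lemma test_field_component:
  assumes p: "p \<in> test_fields" and b: "b \<in> Basis"
  shows "cont_diff_bounded_support (\<lambda>x. p x \<bullet> b)"
    and "frechet_derivative (\<lambda>x. p x \<bullet> b) (at x) v = frechet_derivative p (at x) v \<bullet> b"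
proof -
  have sm: "k_times_cont_diff k p" for k using p by (simp add: test_fields_def smooth_def)
  have "bounded {x. p x \<noteq> 0}"
    using p bounded_subset[OF compact_imp_bounded closure_subset] by (auto simp: test_fields_def)
  then obtain R where R: "\<And>x. p x \<noteq> 0 \<Longrightarrow> norm x \<le> R" by (auto simp: bounded_iff)
  have "k_times_cont_diff 1 (\<lambda>x. p x \<bullet> b)"
    by (rule k_times_cont_diff_linear_comp[where L = "\<lambda>z. z \<bullet> b", OF bounded_linear_inner_left sm])
  moreover have "bounded_support (\<lambda>x. p x \<bullet> b)"
    unfolding bounded_support_def using R by (metis inner_zero_left not_less)
  ultimately show "cont_diff_bounded_support (\<lambda>x. p x \<bullet> b)" by (simp only: cont_diff_bounded_support_def)
  have "(p has_derivative frechet_derivative p (at x)) (at x)"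
    by (rule k_times_cont_diff_has_derivative[OF sm])
  then have "((\<lambda>x. p x \<bullet> b) has_derivative (\<lambda>v. frechet_derivative p (at x) v \<bullet> b)) (at x)"
    by (rule bounded_linear.has_derivative[OF bounded_linear_inner_left])
  from frechet_derivative_at[OF this]
  show "frechet_derivative (\<lambda>x. p x \<bullet> b) (at x) v = frechet_derivative p (at x) v \<bullet> b" by metis
qed

text \<open>
  The divergence of \<open>\<eta> * p\<close> is also the convolution of \<open>\<eta>\<close> with the divergence of \<open>p\<close>, hence
  uniformly close to the latter when \<open>\<eta>\<close> is concentrated near \<open>0\<close>, and both vanish outside a
  fixed ball. Duality turns the integral over \<open>E\<close> of the former into one of \<open>\<nabla>w\<close>.
\<close>

lemma test_field_divergence_le_mollified_gradient:
  assumes p: "p \<in> test_fields" "\<And>x. norm (p x) \<le> 1" and E [measurable]: "E \<in> sets borel" and "e > 0"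
  obtains \<delta> R where "\<delta> > 0" "\<And>\<eta>. mollifier \<delta> \<eta> \<Longrightarrow>
    (LINT x:E|lebesgue. divergence p x) \<le>
      (LINT x|lborel. norm (gradient (convolve \<eta> (indicator E)) x) * indicator (cball 0 R) x) + e"
proof -
  let ?p = "\<lambda>b x. p x \<bullet> b"
  note C = test_field_component[OF p(1)]
  note D = cont_diff_bounded_supportD[OF C(1)]
  have "bounded {x. p x \<noteq> 0}"
    using p bounded_subset[OF compact_imp_bounded closure_subset] by (auto simp: test_fields_def)
  then obtain R where R: "\<And>x. norm x > R \<Longrightarrow> p x = 0" unfolding bounded_iff by (metis mem_Collect_eq not_less)
  define V where "V = measure lborel (cball (0::'a) (R + 1))"
  have V: "V \<ge> 0" by (simp add: V_def)
  (* Summed over the coordinates and integrated over the ball of volume V this error stays below e. *)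
  define e' where "e' = e / (real DIM('a) * (V + 1))"
  have e': "e' > 0" using \<open>e > 0\<close> V by (simp add: e'_def)
  have "\<exists>d>0. \<forall>x y. dist x y < d \<longrightarrow> \<bar>frechet_derivative (?p b) (at x) b - frechet_derivative (?p b) (at y) b\<bar> < e'"
    if "b \<in> Basis" for b
    using continuous_bounded_support_uniform[OF D(4,5)[OF that] e'] by metis
  then obtain d where d: "\<And>b. b \<in> Basis \<Longrightarrow> d b > 0"
    "\<And>b x y. b \<in> Basis \<Longrightarrow> dist x y < d b \<Longrightarrow> \<bar>frechet_derivative (?p b) (at x) b - frechet_derivative (?p b) (at y) b\<bar> < e'"
    by metis
  define m where "m = Min (d ` Basis)"
  have m: "m > 0" "\<And>b. b \<in> Basis \<Longrightarrow> m \<le> d b" using d by (auto simp: m_def)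
  show ?thesis
  proof (rule that[of "min 1 (m/2)" R])
    show "min 1 (m/2) > 0" using m by simp
    fix \<eta> :: "'a \<Rightarrow> real" assume \<eta>: "mollifier (min 1 (m/2)) \<eta>"
    note [measurable] = mollifier_measurable[OF \<eta>] mollified_gradient_measurable[OF \<eta> E]
    obtain B where B: "\<And>x. \<bar>\<eta> x\<bar> \<le> B"
      using continuous_bounded_support_bounded[OF mollifier_continuous[OF \<eta>] mollifier_bounded_support[OF \<eta>]] by metis
    have p_meas [measurable]: "p \<in> borel_measurable borel"
    proof (rule borel_measurable_continuous_onI)
      have "k_times_cont_diff 0 p" using p by (simp add: test_fields_def smooth_def)
      then show "continuous_on UNIV p" by simp
    qed
    let ?q = "mollify_field \<eta> p"
    have div_q: "divergence ?q x = (\<Sum>b\<in>Basis. convolve (\<lambda>x. frechet_derivative (?p b) (at x) b) \<eta> x)" for x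
    proof -
      have "divergence ?q x = (\<Sum>b\<in>Basis. frechet_derivative (convolve \<eta> (?p b)) (at x) b)"
        by (rule mollify_field_divergence[OF \<eta> p_meas p(2)]) (rule R)
      also have "\<dots> = (\<Sum>b\<in>Basis. convolve (\<lambda>x. frechet_derivative (?p b) (at x) b) \<eta> x)"
      proof (rule sum.cong[OF refl])
        fix b :: 'a assume b: "b \<in> Basis"
        have "convolve \<eta> (?p b) = convolve (?p b) \<eta>" by (rule convolve_commute) measurable
        moreover have "(convolve (?p b) \<eta> has_derivative (\<lambda>v. convolve (\<lambda>x. frechet_derivative (?p b) (at x) v) \<eta> x)) (at x)"
          by (rule convolve_has_derivative[OF C(1)[OF b] _ B]) measurable
        ultimately show "frechet_derivative (convolve \<eta> (?p b)) (at x) b = convolve (\<lambda>x. frechet_derivative (?p b) (at x) b) \<eta> x"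
          by (simp add: frechet_derivative_at[symmetric])
      qed
      finally show ?thesis .
    qed
    have cont: "continuous_on UNIV (divergence p)" "continuous_on UNIV (divergence ?q)"
    proof -
      have "divergence p = (\<lambda>x. \<Sum>b\<in>Basis. frechet_derivative (?p b) (at x) b)"
        by (simp add: fun_eq_iff divergence_def C(2))
      then show "continuous_on UNIV (divergence p)" using D(4) by (auto intro: continuous_intros)
      have "divergence ?q = (\<lambda>x. \<Sum>b\<in>Basis. convolve (\<lambda>x. frechet_derivative (?p b) (at x) b) \<eta> x)"
        by (simp add: fun_eq_iff div_q)
      moreover have "continuous_on UNIV (convolve (\<lambda>x. frechet_derivative (?p b) (at x) b) \<eta>)" if "b \<in> Basis" for b
        by (rule convolve_continuous[OF D(4,5)[OF that] _ B]) measurable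
      ultimately show "continuous_on UNIV (divergence ?q)" by (auto intro: continuous_intros)
    qed
    note [measurable] = cont[THEN borel_measurable_continuous_onI]
    have close: "\<bar>divergence p x - divergence ?q x\<bar> \<le> real DIM('a) * e'" for x
    proof -
      have "\<bar>divergence p x - divergence ?q x\<bar>
          = \<bar>\<Sum>b\<in>Basis. frechet_derivative (?p b) (at x) b - convolve (\<lambda>x. frechet_derivative (?p b) (at x) b) \<eta> x\<bar>"
        by (simp add: divergence_def[of p] div_q C(2) sum_subtractf)
      also have "\<dots> \<le> (\<Sum>b\<in>(Basis::'a set). e')"
      proof (intro order_trans[OF sum_abs] sum_mono)
        fix b :: 'a assume b: "b \<in> Basis"
        have "\<bar>convolve (\<lambda>x. frechet_derivative (?p b) (at x) b) \<eta> x - frechet_derivative (?p b) (at x) b\<bar> \<le> e'"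
        proof (rule convolve_mollifier_close[OF \<eta> D(4,5)[OF b]])
          fix y :: 'a assume "norm y \<le> min 1 (m / 2)"
          then have "dist (x - y) x < d b" using m(1) m(2)[OF b] by (simp add: dist_norm)
          then show "\<bar>frechet_derivative (?p b) (at (x - y)) b - frechet_derivative (?p b) (at x) b\<bar> \<le> e'"
            using d(2)[OF b] less_imp_le by blast
        qed
        then show "\<bar>frechet_derivative (?p b) (at x) b - convolve (\<lambda>x. frechet_derivative (?p b) (at x) b) \<eta> x\<bar> \<le> e'"
          by (simp add: abs_minus_commute)
      qed
      finally show ?thesis by simp
    qed
    have div_p0: "divergence p x = 0" if "norm x > R" for x
      using frechet_derivative_zero_outside[of R p, OF R that] by (simp add: divergence_def)
    have div_q0: "divergence ?q x = 0" if "norm x > R + 1" for x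
    proof -
      have "?q z = 0" if "norm z > R + 1" for z
        by (rule mollify_field_support[OF \<eta> p_meas p(2), where R = R]) (use R that in auto)
      from frechet_derivative_zero_outside[of "R+1" ?q, OF this that] show ?thesis by (simp add: divergence_def)
    qed
    let ?h = "\<lambda>x. indicator E x * (divergence p x - divergence ?q x)"
    have ih: "integrable lborel ?h" "\<bar>LINT x|lborel. ?h x\<bar> \<le> (real DIM('a) * e') * V"
      unfolding V_def
      by (rule integral_bounded_support[of ?h "real DIM('a) * e'" 0 "R+1"];
          use close e' div_p0 div_q0 in \<open>auto simp: indicator_def\<close>)+
    obtain B1 where B1: "\<And>x. \<bar>divergence p x\<bar> \<le> B1"
      using continuous_bounded_support_bounded[OF cont(1)] div_p0 unfolding bounded_support_def by metis
    have ip: "integrable lborel (\<lambda>x. indicator E x * divergence p x)"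
      by (rule integral_bounded_support(1)[of _ B1 0 R])
         (use B1 div_p0 B1[of 0] in \<open>auto simp: indicator_def intro: order_trans[OF abs_ge_zero B1]\<close>)
    have "integrable lborel (\<lambda>x. indicator E x * divergence p x - ?h x)" by (rule Bochner_Integration.integrable_diff[OF ip ih(1)])
    then have iq: "integrable lborel (\<lambda>x. indicator E x * divergence ?q x)" by (simp add: algebra_simps)
    have LE: "(LINT x:E|lebesgue. f x) = (LINT x|lborel. indicator E x * f x)" if "continuous_on UNIV f" for f :: "'a \<Rightarrow> real"
      unfolding set_lebesgue_integral_def using borel_measurable_continuous_onI[OF that]
      by (subst integral_completion) auto
    have "(LINT x:E|lebesgue. divergence p x) = (LINT x:E|lebesgue. divergence ?q x) + (LINT x|lborel. ?h x)"
      unfolding LE[OF cont(1)] LE[OF cont(2)]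
      using ip iq by (simp add: right_diff_distrib)
    also have "(LINT x|lborel. ?h x) \<le> (real DIM('a) * e') * V" using ih(2) by linarith
    also have "(real DIM('a) * e') * V \<le> e"
    proof -
      have "real DIM('a) * e' * V = e * (V / (V + 1))" by (simp add: e'_def)
      also have "\<dots> \<le> e * 1" using V \<open>e > 0\<close> by (intro mult_left_mono) auto
      finally show ?thesis by simp
    qed
    also have "(LINT x:E|lebesgue. divergence ?q x) = - (LINT y|lborel. p y \<bullet> gradient (convolve \<eta> (indicator E)) y)"
      by (rule integral_divergence_mollify_field[OF \<eta> p_meas p(2) R E])
    also have "\<dots> = (LINT y|lborel. - (p y \<bullet> gradient (convolve \<eta> (indicator E)) y))" by simp
    also have "\<dots> \<le> (LINT x|lborel. norm (gradient (convolve \<eta> (indicator E)) x) * indicator (cball 0 R) x)"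
    proof -
      let ?g = "gradient (convolve \<eta> (indicator E))"
      have le: "\<bar>p y \<bullet> ?g y\<bar> \<le> norm (?g y) * indicator (cball 0 R) y" for y
        using Cauchy_Schwarz_ineq2[of "p y" "?g y"] mult_right_mono[OF p(2)[of y], of "norm (?g y)"] R[of y]
        by (auto simp: indicator_def)
      note i = mollified_gradient_integrable_cball[OF \<eta> E, of R]
      have "integrable lborel (\<lambda>y. p y \<bullet> ?g y)"
        by (rule Bochner_Integration.integrable_bound[OF i]) (use le in \<open>auto intro: order_trans[OF _ abs_ge_self]\<close>)
      then show ?thesis
        by (intro integral_mono i) (use le in \<open>auto simp: abs_le_iff\<close>)
    qed
    finally show "(LINT x:E|lebesgue. divergence p x) \<le>
      (LINT x|lborel. norm (gradient (convolve \<eta> (indicator E)) x) * indicator (cball 0 R) x) + e" by simp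
  qed
qed

section \<open>Nonlocal energy and mollification\<close>

text \<open>
  For the indicator of \<open>E\<close>, the measure of the symmetric difference of \<open>E\<close> and its translate.
\<close>

definition shift_difference :: "('a::euclidean_space \<Rightarrow> real) \<Rightarrow> 'a \<Rightarrow> ennreal" where
  "shift_difference u h = (\<integral>\<^sup>+x. ennreal \<bar>u (x + h) - u x\<bar> \<partial>lborel)"

definition nonlocal_energy :: "('a::euclidean_space \<Rightarrow> ennreal) \<Rightarrow> ('a \<Rightarrow> real) \<Rightarrow> ennreal" where
  "nonlocal_energy \<rho> u = (\<integral>\<^sup>+h. ennreal (1 / norm h) * \<rho> h * shift_difference u h \<partial>lborel)"

lemma shift_difference_measurable [measurable]:
  assumes [measurable]: "u \<in> borel_measurable borel"
  shows "shift_difference u \<in> borel_measurable borel"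
  unfolding shift_difference_def[abs_def] by measurable

text \<open>
  Substitute \<open>x = y + h\<close> and exchange the integrals. Borel measurability of the set and of the
  kernel makes Fubini's theorem applicable: a Lebesgue measurable \<open>\<rho>\<close> composed with
  \<open>(x, y) \<mapsto> x - y\<close> need not be measurable for the product \<open>\<sigma>\<close>-algebra.
\<close>

lemma nonlocal_perimeter_eq_energy:
  fixes E :: "'a::euclidean_space set"
  assumes [measurable]: "E \<in> sets borel" "\<rho> \<in> borel_measurable borel"
  shows "nonlocal_perimeter \<rho> E = nonlocal_energy \<rho> (indicator E)"
proof -
  let ?u = "indicator E :: 'a \<Rightarrow> real"
  have "nonlocal_perimeter \<rho> E
      = (\<integral>\<^sup>+y. (\<integral>\<^sup>+x. ennreal (\<bar>?u x - ?u y\<bar> / norm (x - y)) * \<rho> (x - y) \<partial>lborel) \<partial>lborel)"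
    unfolding nonlocal_perimeter_def by (simp add: nn_integral_completion)
  also have "\<dots> = (\<integral>\<^sup>+y. (\<integral>\<^sup>+h. ennreal (\<bar>?u (y + h) - ?u y\<bar> / norm h) * \<rho> h \<partial>lborel) \<partial>lborel)"
  proof (rule nn_integral_cong)
    fix y
    have "(\<lambda>x. ennreal (\<bar>?u x - ?u y\<bar> / norm (x - y)) * \<rho> (x - y)) \<in> borel_measurable borel" by measurable
    from nn_integral_lborel_shift[OF this, of y]
    show "(\<integral>\<^sup>+x. ennreal (\<bar>?u x - ?u y\<bar> / norm (x - y)) * \<rho> (x - y) \<partial>lborel)
        = (\<integral>\<^sup>+h. ennreal (\<bar>?u (y + h) - ?u y\<bar> / norm h) * \<rho> h \<partial>lborel)" by simp
  qed
  also have "\<dots> = (\<integral>\<^sup>+h. (\<integral>\<^sup>+y. ennreal (\<bar>?u (y + h) - ?u y\<bar> / norm h) * \<rho> h \<partial>lborel) \<partial>lborel)"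
    by (rule lborel_pair.Fubini') measurable
  also have "\<dots> = (\<integral>\<^sup>+h. (\<integral>\<^sup>+y. (ennreal (1 / norm h) * \<rho> h) * ennreal \<bar>?u (y + h) - ?u y\<bar> \<partial>lborel) \<partial>lborel)"
  proof (intro nn_integral_cong)
    fix h y :: 'a
    have "ennreal (\<bar>?u (y + h) - ?u y\<bar> / norm h) = ennreal (1 / norm h) * ennreal \<bar>?u (y + h) - ?u y\<bar>"
      by (simp add: ennreal_mult[symmetric])
    then show "ennreal (\<bar>?u (y + h) - ?u y\<bar> / norm h) * \<rho> h = (ennreal (1 / norm h) * \<rho> h) * ennreal \<bar>?u (y + h) - ?u y\<bar>"
      by (simp add: ac_simps)
  qed
  also have "\<dots> = nonlocal_energy \<rho> ?u"
    unfolding nonlocal_energy_def shift_difference_def by (intro nn_integral_cong nn_integral_cmult) measurable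
  finally show ?thesis .
qed

lemma AE_lborel_translate:
  fixes P :: "'a::euclidean_space \<Rightarrow> bool"
  assumes "AE x in lborel. P x" shows "AE x in lborel. P (x - a)"
proof -
  obtain N where N: "N \<in> null_sets lborel" "{x. \<not> P x} \<subseteq> N"
    using assms by (auto elim!: AE_E simp: null_sets_def)
  from AE_not_in[OF null_sets_translation[OF N(1), of a]]
  show ?thesis by eventually_elim (use N in auto)
qed

text \<open>
  With \<open>lebesgue_set_AE_borel\<close> this reduces everything to Borel sets and Borel kernels.
\<close>

lemma nonlocal_perimeter_cong_AE:
  assumes "AE x in lborel. \<rho> x = \<rho>' x" "AE x in lborel. x \<in> E \<longleftrightarrow> x \<in> E'"
  shows "nonlocal_perimeter \<rho> E = nonlocal_perimeter \<rho>' E'"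
  unfolding nonlocal_perimeter_def
proof (rule nn_integral_cong_AE, use AE_completion[OF assms(2)] in eventually_elim)
  fix y assume y: "y \<in> E \<longleftrightarrow> y \<in> E'"
  show "(\<integral>\<^sup>+x. ennreal (\<bar>indicator E x - indicator E y\<bar> / norm (x - y)) * \<rho> (x - y) \<partial>lebesgue)
      = (\<integral>\<^sup>+x. ennreal (\<bar>indicator E' x - indicator E' y\<bar> / norm (x - y)) * \<rho>' (x - y) \<partial>lebesgue)"
    by (rule nn_integral_cong_AE, use AE_completion[OF assms(2)] AE_completion[OF AE_lborel_translate[OF assms(1), of y]] in eventually_elim)
       (use y in \<open>simp add: indicator_def\<close>)
qed

lemma lebesgue_set_AE_borel:
  assumes "E \<in> sets (lebesgue :: 'a::euclidean_space measure)"
  obtains E' where "E' \<in> sets borel" "AE x in lborel. x \<in> E \<longleftrightarrow> x \<in> E'"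
proof -
  obtain S N N' where S: "E = S \<union> N" "N \<subseteq> N'" "N' \<in> null_sets lborel" "S \<in> sets lborel"
    using assms by (rule sets_completionE)
  show ?thesis
  proof (rule that[of S])
    show "AE x in lborel. x \<in> E \<longleftrightarrow> x \<in> S"
      using AE_not_in[OF S(3)] by eventually_elim (use S in auto)
  qed (use S in simp)
qed

text \<open>
  A convolution with a probability density is an average of translates, and translation does
  not change \<open>shift_difference\<close>.
\<close>

lemma shift_difference_convolve_le:
  fixes k :: "'a::euclidean_space \<Rightarrow> real"
  assumes \<eta>: "mollifier \<delta> \<eta>" and k: "\<And>y. \<bar>k y\<bar> \<le> M" and [measurable]: "k \<in> borel_measurable borel"
  shows "shift_difference (convolve \<eta> k) h \<le> shift_difference k h"
proof -
  note [measurable] = mollifier_measurable[OF \<eta>]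
  have i: "integrable lborel (\<lambda>y. \<eta> y * k (x - y))" for x
    using convolve_integrable[OF mollifier_continuous[OF \<eta>] mollifier_bounded_support[OF \<eta>], of "\<lambda>y. k (x - y)" M 0] k
    by (simp add: mollifier_even[OF \<eta>])
  have c: "convolve \<eta> k x = (LINT y|lborel. \<eta> y * k (x - y))" for x
    using convolve_commute[of \<eta> k] by (simp add: convolve_def mult.commute)
  have pt: "ennreal \<bar>convolve \<eta> k (x + h) - convolve \<eta> k x\<bar>
      \<le> (\<integral>\<^sup>+z. ennreal (\<eta> z) * ennreal \<bar>k (x - z + h) - k (x - z)\<bar> \<partial>lborel)" for x
  proof -
    have "convolve \<eta> k (x + h) - convolve \<eta> k x = (LINT z|lborel. \<eta> z * (k (x + h - z) - k (x - z)))"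
      unfolding c using i by (simp add: right_diff_distrib)
    also have "ennreal \<bar>\<dots>\<bar> \<le> (\<integral>\<^sup>+z. norm (\<eta> z * (k (x + h - z) - k (x - z))) \<partial>lborel)"
      using integral_norm_bound_ennreal[of lborel "\<lambda>z. \<eta> z * (k (x + h - z) - k (x - z))"] i
      by (simp add: right_diff_distrib)
    also have "\<dots> = (\<integral>\<^sup>+z. ennreal (\<eta> z) * ennreal \<bar>k (x - z + h) - k (x - z)\<bar> \<partial>lborel)"
      using mollifier_nonneg[OF \<eta>] by (intro nn_integral_cong) (simp add: abs_mult ennreal_mult diff_add_eq)
    finally show ?thesis .
  qed
  have "shift_difference (convolve \<eta> k) h
      \<le> (\<integral>\<^sup>+x. (\<integral>\<^sup>+z. ennreal (\<eta> z) * ennreal \<bar>k (x - z + h) - k (x - z)\<bar> \<partial>lborel) \<partial>lborel)"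
    unfolding shift_difference_def by (intro nn_integral_mono pt)
  also have "\<dots> = (\<integral>\<^sup>+z. (\<integral>\<^sup>+x. ennreal (\<eta> z) * ennreal \<bar>k (x - z + h) - k (x - z)\<bar> \<partial>lborel) \<partial>lborel)"
    by (rule lborel_pair.Fubini') measurable
  also have "\<dots> = (\<integral>\<^sup>+z. ennreal (\<eta> z) * shift_difference k h \<partial>lborel)"
  proof (rule nn_integral_cong)
    fix z
    have "(\<integral>\<^sup>+x. ennreal \<bar>k (x - z + h) - k (x - z)\<bar> \<partial>lborel) = shift_difference k h"
      using nn_integral_lborel_shift[of "\<lambda>x. ennreal \<bar>k (x + h) - k x\<bar>" "- z"]
      unfolding shift_difference_def by (simp add: algebra_simps)
    then show "(\<integral>\<^sup>+x. ennreal (\<eta> z) * ennreal \<bar>k (x - z + h) - k (x - z)\<bar> \<partial>lborel) = ennreal (\<eta> z) * shift_difference k h"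
      by (simp add: nn_integral_cmult)
  qed
  also have "\<dots> = shift_difference k h" by (simp add: nn_integral_multc mollifier_nn_integral[OF \<eta>])
  finally show ?thesis .
qed

text \<open>
  Integrate the directional derivative along the segment from \<open>x\<close> to \<open>x + h\<close>, then over all
  \<open>x\<close>.
\<close>

lemma shift_difference_le_gradient:
  fixes w :: "'a::euclidean_space \<Rightarrow> real"
  assumes diff: "\<And>x. w differentiable at x" and cont: "continuous_on UNIV (gradient w)"
  shows "shift_difference w h \<le> (\<integral>\<^sup>+x. ennreal \<bar>h \<bullet> gradient w x\<bar> \<partial>lborel)"
proof -
  let ?g = "gradient w"
  have [measurable]: "?g \<in> borel_measurable borel" by (rule borel_measurable_continuous_onI[OF cont])
  have pt: "ennreal \<bar>w (x + h) - w x\<bar> \<le> (\<integral>\<^sup>+t. ennreal \<bar>h \<bullet> ?g (x + t *\<^sub>R h)\<bar> * indicator {0..1} t \<partial>lborel)" for x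
  proof -
    let ?F = "\<lambda>t. w (x + t *\<^sub>R h)" and ?f = "\<lambda>t. h \<bullet> ?g (x + t *\<^sub>R h)"
    have D: "DERIV ?F t :> ?f t" for t
    proof -
      have "(w has_derivative frechet_derivative w (at (x + t *\<^sub>R h))) (at (x + t *\<^sub>R h))"
        using diff by (simp add: frechet_derivative_works)
      moreover have "((\<lambda>t. x + t *\<^sub>R h) has_derivative (\<lambda>s. s *\<^sub>R h)) (at t)"
        by (auto intro!: derivative_eq_intros)
      ultimately have "(?F has_derivative (\<lambda>s. frechet_derivative w (at (x + t *\<^sub>R h)) (s *\<^sub>R h))) (at t)"
        by (rule has_derivative_compose[rotated])
      then show ?thesis
        by (simp add: frechet_derivative_eq_inner_gradient[OF diff] has_field_derivative_def inner_commute mult_commute_abs)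
    qed
    have C: "isCont ?f t" for t
    proof -
      have "continuous_on UNIV ?f"
        by (intro continuous_intros continuous_on_compose2[OF cont]) auto
      then show ?thesis by (simp add: continuous_on_eq_continuous_at)
    qed
    have int: "has_bochner_integral lborel (\<lambda>t. ?f t * indicator {0..1} t) (?F 1 - ?F 0)"
      by (rule has_bochner_integral_FTC_Icc_real) (use D C in auto)
    then have "ennreal \<bar>?F 1 - ?F 0\<bar> \<le> (\<integral>\<^sup>+t. norm (?f t * indicator {0..1} t) \<partial>lborel)"
      using integral_norm_bound_ennreal[of lborel "\<lambda>t. ?f t * indicator {0..1} t"]
      by (simp add: has_bochner_integral_iff)
    also have "\<dots> = (\<integral>\<^sup>+t. ennreal \<bar>?f t\<bar> * indicator {0..1} t \<partial>lborel)"
      by (intro nn_integral_cong) (auto simp: indicator_def)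
    finally show ?thesis by simp
  qed
  have "shift_difference w h \<le> (\<integral>\<^sup>+x. (\<integral>\<^sup>+t. ennreal \<bar>h \<bullet> ?g (x + t *\<^sub>R h)\<bar> * indicator {0..1} t \<partial>lborel) \<partial>lborel)"
    unfolding shift_difference_def by (intro nn_integral_mono pt)
  also have "\<dots> = (\<integral>\<^sup>+t. (\<integral>\<^sup>+x. ennreal \<bar>h \<bullet> ?g (x + t *\<^sub>R h)\<bar> * indicator {0..1::real} t \<partial>lborel) \<partial>lborel)"
    by (rule lborel_pair.Fubini') measurable
  also have "\<dots> = (\<integral>\<^sup>+t. (\<integral>\<^sup>+x. ennreal \<bar>h \<bullet> ?g x\<bar> \<partial>lborel) * indicator {0..1::real} t \<partial>lborel)"
  proof (rule nn_integral_cong)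
    fix t :: real
    show "(\<integral>\<^sup>+x. ennreal \<bar>h \<bullet> ?g (x + t *\<^sub>R h)\<bar> * indicator {0..1} t \<partial>lborel)
        = (\<integral>\<^sup>+x. ennreal \<bar>h \<bullet> ?g x\<bar> \<partial>lborel) * indicator {0..1} t"
      using nn_integral_lborel_shift[of "\<lambda>x. ennreal \<bar>h \<bullet> ?g x\<bar>" "t *\<^sub>R h"]
      by (simp add: nn_integral_multc add.commute)
  qed
  also have "\<dots> = (\<integral>\<^sup>+x. ennreal \<bar>h \<bullet> ?g x\<bar> \<partial>lborel)" by (simp add: nn_integral_cmult)
  finally show ?thesis .
qed

text \<open>
  For compact \<open>T\<close> inside an open set \<open>U\<close> of nearly the same measure, small translates of \<open>T\<close>
  stay in \<open>U\<close>; inner and outer regularity reduce the general case to this one.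
\<close>

lemma indicator_translation_continuous:
  fixes A :: "'a::euclidean_space set"
  assumes [measurable]: "A \<in> sets borel" and "bounded A" and "e > 0"
  obtains d where "d > 0" "\<And>z. norm z < d \<Longrightarrow> shift_difference (indicator A) z \<le> ennreal e"
proof -
  have e4: "e/4 > 0" using \<open>e > 0\<close> by simp
  obtain T where T: "closed T" "T \<subseteq> A" "emeasure lebesgue (A - T) < ennreal (e/4)"
    using sets_lebesgue_inner_closed[OF _ e4, of A] by (metis assms(1) sets_completionI_sets sets_lborel)
  then have [measurable]: "T \<in> sets borel" by simp
  have "compact T" using T \<open>bounded A\<close> bounded_subset by (auto simp: compact_eq_bounded_closed)
  obtain U where U: "open U" "T \<subseteq> U" "emeasure lebesgue (U - T) < ennreal (e/4)"
    using sets_lebesgue_outer_open[OF _ e4, of T] by (metis \<open>T \<in> sets borel\<close> sets_completionI_sets sets_lborel)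
  then have [measurable]: "U \<in> sets borel" by simp
  obtain d where d: "d > 0" "(\<Union>x\<in>T. ball x d) \<subseteq> U"
    using compact_subset_open_imp_ball_epsilon_subset[OF \<open>compact T\<close> U(1,2)] by blast
  have AT: "emeasure lborel (A - T) \<le> ennreal (e/4)" and UT: "emeasure lborel (U - T) \<le> ennreal (e/4)"
    using T(3) U(3) by (simp_all add: less_imp_le)
  have Tfin: "emeasure lborel T < top" using \<open>compact T\<close> emeasure_compact_finite by simp
  show ?thesis
  proof (rule that[OF d(1)])
    fix z :: 'a assume z: "norm z < d"
    have TU: "indicator T (x + z) \<le> (indicator U x :: real)" for x
    proof (cases "x + z \<in> T")
      case True
      then have "x \<in> U" using d(2) z by (force simp: dist_norm)
      then show ?thesis by (simp add: indicator_def)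
    qed simp
    have shift: "(\<integral>\<^sup>+x. f (x + z) \<partial>lborel) = (\<integral>\<^sup>+x. f x \<partial>lborel)"
      if [measurable]: "f \<in> borel_measurable borel" for f :: "'a \<Rightarrow> ennreal"
      using nn_integral_lborel_shift[of f z] by (simp add: add.commute)
    have TUT: "(\<integral>\<^sup>+x. ennreal (indicator U x - indicator T (x + z)) \<partial>lborel) = emeasure lborel (U - T)"
    proof -
      have "(\<integral>\<^sup>+x. ennreal (indicator U x - indicator T (x + z)) \<partial>lborel) + emeasure lborel T
        = (\<integral>\<^sup>+x. ennreal (indicator U x - indicator T (x + z)) + indicator T (x + z) \<partial>lborel)"
        using shift[of "indicator T"] by (subst nn_integral_add) auto
      also have "\<dots> = (\<integral>\<^sup>+x. indicator U x \<partial>lborel)"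
        using TU by (intro nn_integral_cong) (force simp: indicator_def split: if_splits)
      also have "\<dots> = emeasure lborel (U - T) + emeasure lborel T"
      proof -
        have "emeasure lborel (U - T) + emeasure lborel T = emeasure lborel ((U - T) \<union> T)"
          by (rule plus_emeasure) auto
        also have "(U - T) \<union> T = U" using U(2) by auto
        finally show ?thesis by simp
      qed
      finally have "emeasure lborel T + (\<integral>\<^sup>+x. ennreal (indicator U x - indicator T (x + z)) \<partial>lborel)
        = emeasure lborel T + emeasure lborel (U - T)" by (simp only: add.commute)
      moreover have "emeasure lborel T \<noteq> \<infinity>" using Tfin by simp
      ultimately show ?thesis unfolding ennreal_add_left_cancel by blast
    qed
    have le: "ennreal \<bar>indicator A (x + z) - indicator A x\<bar>
      \<le> indicator (A - T) (x + z) + ennreal (indicator U x - indicator T (x + z)) + indicator (U - T) x + indicator (A - T) x" for x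
      using subsetD[OF T(2), of x] subsetD[OF T(2), of "x + z"] subsetD[OF U(2), of x] TU[of x]
      by (cases "x \<in> A"; cases "x + z \<in> A"; cases "x + z \<in> T"; cases "x \<in> T"; cases "x \<in> U"; simp add: indicator_def)
    have "shift_difference (indicator A) z
      \<le> (\<integral>\<^sup>+x. indicator (A - T) (x + z) + ennreal (indicator U x - indicator T (x + z)) + indicator (U - T) x + indicator (A - T) x \<partial>lborel)"
      unfolding shift_difference_def by (intro nn_integral_mono le)
    also have "\<dots> = emeasure lborel (A - T) + emeasure lborel (U - T) + emeasure lborel (U - T) + emeasure lborel (A - T)"
      using shift[of "indicator (A - T)"] by (simp add: nn_integral_add TUT)
    also have "\<dots> \<le> ennreal (e/4) + ennreal (e/4) + ennreal (e/4) + ennreal (e/4)"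
      by (intro add_mono AT UT)
    also have "\<dots> = ennreal e" using \<open>e > 0\<close> by (simp add: ennreal_plus[symmetric] del: ennreal_plus)
    finally show "shift_difference (indicator A) z \<le> ennreal e" .
  qed
qed

text \<open>
  \<open>w(x) - 1\<^sub>E(x)\<close> is an average of \<open>1\<^sub>E(x - z) - 1\<^sub>E(x)\<close> over small \<open>z\<close>. As \<open>E\<close> may have
  infinite measure, closeness holds only on balls.
\<close>

lemma mollified_indicator_close:
  fixes E :: "'a::euclidean_space set"
  assumes [measurable]: "E \<in> sets borel" and "e > 0"
  obtains d where "d > 0" "\<And>\<delta> \<eta>. mollifier \<delta> \<eta> \<Longrightarrow> \<delta> < d \<Longrightarrow>
    (\<integral>\<^sup>+x. ennreal \<bar>convolve \<eta> (indicator E) x - indicator E x\<bar> * indicator (cball 0 R) x \<partial>lborel) \<le> ennreal e"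
proof -
  have [measurable]: "cball (0::'a) r \<in> sets borel" for r by simp
  let ?A = "E \<inter> cball 0 (R + 1)"
  obtain d where d: "d > 0" "\<And>z. norm z < d \<Longrightarrow> shift_difference (indicator ?A) z \<le> ennreal e"
    using indicator_translation_continuous[of ?A e] \<open>e > 0\<close> by (auto intro: bounded_Int)
  show ?thesis
  proof (rule that[of "min d 1"])
    show "min d 1 > 0" using d by simp
    fix \<delta> and \<eta> :: "'a \<Rightarrow> real" assume \<eta>: "mollifier \<delta> \<eta>" and \<delta>: "\<delta> < min d 1"
    note [measurable] = mollifier_measurable[OF \<eta>]
    let ?u = "indicator E :: 'a \<Rightarrow> real"
    have i: "integrable lborel (\<lambda>z. \<eta> z * ?u (x - z))" for x
      using convolve_integrable[OF mollifier_continuous[OF \<eta>] mollifier_bounded_support[OF \<eta>], of "\<lambda>y. ?u (x - y)" 1 0]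
      by (simp add: mollifier_even[OF \<eta>] indicator_def)
    have i1: "integrable lborel (\<lambda>z. \<eta> z * c)" for c using mollifier_integrable[OF \<eta>] by simp
    have c: "convolve \<eta> ?u x = (LINT y|lborel. \<eta> y * ?u (x - y))" for x
      using convolve_commute[of \<eta> ?u] by (simp add: convolve_def mult.commute)
    have pt: "ennreal \<bar>convolve \<eta> ?u x - ?u x\<bar>
        \<le> (\<integral>\<^sup>+z. ennreal (\<eta> z) * ennreal \<bar>?u (x - z) - ?u x\<bar> \<partial>lborel)" for x
    proof -
      have "convolve \<eta> ?u x - ?u x = (LINT z|lborel. \<eta> z * (?u (x - z) - ?u x))"
        unfolding c using i i1 mollifier_integral[OF \<eta>] by (simp add: right_diff_distrib)
      also have "ennreal \<bar>\<dots>\<bar> \<le> (\<integral>\<^sup>+z. norm (\<eta> z * (?u (x - z) - ?u x)) \<partial>lborel)"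
        using integral_norm_bound_ennreal[of lborel "\<lambda>z. \<eta> z * (?u (x - z) - ?u x)"] i i1
        by (simp add: right_diff_distrib)
      also have "\<dots> = (\<integral>\<^sup>+z. ennreal (\<eta> z) * ennreal \<bar>?u (x - z) - ?u x\<bar> \<partial>lborel)"
        using mollifier_nonneg[OF \<eta>] by (intro nn_integral_cong) (simp add: abs_mult ennreal_mult)
      finally show ?thesis .
    qed
    have "(\<integral>\<^sup>+x. ennreal \<bar>convolve \<eta> ?u x - ?u x\<bar> * indicator (cball 0 R) x \<partial>lborel)
        \<le> (\<integral>\<^sup>+x. (\<integral>\<^sup>+z. ennreal (\<eta> z) * ennreal \<bar>?u (x - z) - ?u x\<bar> \<partial>lborel) * indicator (cball 0 R) x \<partial>lborel)"
      by (intro nn_integral_mono mult_right_mono pt) simp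
    also have "\<dots> = (\<integral>\<^sup>+x. (\<integral>\<^sup>+z. ennreal (\<eta> z) * ennreal \<bar>?u (x - z) - ?u x\<bar> * indicator (cball 0 R) x \<partial>lborel) \<partial>lborel)"
      by (intro nn_integral_cong nn_integral_multc[symmetric]) measurable
    also have "\<dots> = (\<integral>\<^sup>+z. (\<integral>\<^sup>+x. ennreal (\<eta> z) * ennreal \<bar>?u (x - z) - ?u x\<bar> * indicator (cball 0 R) x \<partial>lborel) \<partial>lborel)"
      by (rule lborel_pair.Fubini') measurable
    also have "\<dots> \<le> (\<integral>\<^sup>+z. ennreal (\<eta> z) * ennreal e \<partial>lborel)"
    proof (rule nn_integral_mono)
      fix z
      show "(\<integral>\<^sup>+x. ennreal (\<eta> z) * ennreal \<bar>?u (x - z) - ?u x\<bar> * indicator (cball 0 R) x \<partial>lborel) \<le> ennreal (\<eta> z) * ennreal e"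
      proof (cases "norm z > \<delta>")
        case True then show ?thesis using mollifier_support[OF \<eta>] by simp
      next
        case False
        then have z: "norm z < d" "norm z < 1" using \<delta> by auto
        have "(\<integral>\<^sup>+x. ennreal (\<eta> z) * ennreal \<bar>?u (x - z) - ?u x\<bar> * indicator (cball 0 R) x \<partial>lborel)
            \<le> (\<integral>\<^sup>+x. ennreal (\<eta> z) * ennreal \<bar>indicator ?A (x + (- z)) - indicator ?A x\<bar> \<partial>lborel)"
        proof (rule nn_integral_mono)
          fix x
          have "norm (x - z) \<le> R + 1" if "norm x \<le> R" using norm_triangle_ineq4[of x z] z that by linarith
          then show "ennreal (\<eta> z) * ennreal \<bar>?u (x - z) - ?u x\<bar> * indicator (cball 0 R) x
              \<le> ennreal (\<eta> z) * ennreal \<bar>indicator ?A (x + (- z)) - indicator ?A x\<bar>"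
            by (cases "norm x \<le> R") (auto simp: indicator_def)
        qed
        also have "\<dots> = ennreal (\<eta> z) * shift_difference (indicator ?A) (- z)"
          unfolding shift_difference_def by (rule nn_integral_cmult) measurable
        also have "\<dots> \<le> ennreal (\<eta> z) * ennreal e" using d(2)[of "- z"] z by (intro mult_left_mono) auto
        finally show ?thesis .
      qed
    qed
    also have "\<dots> = ennreal e" by (simp add: nn_integral_multc mollifier_nn_integral[OF \<eta>])
    finally show "(\<integral>\<^sup>+x. ennreal \<bar>convolve \<eta> ?u x - ?u x\<bar> * indicator (cball 0 R) x \<partial>lborel) \<le> ennreal e" .
  qed
qed

lemma le_liminf_plus_const:
  fixes a :: "nat \<Rightarrow> ennreal"
  assumes "\<forall>\<^sub>F n in sequentially. x \<le> a n + ennreal c"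
  shows "x \<le> liminf a + ennreal c"
proof -
  have "\<forall>\<^sub>F n in sequentially. x - ennreal c \<le> a n"
    using assms by eventually_elim (simp add: ennreal_minus_le_iff add.commute)
  then have "x - ennreal c \<le> liminf a" by (rule Liminf_bounded)
  then show ?thesis by (simp add: ennreal_minus_le_iff add.commute)
qed

lemma convolve_indicator_measurable:
  assumes "mollifier \<delta> \<eta>" "E \<in> sets borel"
  shows "convolve \<eta> (indicator E) \<in> borel_measurable borel"
proof (rule borel_measurable_continuous_onI)
  have "k_times_cont_diff 0 (convolve \<eta> (indicator E))"
    by (rule convolve_mollifier_derivative(5)[OF assms(1), of _ 1]) (use assms in \<open>auto simp: indicator_def\<close>)
  then show "continuous_on UNIV (convolve \<eta> (indicator E))" by simp
qed

text \<open>
  Local convergence of the mollified functions in \<open>L\<^sup>1\<close> makes the integral over each ball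
  lower semicontinuous.
\<close>

lemma shift_difference_le_liminf:
  fixes E :: "'a::euclidean_space set"
  assumes [measurable]: "E \<in> sets borel" and \<eta>: "\<And>m. mollifier (1 / real (Suc m)) (\<eta> m)"
  shows "shift_difference (indicator E) h \<le> liminf (\<lambda>m. shift_difference (convolve (\<eta> m) (indicator E)) h)"
  unfolding shift_difference_def[of "indicator E"]
proof (rule nn_integral_le_of_balls)
  show "(\<lambda>x. ennreal \<bar>indicator E (x + h) - indicator E x\<bar>) \<in> borel_measurable borel" by measurable
  fix R
  let ?u = "indicator E :: 'a \<Rightarrow> real"
  have [measurable]: "cball (0::'a) r \<in> sets borel" for r by simp
  show "(\<integral>\<^sup>+x. ennreal \<bar>?u (x + h) - ?u x\<bar> * indicator (cball 0 R) x \<partial>lborel)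
      \<le> liminf (\<lambda>m. shift_difference (convolve (\<eta> m) ?u) h)"
  proof (rule ennreal_le_epsilon)
    fix e :: real assume "e > 0"
    then have "e/2 > 0" by simp
    let ?R = "R + norm h"
    obtain d where d: "d > 0" "\<And>\<delta> \<eta>. mollifier \<delta> \<eta> \<Longrightarrow> \<delta> < d \<Longrightarrow>
      (\<integral>\<^sup>+x. ennreal \<bar>convolve \<eta> ?u x - ?u x\<bar> * indicator (cball 0 ?R) x \<partial>lborel) \<le> ennreal (e/2)"
      using mollified_indicator_close[OF assms(1) \<open>e/2 > 0\<close>, of ?R] by metis
    have "(\<lambda>m. 1 / real (Suc m)) \<longlonglongrightarrow> 0" by (rule LIMSEQ_Suc[OF lim_1_over_n])
    then have "\<forall>\<^sub>F m in sequentially. 1 / real (Suc m) < d" using d(1) by (rule order_tendstoD)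
    then have "\<forall>\<^sub>F m in sequentially. (\<integral>\<^sup>+x. ennreal \<bar>?u (x + h) - ?u x\<bar> * indicator (cball 0 R) x \<partial>lborel)
        \<le> shift_difference (convolve (\<eta> m) ?u) h + ennreal e"
    proof eventually_elim
      fix m assume m: "1 / real (Suc m) < d"
      let ?w = "convolve (\<eta> m) ?u"
      have [measurable]: "?w \<in> borel_measurable borel"
        by (rule convolve_indicator_measurable[OF \<eta>]) simp
      let ?f = "\<lambda>x. ennreal \<bar>?w x - ?u x\<bar> * indicator (cball 0 ?R) x"
      have le: "ennreal \<bar>?u (x + h) - ?u x\<bar> * indicator (cball 0 R) x
          \<le> ennreal \<bar>?w (x + h) - ?w x\<bar> + ?f (h + x) + ?f x" for x
      proof (cases "norm x \<le> R")
        case True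
        then have "norm (h + x) \<le> ?R" "norm x \<le> ?R" using norm_triangle_ineq[of h x] norm_ge_zero[of h] by linarith+
        moreover have "ennreal \<bar>?u (x + h) - ?u x\<bar> \<le> ennreal (\<bar>?w (x + h) - ?w x\<bar> + \<bar>?w (h + x) - ?u (h + x)\<bar> + \<bar>?w x - ?u x\<bar>)"
          by (intro ennreal_leI) (simp add: add.commute)
        ultimately show ?thesis using True by (simp add: ennreal_plus)
      qed simp
      have "(\<integral>\<^sup>+x. ennreal \<bar>?u (x + h) - ?u x\<bar> * indicator (cball 0 R) x \<partial>lborel)
          \<le> (\<integral>\<^sup>+x. ennreal \<bar>?w (x + h) - ?w x\<bar> + ?f (h + x) + ?f x \<partial>lborel)"
        by (intro nn_integral_mono le)
      also have "\<dots> = shift_difference ?w h + (\<integral>\<^sup>+x. ?f (h + x) \<partial>lborel) + (\<integral>\<^sup>+x. ?f x \<partial>lborel)"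
        unfolding shift_difference_def by (simp add: nn_integral_add)
      also have "(\<integral>\<^sup>+x. ?f (h + x) \<partial>lborel) = (\<integral>\<^sup>+x. ?f x \<partial>lborel)"
        by (rule nn_integral_lborel_shift) measurable
      also have "shift_difference ?w h + (\<integral>\<^sup>+x. ?f x \<partial>lborel) + (\<integral>\<^sup>+x. ?f x \<partial>lborel)
          \<le> shift_difference ?w h + ennreal (e/2) + ennreal (e/2)"
        by (intro add_mono d(2)[OF \<eta> m] order_refl)
      also have "\<dots> = shift_difference ?w h + ennreal e"
        using \<open>e > 0\<close> by (simp add: add.assoc ennreal_plus[symmetric] del: ennreal_plus)
      finally show "(\<integral>\<^sup>+x. ennreal \<bar>?u (x + h) - ?u x\<bar> * indicator (cball 0 R) x \<partial>lborel)
        \<le> shift_difference ?w h + ennreal e" .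
    qed
    then show "(\<integral>\<^sup>+x. ennreal \<bar>?u (x + h) - ?u x\<bar> * indicator (cball 0 R) x \<partial>lborel)
      \<le> liminf (\<lambda>m. shift_difference (convolve (\<eta> m) ?u) h) + ennreal e"
      by (rule le_liminf_plus_const)
  qed
qed

lemma mult_liminf_le:
  fixes a :: "nat \<Rightarrow> ennreal" shows "c * liminf a \<le> liminf (\<lambda>n. c * a n)"
  unfolding liminf_SUP_INF SUP_mult_left_ennreal
  by (intro SUP_mono bexI[where x = "_ :: nat"] INF_greatest mult_left_mono INF_lower) auto

section \<open>Comparison of the nonlocal energy with the perimeter\<close>

text \<open>
  The properties of \<open>\<rho>\<close> that pass to a Borel representative. The identity for the directional
  means takes the place of radial symmetry, and \<open>r\<close> is the radius \<open>\<epsilon>\<close> of the support.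
\<close>

definition borel_kernel :: "('a::euclidean_space \<Rightarrow> ennreal) \<Rightarrow> real \<Rightarrow> real \<Rightarrow> bool" where
  "borel_kernel \<rho> r K \<longleftrightarrow> \<rho> \<in> borel_measurable borel \<and> (\<integral>\<^sup>+h. \<rho> h \<partial>lborel) = 1 \<and>
     (AE h in lborel. norm h > r \<longrightarrow> \<rho> h = 0) \<and> 0 < K \<and>
     (\<forall>v. (\<integral>\<^sup>+h. ennreal (\<bar>h \<bullet> v\<bar> / norm h) * \<rho> h \<partial>lborel) = ennreal (K * norm v))"

lemma borel_kernelD:
  assumes "borel_kernel \<rho> r K"
  shows "\<rho> \<in> borel_measurable borel" "(\<integral>\<^sup>+h. \<rho> h \<partial>lborel) = 1"
    "AE h in lborel. norm h > r \<longrightarrow> \<rho> h = 0" "0 < K"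
    "(\<integral>\<^sup>+h. ennreal (\<bar>h \<bullet> v\<bar> / norm h) * \<rho> h \<partial>lborel) = ennreal (K * norm v)"
  using assms by (simp_all add: borel_kernel_def)

text \<open>
  The exact identity behind both inequalities: averaging the directional variation of a vector
  field with the kernel gives \<open>K\<close> times its total variation. The weight \<open>f\<close> is \<open>1\<close> or the
  indicator of a ball.
\<close>

lemma kernel_gradient_integral:
  fixes \<rho> :: "'a::euclidean_space \<Rightarrow> ennreal" and g :: "'a \<Rightarrow> 'a"
  assumes \<rho>: "borel_kernel \<rho> r K" and [measurable]: "f \<in> borel_measurable borel" "g \<in> borel_measurable borel"
  shows "(\<integral>\<^sup>+h. ennreal (1 / norm h) * \<rho> h * (\<integral>\<^sup>+x. ennreal \<bar>h \<bullet> g x\<bar> * f x \<partial>lborel) \<partial>lborel)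
       = ennreal K * (\<integral>\<^sup>+x. ennreal (norm (g x)) * f x \<partial>lborel)"
proof -
  note [measurable] = borel_kernelD(1)[OF \<rho>]
  have "(\<integral>\<^sup>+h. ennreal (1 / norm h) * \<rho> h * (\<integral>\<^sup>+x. ennreal \<bar>h \<bullet> g x\<bar> * f x \<partial>lborel) \<partial>lborel)
      = (\<integral>\<^sup>+h. (\<integral>\<^sup>+x. ennreal (1 / norm h) * \<rho> h * (ennreal \<bar>h \<bullet> g x\<bar> * f x) \<partial>lborel) \<partial>lborel)"
    by (intro nn_integral_cong nn_integral_cmult[symmetric]) measurable
  also have "\<dots> = (\<integral>\<^sup>+x. (\<integral>\<^sup>+h. ennreal (1 / norm h) * \<rho> h * (ennreal \<bar>h \<bullet> g x\<bar> * f x) \<partial>lborel) \<partial>lborel)"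
    by (rule lborel_pair.Fubini') measurable
  also have "\<dots> = (\<integral>\<^sup>+x. ennreal K * (ennreal (norm (g x)) * f x) \<partial>lborel)"
  proof (rule nn_integral_cong)
    fix x
    have "(\<integral>\<^sup>+h. ennreal (1 / norm h) * \<rho> h * (ennreal \<bar>h \<bullet> g x\<bar> * f x) \<partial>lborel)
        = (\<integral>\<^sup>+h. (ennreal (\<bar>h \<bullet> g x\<bar> / norm h) * \<rho> h) * f x \<partial>lborel)"
    proof (rule nn_integral_cong)
      fix h
      have "ennreal (\<bar>h \<bullet> g x\<bar> / norm h) = ennreal (1 / norm h) * ennreal \<bar>h \<bullet> g x\<bar>"
        by (simp add: ennreal_mult[symmetric])
      then show "ennreal (1 / norm h) * \<rho> h * (ennreal \<bar>h \<bullet> g x\<bar> * f x) = (ennreal (\<bar>h \<bullet> g x\<bar> / norm h) * \<rho> h) * f x"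
        by (simp add: ac_simps)
    qed
    also have "\<dots> = ennreal (K * norm (g x)) * f x" by (subst nn_integral_multc) (auto simp: borel_kernelD(5)[OF \<rho>])
    finally show "(\<integral>\<^sup>+h. ennreal (1 / norm h) * \<rho> h * (ennreal \<bar>h \<bullet> g x\<bar> * f x) \<partial>lborel) = ennreal K * (ennreal (norm (g x)) * f x)"
      using borel_kernelD(4)[OF \<rho>] by (simp add: ennreal_mult mult.assoc)
  qed
  also have "\<dots> = ennreal K * (\<integral>\<^sup>+x. ennreal (norm (g x)) * f x \<partial>lborel)"
    by (rule nn_integral_cmult) measurable
  finally show ?thesis .
qed

text \<open>
  The bound holds for the mollified indicators with the same constant, and Fatou's lemma lets
  the width of the bump tend to \<open>0\<close>.
\<close>

lemma nonlocal_energy_le_perimeter: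
  fixes \<rho> :: "'a::euclidean_space \<Rightarrow> ennreal"
  assumes \<rho>: "borel_kernel \<rho> r K" and [measurable]: "E \<in> sets borel"
  shows "nonlocal_energy \<rho> (indicator E) \<le> ennreal K * perimeter E"
proof -
  note [measurable] = borel_kernelD(1)[OF \<rho>]
  have "\<exists>\<eta>::'a \<Rightarrow> real. mollifier (1 / real (Suc m)) \<eta>" for m
    using mollifier_exists[of "1 / real (Suc m)"] unfolding mollifier_def by (metis of_nat_0_less_iff zero_less_Suc zero_less_divide_1_iff)
  then obtain \<eta> :: "nat \<Rightarrow> 'a \<Rightarrow> real" where \<eta>: "\<And>m. mollifier (1 / real (Suc m)) (\<eta> m)" by metis
  let ?w = "\<lambda>m. convolve (\<eta> m) (indicator E)"
  have [measurable]: "?w m \<in> borel_measurable borel" for m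
    by (rule convolve_indicator_measurable[OF \<eta>]) simp
  have ind: "\<bar>indicator E x :: real\<bar> \<le> 1" for x by (simp add: indicator_def)
  have each: "nonlocal_energy \<rho> (?w m) \<le> ennreal K * perimeter E" for m
  proof -
    have [measurable]: "gradient (?w m) \<in> borel_measurable borel" by (rule mollified_gradient_measurable[OF \<eta>]) simp
    have "nonlocal_energy \<rho> (?w m)
        \<le> (\<integral>\<^sup>+h. ennreal (1 / norm h) * \<rho> h * (\<integral>\<^sup>+x. ennreal \<bar>h \<bullet> gradient (?w m) x\<bar> * 1 \<partial>lborel) \<partial>lborel)"
      unfolding nonlocal_energy_def mult_1_right
      by (intro nn_integral_mono mult_left_mono shift_difference_le_gradient mollified_gradient_continuous[OF \<eta>]
            convolve_mollifier_derivative(2)[OF \<eta> ind]) auto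
    also have "\<dots> = ennreal K * (\<integral>\<^sup>+x. ennreal (norm (gradient (?w m) x)) * 1 \<partial>lborel)"
      by (rule kernel_gradient_integral[OF \<rho>]) measurable
    also have "\<dots> \<le> ennreal K * perimeter E"
      unfolding mult_1_right by (intro mult_left_mono mollified_gradient_le_perimeter[OF \<eta>]) auto
    finally show ?thesis .
  qed
  have "nonlocal_energy \<rho> (indicator E)
      \<le> (\<integral>\<^sup>+h. liminf (\<lambda>m. ennreal (1 / norm h) * \<rho> h * shift_difference (?w m) h) \<partial>lborel)"
    unfolding nonlocal_energy_def
    by (intro nn_integral_mono order_trans[OF mult_left_mono mult_liminf_le] shift_difference_le_liminf \<eta>) auto
  also have "\<dots> \<le> liminf (\<lambda>m. nonlocal_energy \<rho> (?w m))"
    unfolding nonlocal_energy_def by (rule nn_integral_liminf) measurable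
  also have "\<dots> \<le> liminf (\<lambda>m::nat. ennreal K * perimeter E)" by (intro Liminf_mono always_eventually allI each)
  also have "\<dots> = ennreal K * perimeter E" by (simp add: Liminf_const)
  finally show ?thesis .
qed

lemma cont_diff_bounded_support_lipschitz:
  fixes f :: "'a::euclidean_space \<Rightarrow> real"
  assumes f: "cont_diff_bounded_support f"
  obtains L where "L \<ge> 0" "\<And>x y. \<bar>f x - f y\<bar> \<le> L * norm (x - y)"
proof -
  note D = cont_diff_bounded_supportD[OF f]
  have "\<exists>B\<ge>0. \<forall>x. \<bar>frechet_derivative f (at x) b\<bar> \<le> B" for b
    using continuous_bounded_support_bounded[OF D(4,5)] by metis
  then obtain B where B: "\<And>b. B b \<ge> 0" "\<And>b x. \<bar>frechet_derivative f (at x) b\<bar> \<le> B b" by metis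
  let ?L = "\<Sum>b\<in>(Basis::'a set). B b"
  show ?thesis
  proof (rule that[of ?L])
    show "?L \<ge> 0" using B by (simp add: sum_nonneg)
    fix x y :: 'a
    have "norm (f x - f y) \<le> ?L * norm (x - y)"
    proof (rule differentiable_bound[of UNIV f "\<lambda>x. frechet_derivative f (at x)"])
      show "(f has_derivative frechet_derivative f (at x)) (at x within UNIV)" for x by (simp add: D)
      fix x
      have "onorm (frechet_derivative f (at x)) \<le> (\<Sum>b\<in>Basis. norm (frechet_derivative f (at x) b))"
        by (rule onorm_componentwise[OF has_derivative_bounded_linear[OF D(3)]])
      also have "\<dots> \<le> ?L" using B(2) by (intro sum_mono) simp
      finally show "onorm (frechet_derivative f (at x)) \<le> ?L" .
    qed auto
    then show "\<bar>f x - f y\<bar> \<le> ?L * norm (x - y)" by simp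
  qed
qed

text \<open>
  The difference of the two mollified indicators is the convolution of a Lipschitz function
  with a function carried by the symmetric difference.
\<close>

lemma mollified_difference_lipschitz:
  fixes A B :: "'a::euclidean_space set"
  assumes \<eta>: "mollifier \<delta> \<eta>" and [measurable]: "A \<in> sets borel" "B \<in> sets borel"
    and lip: "\<And>x y. \<bar>\<eta> x - \<eta> y\<bar> \<le> L * norm (x - y)" and L: "L \<ge> 0"
  shows "ennreal \<bar>(convolve \<eta> (indicator A) (x + h) - convolve \<eta> (indicator A) x)
      - (convolve \<eta> (indicator B) (x + h) - convolve \<eta> (indicator B) x)\<bar>
    \<le> ennreal (L * norm h) * emeasure lborel (sym_diff A B)"
proof -
  note [measurable] = mollifier_measurable[OF \<eta>]
  have i: "integrable lborel (\<lambda>y. \<eta> (x - y) * indicator A y)" if "A \<in> sets borel" for A x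
    by (rule convolve_integrable[OF mollifier_continuous[OF \<eta>] mollifier_bounded_support[OF \<eta>], of _ 1])
       (use that in \<open>auto simp: indicator_def\<close>)
  let ?g = "\<lambda>y. (\<eta> (x + h - y) - \<eta> (x - y)) * (indicator A y - indicator B y)"
  have ig: "integrable lborel ?g"
    using i[of A] i[of B] by (simp add: left_diff_distrib right_diff_distrib)
  have "(convolve \<eta> (indicator A) (x + h) - convolve \<eta> (indicator A) x)
      - (convolve \<eta> (indicator B) (x + h) - convolve \<eta> (indicator B) x) = (LINT y|lborel. ?g y)"
    unfolding convolve_def using i[of A] i[of B] by (simp add: left_diff_distrib right_diff_distrib)
  also have "ennreal \<bar>\<dots>\<bar> \<le> (\<integral>\<^sup>+y. norm (?g y) \<partial>lborel)"
    using integral_norm_bound_ennreal[OF ig] by simp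
  also have "\<dots> \<le> (\<integral>\<^sup>+y. ennreal (L * norm h) * indicator (sym_diff A B) y \<partial>lborel)"
  proof (rule nn_integral_mono)
    fix y
    have "\<bar>\<eta> (x + h - y) - \<eta> (x - y)\<bar> \<le> L * norm h" using lip[of "x + h - y" "x - y"] by simp
    then show "ennreal (norm (?g y)) \<le> ennreal (L * norm h) * indicator (sym_diff A B) y"
      by (auto simp: indicator_def abs_mult intro: ennreal_leI)
  qed
  also have "\<dots> = ennreal (L * norm h) * emeasure lborel (sym_diff A B)" by (simp add: nn_integral_cmult)
  finally show ?thesis .
qed

text \<open>
  For \<open>\<bar>h\<bar> < d\<close> the increment of \<open>w\<close> is \<open>h \<bullet> \<nabla>w\<close> up to \<open>e \<bar>h\<bar>\<close>, and replacing \<open>E\<close> by \<open>A\<close> costs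
  at most \<open>L \<bar>h\<bar>\<close> times the measure of the symmetric difference. The constants \<open>d\<close> and \<open>L\<close>
  depend on \<open>E\<close>, the bump and \<open>e\<close> only, so the estimate is uniform over all kernels with
  support radius below \<open>d\<close> and all competitors \<open>A\<close>. The error term vanishes as \<open>A\<close> tends to
  \<open>E\<close> in measure and then \<open>e\<close> to \<open>0\<close>.
\<close>

lemma nonlocal_energy_lower_bound:
  fixes E :: "'a::euclidean_space set"
  assumes \<eta>: "mollifier \<delta> \<eta>" and E [measurable]: "E \<in> sets borel" and e: "e > 0"
  obtains d L where "d > 0" "\<And>\<rho> A r K. borel_kernel \<rho> r K \<Longrightarrow> r < d \<Longrightarrow> A \<in> sets borel \<Longrightarrow>
      ennreal K * (\<integral>\<^sup>+x. ennreal (norm (gradient (convolve \<eta> (indicator E)) x)) * indicator (cball 0 R) x \<partial>lborel)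
      \<le> nonlocal_energy \<rho> (indicator A) +
         (ennreal e + ennreal L * emeasure lborel (sym_diff A E)) * emeasure lborel (cball (0::'a) R)"
proof -
  have [measurable]: "cball (0::'a) R \<in> sets borel" by simp
  let ?w = "convolve \<eta> (indicator E)"
  have ind: "\<bar>indicator A x :: real\<bar> \<le> 1" for A :: "'a set" and x by (simp add: indicator_def)
  note indE = ind[of E]
  obtain L where L: "L \<ge> 0" "\<And>x y. \<bar>\<eta> x - \<eta> y\<bar> \<le> L * norm (x - y)"
    using cont_diff_bounded_support_lipschitz[OF mollifier_cont_diff[OF \<eta>]] by metis
  obtain d where d: "d > 0" "\<And>x h. norm h < d \<Longrightarrow>
      \<bar>?w (x + h) - ?w x - convolve (\<lambda>x. frechet_derivative \<eta> (at x) h) (indicator E) x\<bar> \<le> e * norm h"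
    using convolve_uniform_expansion[where f = \<eta> and k = "indicator E" and M = 1 and e = e,
        OF mollifier_cont_diff[OF \<eta>] borel_measurable_indicator[OF E] indE e] by blast
  have grad: "convolve (\<lambda>x. frechet_derivative \<eta> (at x) h) (indicator E) x = h \<bullet> gradient ?w x" for x h
  proof -
    have m: "indicator E \<in> borel_measurable borel" by simp
    show ?thesis
      using convolve_mollifier_derivative(3)[OF \<eta> indE m, of x]
        frechet_derivative_eq_inner_gradient[OF convolve_mollifier_derivative(2)[OF \<eta> indE m], of x h]
      by (simp add: inner_commute)
  qed
  have gm: "gradient ?w \<in> borel_measurable borel" by (rule mollified_gradient_measurable[OF \<eta> E])
  show ?thesis
  proof (rule that[OF d(1), of L])
    fix \<rho> :: "'a \<Rightarrow> ennreal" and A :: "'a set" and r K :: real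
    assume \<rho>: "borel_kernel \<rho> r K" and "r < d" and [measurable]: "A \<in> sets borel"
    note [measurable] = gm borel_kernelD(1)[OF \<rho>]
    let ?v = "convolve \<eta> (indicator A)"
    have [measurable]: "?v \<in> borel_measurable borel" by (rule convolve_indicator_measurable[OF \<eta>]) simp
    let ?m = "emeasure lborel (sym_diff A E)" and ?V = "emeasure lborel (cball (0::'a) R)"
    let ?c = "ennreal e + ennreal L * ?m"
    have pt: "ennreal \<bar>h \<bullet> gradient ?w x\<bar> \<le> ennreal \<bar>?v (x + h) - ?v x\<bar> + ?c * ennreal (norm h)" if "norm h < d" for x h
    proof -
      let ?a = "?v (x + h) - ?v x" and ?b = "(?v (x + h) - ?v x) - (?w (x + h) - ?w x)"
      have "\<bar>h \<bullet> gradient ?w x\<bar> \<le> \<bar>?a\<bar> + \<bar>?b\<bar> + e * norm h"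
        using d(2)[OF that, of x] unfolding grad by linarith
      then have "ennreal \<bar>h \<bullet> gradient ?w x\<bar> \<le> ennreal (\<bar>?a\<bar> + \<bar>?b\<bar> + e * norm h)" by (rule ennreal_leI)
      also have "\<dots> = ennreal \<bar>?a\<bar> + ennreal \<bar>?b\<bar> + ennreal (e * norm h)" using e by (simp add: ennreal_plus)
      also have "\<dots> \<le> ennreal \<bar>?a\<bar> + ennreal (L * norm h) * ?m + ennreal (e * norm h)"
        by (intro add_mono order_refl mollified_difference_lipschitz[OF \<eta> _ _ L(2,1)]) measurable
      also have "\<dots> = ennreal \<bar>?a\<bar> + ?c * ennreal (norm h)"
        using e L(1) by (simp add: ennreal_mult distrib_left distrib_right ac_simps)
      finally show ?thesis .
    qed
    have inner: "(\<integral>\<^sup>+x. ennreal \<bar>h \<bullet> gradient ?w x\<bar> * indicator (cball 0 R) x \<partial>lborel)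
        \<le> shift_difference (indicator A) h + ?c * ennreal (norm h) * ?V" if "norm h < d" for h
    proof -
      have "(\<integral>\<^sup>+x. ennreal \<bar>h \<bullet> gradient ?w x\<bar> * indicator (cball 0 R) x \<partial>lborel)
          \<le> (\<integral>\<^sup>+x. ennreal \<bar>?v (x + h) - ?v x\<bar> + ?c * ennreal (norm h) * indicator (cball 0 R) x \<partial>lborel)"
        using pt[OF that] by (intro nn_integral_mono) (auto simp: indicator_def)
      also have "\<dots> = shift_difference ?v h + ?c * ennreal (norm h) * ?V"
        unfolding shift_difference_def by (simp add: nn_integral_add nn_integral_cmult)
      also have "\<dots> \<le> shift_difference (indicator A) h + ?c * ennreal (norm h) * ?V"
        by (intro add_mono order_refl shift_difference_convolve_le[OF \<eta> ind]) measurable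
      finally show ?thesis .
    qed
    have "ennreal K * (\<integral>\<^sup>+x. ennreal (norm (gradient ?w x)) * indicator (cball 0 R) x \<partial>lborel)
        = (\<integral>\<^sup>+h. ennreal (1 / norm h) * \<rho> h * (\<integral>\<^sup>+x. ennreal \<bar>h \<bullet> gradient ?w x\<bar> * indicator (cball 0 R) x \<partial>lborel) \<partial>lborel)"
      by (rule kernel_gradient_integral[OF \<rho>, symmetric]) measurable
    also have "\<dots> \<le> (\<integral>\<^sup>+h. ennreal (1 / norm h) * \<rho> h * shift_difference (indicator A) h + (?c * ?V) * \<rho> h \<partial>lborel)"
    proof (rule nn_integral_mono_AE, use borel_kernelD(3)[OF \<rho>] AE_lborel_nonzero in eventually_elim)
      fix h :: 'a assume supp: "norm h > r \<longrightarrow> \<rho> h = 0" and "h \<noteq> 0"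
      show "ennreal (1 / norm h) * \<rho> h * (\<integral>\<^sup>+x. ennreal \<bar>h \<bullet> gradient ?w x\<bar> * indicator (cball 0 R) x \<partial>lborel)
          \<le> ennreal (1 / norm h) * \<rho> h * shift_difference (indicator A) h + (?c * ?V) * \<rho> h"
      proof (cases "norm h < d")
        case True
        have "ennreal (1 / norm h) * \<rho> h * (\<integral>\<^sup>+x. ennreal \<bar>h \<bullet> gradient ?w x\<bar> * indicator (cball 0 R) x \<partial>lborel)
          \<le> ennreal (1 / norm h) * \<rho> h * (shift_difference (indicator A) h + ?c * ennreal (norm h) * ?V)"
          by (intro mult_left_mono inner[OF True]) simp
        also have "\<dots> = ennreal (1 / norm h) * \<rho> h * shift_difference (indicator A) h
            + (ennreal (1 / norm h) * ennreal (norm h)) * ((?c * ?V) * \<rho> h)"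
          by (simp only: distrib_left ac_simps)
        also have "ennreal (1 / norm h) * ennreal (norm h) = 1" using \<open>h \<noteq> 0\<close> by (simp add: ennreal_mult[symmetric])
        finally show ?thesis by simp
      qed (use supp \<open>r < d\<close> in simp)
    qed
    also have "\<dots> = nonlocal_energy \<rho> (indicator A) + (?c * ?V) * (\<integral>\<^sup>+h. \<rho> h \<partial>lborel)"
      unfolding nonlocal_energy_def by (simp add: nn_integral_add nn_integral_cmult)
    finally show "ennreal K * (\<integral>\<^sup>+x. ennreal (norm (gradient ?w x)) * indicator (cball 0 R) x \<partial>lborel)
      \<le> nonlocal_energy \<rho> (indicator A) + ?c * ?V" using borel_kernelD(2)[OF \<rho>] by simp
  qed
qed

text \<open>
  Fix a test field first, then a bump and a ball that almost attain its value; only then let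
  \<open>n\<close> tend to infinity.
\<close>

lemma perimeter_le_liminf_nonlocal_energy:
  fixes E :: "'a::euclidean_space set" and \<rho> :: "nat \<Rightarrow> 'a \<Rightarrow> ennreal"
  assumes E: "E \<in> sets borel" and A: "\<And>n. A n \<in> sets borel"
    and \<rho>: "\<And>n. borel_kernel (\<rho> n) (\<epsilon> n) K" and eps: "\<epsilon> \<longlonglongrightarrow> 0"
    and conv: "(\<lambda>n. emeasure lborel (sym_diff (A n) E)) \<longlonglongrightarrow> 0"
  shows "ennreal K * perimeter E \<le> liminf (\<lambda>n. nonlocal_energy (\<rho> n) (indicator (A n)))"
  unfolding perimeter_def SUP_mult_left_ennreal
proof (rule SUP_least, rule ennreal_le_epsilon)
  fix p :: "'a \<Rightarrow> 'a" and e :: real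
  assume "p \<in> {p \<in> test_fields. \<forall>x. norm (p x) \<le> 1}" and "e > 0"
  then have p: "p \<in> test_fields" "\<And>x. norm (p x) \<le> 1" by auto
  have K: "K \<ge> 0" using borel_kernelD(4)[OF \<rho>[of 0]] by simp
  define \<tau> where "\<tau> = e / (2 * (K + 1))"
  have \<tau>: "\<tau> > 0" "K * \<tau> \<le> e / 2" using \<open>e > 0\<close> K by (auto simp: \<tau>_def field_simps)
  obtain \<delta> R where \<delta>: "\<delta> > 0" "\<And>\<eta>. mollifier \<delta> \<eta> \<Longrightarrow> (LINT x:E|lebesgue. divergence p x) \<le>
      (LINT x|lborel. norm (gradient (convolve \<eta> (indicator E)) x) * indicator (cball 0 R) x) + \<tau>"
    using test_field_divergence_le_mollified_gradient[OF p E \<tau>(1)] by blast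
  obtain \<eta> :: "'a \<Rightarrow> real" where \<eta>: "mollifier \<delta> \<eta>"
    using mollifier_exists[OF \<delta>(1)] unfolding mollifier_def by metis
  define G where "G = (LINT x|lborel. norm (gradient (convolve \<eta> (indicator E)) x) * indicator (cball 0 R) x)"
  have G0: "G \<ge> 0" unfolding G_def by (intro integral_nonneg_AE) auto
  have G: "(\<integral>\<^sup>+x. ennreal (norm (gradient (convolve \<eta> (indicator E)) x)) * indicator (cball 0 R) x \<partial>lborel) = ennreal G"
  proof -
    have "(\<integral>\<^sup>+x. ennreal (norm (gradient (convolve \<eta> (indicator E)) x)) * indicator (cball 0 R) x \<partial>lborel)
      = (\<integral>\<^sup>+x. ennreal (norm (gradient (convolve \<eta> (indicator E)) x) * indicator (cball 0 R) x) \<partial>lborel)"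
      by (intro nn_integral_cong) (auto simp: indicator_def)
    then show ?thesis unfolding G_def
      using nn_integral_eq_integral[OF mollified_gradient_integrable_cball[OF \<eta> E, of R]] by simp
  qed
  define V where "V = measure lborel (cball (0::'a) R)"
  have V: "emeasure lborel (cball (0::'a) R) = ennreal V" "V \<ge> 0"
    using emeasure_lborel_cball_finite[of "0::'a" R] by (auto simp: V_def emeasure_eq_ennreal_measure)
  define e' where "e' = e / (4 * (V + 1))"
  have e': "e' > 0" "2 * e' * V \<le> e / 2" using \<open>e > 0\<close> V(2) by (auto simp: e'_def field_simps)
  obtain d L where d: "d > 0" and lower: "\<And>\<rho> A r K. borel_kernel \<rho> r K \<Longrightarrow> r < d \<Longrightarrow> A \<in> sets borel \<Longrightarrow>
      ennreal K * (\<integral>\<^sup>+x. ennreal (norm (gradient (convolve \<eta> (indicator E)) x)) * indicator (cball 0 R) x \<partial>lborel)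
      \<le> nonlocal_energy \<rho> (indicator A) +
         (ennreal e' + ennreal L * emeasure lborel (sym_diff A E)) * emeasure lborel (cball (0::'a) R)"
    using nonlocal_energy_lower_bound[OF \<eta> E e'(1), of R] by blast
  have "(\<lambda>n. ennreal L * emeasure lborel (sym_diff (A n) E)) \<longlonglongrightarrow> ennreal L * 0"
    by (intro ennreal_tendsto_cmult conv) simp
  then have "\<forall>\<^sub>F n in sequentially. ennreal L * emeasure lborel (sym_diff (A n) E) < ennreal e'"
    by (rule order_tendstoD) (use e' in simp)
  moreover have "\<forall>\<^sub>F n in sequentially. \<epsilon> n < d" by (rule order_tendstoD(2)[OF eps d])
  ultimately have "\<forall>\<^sub>F n in sequentially. ennreal (K * G) \<le> nonlocal_energy (\<rho> n) (indicator (A n)) + ennreal (e / 2)"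
  proof eventually_elim
    fix n assume small: "ennreal L * emeasure lborel (sym_diff (A n) E) < ennreal e'" and n: "\<epsilon> n < d"
    have "ennreal K * ennreal G \<le> nonlocal_energy (\<rho> n) (indicator (A n)) +
         (ennreal e' + ennreal L * emeasure lborel (sym_diff (A n) E)) * ennreal V"
      using lower[OF \<rho> n A] unfolding G V(1) .
    also have "\<dots> \<le> nonlocal_energy (\<rho> n) (indicator (A n)) + (ennreal e' + ennreal e') * ennreal V"
      using small by (intro add_mono mult_right_mono order_refl) auto
    also have "(ennreal e' + ennreal e') * ennreal V = ennreal (2 * e' * V)"
      using e' V by (simp add: ennreal_plus[symmetric] ennreal_mult[symmetric] del: ennreal_plus)
    also have "\<dots> \<le> ennreal (e / 2)" using e'(2) by (rule ennreal_leI)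
    finally show "ennreal (K * G) \<le> nonlocal_energy (\<rho> n) (indicator (A n)) + ennreal (e / 2)"
      using K G0 by (simp add: ennreal_mult add_left_mono)
  qed
  then have KG: "ennreal (K * G) \<le> liminf (\<lambda>n. nonlocal_energy (\<rho> n) (indicator (A n))) + ennreal (e / 2)"
    by (rule le_liminf_plus_const)
  have "ennreal K * ennreal (LINT x:E|lebesgue. divergence p x) \<le> ennreal K * ennreal (G + \<tau>)"
    using \<delta>(2)[OF \<eta>] unfolding G_def by (intro mult_left_mono ennreal_leI) auto
  also have "\<dots> = ennreal (K * G) + ennreal (K * \<tau>)"
    using K G0 \<tau> by (simp add: ennreal_plus ennreal_mult distrib_left)
  also have "\<dots> \<le> (liminf (\<lambda>n. nonlocal_energy (\<rho> n) (indicator (A n))) + ennreal (e / 2)) + ennreal (e / 2)"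
    by (intro add_mono KG ennreal_leI \<tau>)
  also have "\<dots> = liminf (\<lambda>n. nonlocal_energy (\<rho> n) (indicator (A n))) + ennreal e"
    using \<open>e > 0\<close> by (simp add: add.assoc ennreal_plus[symmetric] del: ennreal_plus)
  finally show "ennreal K * ennreal (LINT x:E|lebesgue. divergence p x)
      \<le> liminf (\<lambda>n. nonlocal_energy (\<rho> n) (indicator (A n))) + ennreal e" .
qed

section \<open>Sets with negligible nonlocal energy\<close>

lemma shift_difference_Un_le:
  fixes A B :: "'a::euclidean_space set"
  assumes [measurable]: "A \<in> sets borel" "B \<in> sets borel"
  shows "shift_difference (indicator (A \<union> B)) h \<le> shift_difference (indicator A) h + shift_difference (indicator B) h"
proof -
  have "shift_difference (indicator (A \<union> B)) h
      \<le> (\<integral>\<^sup>+x. ennreal \<bar>indicator A (x + h) - indicator A x\<bar> + ennreal \<bar>indicator B (x + h) - indicator B x\<bar> \<partial>lborel)"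
    unfolding shift_difference_def by (intro nn_integral_mono) (auto simp: indicator_def)
  then show ?thesis unfolding shift_difference_def by (simp add: nn_integral_add)
qed

lemma shift_difference_UN_le:
  fixes A :: "nat \<Rightarrow> 'a::euclidean_space set"
  assumes [measurable]: "\<And>i. A i \<in> sets borel"
  shows "shift_difference (indicator (\<Union>i. A i)) h \<le> (\<Sum>i. shift_difference (indicator (A i)) h)"
proof -
  have pt: "ennreal \<bar>indicator (\<Union>i. A i) (x + h) - indicator (\<Union>i. A i) x\<bar>
      \<le> (\<Sum>i. ennreal \<bar>indicator (A i) (x + h) - indicator (A i) x\<bar>)" for x
  proof (cases "(x + h \<in> (\<Union>i. A i)) = (x \<in> (\<Union>i. A i))")
    case True then show ?thesis by (simp add: indicator_def)
  next
    case False
    then obtain i where i: "(x + h \<in> A i) \<noteq> (x \<in> A i)" by blast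
    define f where "f i = ennreal \<bar>indicator (A i) (x + h) - indicator (A i) x\<bar>" for i
    have "f i = 1" using i by (auto simp: f_def indicator_def)
    moreover have "sum f {i} \<le> suminf f" by (rule sum_le_suminf) auto
    ultimately have "1 \<le> (\<Sum>i. ennreal \<bar>indicator (A i) (x + h) - indicator (A i) x\<bar>)"
      unfolding f_def[abs_def] by simp
    moreover have "ennreal \<bar>indicator (\<Union>i. A i) (x + h) - indicator (\<Union>i. A i) x\<bar> \<le> 1"
      by (simp add: indicator_def)
    ultimately show ?thesis by (rule order_trans[rotated])
  qed
  have "shift_difference (indicator (\<Union>i. A i)) h
      \<le> (\<integral>\<^sup>+x. (\<Sum>i. ennreal \<bar>indicator (A i) (x + h) - indicator (A i) x\<bar>) \<partial>lborel)"
    unfolding shift_difference_def by (intro nn_integral_mono pt)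
  also have "\<dots> = (\<Sum>i. shift_difference (indicator (A i)) h)"
    unfolding shift_difference_def by (rule nn_integral_suminf) measurable
  finally show ?thesis .
qed

lemma nonlocal_energy_Un_le:
  fixes A B :: "'a::euclidean_space set"
  assumes [measurable]: "\<rho> \<in> borel_measurable borel" "A \<in> sets borel" "B \<in> sets borel"
  shows "nonlocal_energy \<rho> (indicator (A \<union> B)) \<le> nonlocal_energy \<rho> (indicator A) + nonlocal_energy \<rho> (indicator B)"
proof -
  have "nonlocal_energy \<rho> (indicator (A \<union> B)) \<le> (\<integral>\<^sup>+h. ennreal (1 / norm h) * \<rho> h *
      (shift_difference (indicator A) h + shift_difference (indicator B) h) \<partial>lborel)"
    unfolding nonlocal_energy_def by (intro nn_integral_mono mult_left_mono shift_difference_Un_le) auto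
  then show ?thesis unfolding nonlocal_energy_def by (simp add: nn_integral_add distrib_left)
qed

lemma nonlocal_energy_UN_le:
  fixes A :: "nat \<Rightarrow> 'a::euclidean_space set"
  assumes [measurable]: "\<rho> \<in> borel_measurable borel" "\<And>i. A i \<in> sets borel"
  shows "nonlocal_energy \<rho> (indicator (\<Union>i. A i)) \<le> (\<Sum>i. nonlocal_energy \<rho> (indicator (A i)))"
proof -
  have "nonlocal_energy \<rho> (indicator (\<Union>i. A i)) \<le> (\<integral>\<^sup>+h. ennreal (1 / norm h) * \<rho> h *
      (\<Sum>i. shift_difference (indicator (A i)) h) \<partial>lborel)"
    unfolding nonlocal_energy_def by (intro nn_integral_mono mult_left_mono shift_difference_UN_le) auto
  also have "\<dots> = (\<integral>\<^sup>+h. (\<Sum>i. ennreal (1 / norm h) * \<rho> h * shift_difference (indicator (A i)) h) \<partial>lborel)"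
    by simp
  also have "\<dots> = (\<Sum>i. nonlocal_energy \<rho> (indicator (A i)))"
    unfolding nonlocal_energy_def by (rule nn_integral_suminf) measurable
  finally show ?thesis .
qed

text \<open>
  The first bound tends to \<open>0\<close> with the radius. The second is linear in \<open>\<bar>h\<bar>\<close>, uniformly in
  the radius, so it dominates after division by \<open>\<bar>h\<bar>\<close>.
\<close>

lemma shift_difference_ball_le:
  fixes q h :: "'a::euclidean_space"
  assumes r: "0 < r" "r \<le> 1"
  shows "shift_difference (indicator (ball q r)) h \<le> ennreal (2 * unit_ball_vol (real DIM('a)) * r ^ DIM('a))"
    and "shift_difference (indicator (ball q r)) h \<le> ennreal (unit_ball_vol (real DIM('a)) * (2 + 2 * (real DIM('a) * 2 ^ (DIM('a) - 1))) * norm h)"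
proof -
  let ?V = "unit_ball_vol (real DIM('a))" and ?d = "DIM('a)"
  have V: "?V > 0" by (rule unit_ball_vol_nat_pos)
  have [measurable]: "ball q r \<in> sets borel" for q :: 'a and r by simp
  have em: "emeasure lborel (ball q s) = ennreal (?V * s ^ ?d)" if "s \<ge> 0" for q :: 'a and s
    using that by (simp add: emeasure_ball)
  show 1: "shift_difference (indicator (ball q r)) h \<le> ennreal (2 * ?V * r ^ ?d)"
  proof -
    have "shift_difference (indicator (ball q r)) h
        \<le> (\<integral>\<^sup>+x. indicator (ball q r) (h + x) + indicator (ball q r) x \<partial>lborel)"
      unfolding shift_difference_def by (intro nn_integral_mono) (auto simp: indicator_def add.commute)
    also have "\<dots> = ennreal (?V * r ^ ?d) + ennreal (?V * r ^ ?d)"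
      using r nn_integral_lborel_shift[of "indicator (ball q r)" h] by (simp add: nn_integral_add em)
    also have "\<dots> = ennreal (2 * ?V * r ^ ?d)" using r V by (simp add: ennreal_plus[symmetric] del: ennreal_plus)
    finally show ?thesis .
  qed
  let ?C = "real ?d * 2 ^ (?d - 1)"
  show "shift_difference (indicator (ball q r)) h \<le> ennreal (?V * (2 + 2 * ?C) * norm h)"
  proof (cases "norm h < r")
    case False
    have "r ^ ?d \<le> r ^ 1" using r by (intro power_decreasing) auto
    then have "2 * ?V * r ^ ?d \<le> 2 * ?V * norm h" using False V by (intro mult_left_mono) auto
    also have "\<dots> \<le> ?V * (2 + 2 * ?C) * norm h" using V by (simp add: algebra_simps)
    finally show ?thesis using order_trans[OF 1 ennreal_leI] by blast
  next
    case True
    let ?s = "norm h"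
    have "shift_difference (indicator (ball q r)) h \<le> (\<integral>\<^sup>+x. indicator (ball q (r + ?s) - ball q (r - ?s)) x \<partial>lborel)"
      unfolding shift_difference_def
    proof (rule nn_integral_mono)
      fix x
      have tri: "dist q x \<le> dist q (x + h) + ?s" "dist q (x + h) \<le> dist q x + ?s"
        using dist_triangle[of q x "x + h"] dist_triangle[of q "x + h" x] by (auto simp: dist_norm)
      show "ennreal \<bar>indicator (ball q r) (x + h) - indicator (ball q r) x\<bar> \<le> indicator (ball q (r + ?s) - ball q (r - ?s)) x"
        using tri norm_ge_zero[of h] by (auto simp: indicator_def)
    qed
    also have "\<dots> = emeasure lborel (ball q (r + ?s)) - emeasure lborel (ball q (r - ?s))"
    proof -
      have "ball q (r - ?s) \<subseteq> ball q (r + ?s)" using norm_ge_zero[of h] by (intro subset_ball) linarith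
      then show ?thesis
        using emeasure_lborel_ball_finite[of q "r - ?s"] by (simp add: emeasure_Diff)
    qed
    also have "\<dots> = ennreal (?V * (r + ?s) ^ ?d - ?V * (r - ?s) ^ ?d)"
      using True r V by (simp add: em ennreal_minus)
    also have "\<dots> \<le> ennreal (?V * (2 + 2 * ?C) * norm h)"
    proof (rule ennreal_leI)
      have "(r + ?s) ^ ?d - (r - ?s) ^ ?d \<le> ((r + ?s) - (r - ?s)) * ?C"
        using True r by (intro power_diff_le) auto
      then have "?V * ((r + ?s) ^ ?d - (r - ?s) ^ ?d) \<le> ?V * (2 * ?s * ?C)" using V by (intro mult_left_mono) auto
      also have "\<dots> \<le> ?V * ((2 + 2 * ?C) * ?s)" using V by (intro mult_left_mono) (auto simp: algebra_simps)
      finally show "?V * (r + ?s) ^ ?d - ?V * (r - ?s) ^ ?d \<le> ?V * (2 + 2 * ?C) * norm h" by (simp add: algebra_simps)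
    qed
    finally show ?thesis .
  qed
qed

text \<open>
  Dominated convergence. The kernel is a function, so none of its mass sits at the origin; how
  small the ball has to be depends on the kernel.
\<close>

lemma small_ball_energy:
  fixes \<rho> :: "'a::euclidean_space \<Rightarrow> ennreal"
  assumes \<rho> [measurable]: "\<rho> \<in> borel_measurable borel" and one: "(\<integral>\<^sup>+h. \<rho> h \<partial>lborel) = 1" and "e > 0"
  obtains r where "r > 0" "nonlocal_energy \<rho> (indicator (ball q r)) \<le> ennreal e"
    "emeasure lborel (ball q r) \<le> ennreal e"
proof -
  let ?V = "unit_ball_vol (real DIM('a))" and ?d = "DIM('a)"
  define r where "r n = 1 / real (Suc n)" for n
  let ?F = "\<lambda>n h. ennreal (1 / norm h) * \<rho> h * shift_difference (indicator (ball q (r n))) h"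
  define C where "C = ?V * (2 + 2 * (real ?d * 2 ^ (?d - 1)))"
  have V: "?V > 0" by (rule unit_ball_vol_nat_pos)
  have C: "C \<ge> 0" using V by (simp add: C_def)
  have [measurable]: "ball q r \<in> sets borel" for q :: 'a and r by simp
  have r: "0 < r n" "r n \<le> 1" for n by (auto simp: r_def)
  have r0: "r \<longlonglongrightarrow> 0" unfolding r_def by (rule LIMSEQ_Suc[OF lim_1_over_n])
  have rd: "(\<lambda>n. ennreal (c * r n ^ ?d)) \<longlonglongrightarrow> 0" for c
  proof -
    have "(\<lambda>n. c * r n ^ ?d) \<longlonglongrightarrow> c * 0 ^ ?d" by (intro tendsto_intros r0)
    then have "(\<lambda>n. ennreal (c * r n ^ ?d)) \<longlonglongrightarrow> ennreal (c * 0 ^ ?d)" by (rule tendsto_ennrealI)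
    then show ?thesis by (simp add: zero_power)
  qed
  have fin: "AE h in lborel. \<rho> h \<noteq> \<infinity>" by (rule nn_integral_PInf_AE) (auto simp: one)
  have "(\<lambda>n. nonlocal_energy \<rho> (indicator (ball q (r n)))) \<longlonglongrightarrow> (\<integral>\<^sup>+h. 0 \<partial>(lborel :: 'a measure))"
    unfolding nonlocal_energy_def
  proof (rule nn_integral_dominated_convergence[where w = "\<lambda>h. ennreal C * \<rho> h"])
    show "(\<integral>\<^sup>+h. ennreal C * \<rho> h \<partial>lborel) < \<infinity>" by (simp add: nn_integral_cmult one)
    show "AE h in lborel. ?F n h \<le> ennreal C * \<rho> h" for n
      using AE_lborel_nonzero
    proof eventually_elim
      fix h :: 'a assume "h \<noteq> 0"
      have "?F n h \<le> ennreal (1 / norm h) * \<rho> h * ennreal (C * norm h)"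
        unfolding C_def by (intro mult_left_mono shift_difference_ball_le(2) r) simp
      also have "\<dots> = (ennreal (1 / norm h) * ennreal (C * norm h)) * \<rho> h" by (simp only: ac_simps)
      also have "ennreal (1 / norm h) * ennreal (C * norm h) = ennreal C"
        using \<open>h \<noteq> 0\<close> C by (subst ennreal_mult[symmetric]) auto
      finally show "?F n h \<le> ennreal C * \<rho> h" .
    qed
    show "AE h in lborel. (\<lambda>n. ?F n h) \<longlonglongrightarrow> 0"
      using fin
    proof eventually_elim
      fix h :: 'a assume f: "\<rho> h \<noteq> \<infinity>"
      have "(\<lambda>n. shift_difference (indicator (ball q (r n))) h) \<longlonglongrightarrow> 0"
        by (rule tendsto_sandwich[OF _ _ tendsto_const rd[of "2 * ?V"]])
           (auto intro!: always_eventually shift_difference_ball_le(1) r)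
      then have "(\<lambda>n. (ennreal (1 / norm h) * \<rho> h) * shift_difference (indicator (ball q (r n))) h) \<longlonglongrightarrow> (ennreal (1 / norm h) * \<rho> h) * 0"
        using f by (intro ennreal_tendsto_cmult) (auto simp: ennreal_mult_less_top less_top)
      then show "(\<lambda>n. ?F n h) \<longlonglongrightarrow> 0" by simp
    qed
  qed measurable
  then have "\<forall>\<^sub>F n in sequentially. nonlocal_energy \<rho> (indicator (ball q (r n))) < ennreal e"
    by (intro order_tendstoD(2)[of _ 0]) (use \<open>e > 0\<close> in auto)
  moreover have "\<forall>\<^sub>F n in sequentially. emeasure lborel (ball q (r n)) < ennreal e"
  proof (rule order_tendstoD(2))
    show "(\<lambda>n. emeasure lborel (ball q (r n))) \<longlonglongrightarrow> 0"
      using rd[of ?V] r by (simp add: emeasure_ball less_imp_le)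
  qed (use \<open>e > 0\<close> in simp)
  ultimately have "\<forall>\<^sub>F n in sequentially. nonlocal_energy \<rho> (indicator (ball q (r n))) < ennreal e \<and> emeasure lborel (ball q (r n)) < ennreal e"
    by eventually_elim auto
  then obtain n where "nonlocal_energy \<rho> (indicator (ball q (r n))) < ennreal e" "emeasure lborel (ball q (r n)) < ennreal e"
    by (auto simp: eventually_sequentially)
  then show ?thesis using that[of "r n"] r by auto
qed

text \<open>
  By the Lindelof property countably many null neighbourhoods suffice.
\<close>

lemma locally_null_imp_null:
  fixes A :: "'a::euclidean_space set"
  assumes [measurable]: "A \<in> sets borel" and loc: "\<And>p. \<exists>s>0. emeasure lborel (A \<inter> ball p s) = 0"
  shows "emeasure lborel A = 0"
proof -
  let ?F = "{ball p s | p s. s > 0 \<and> emeasure lborel (A \<inter> ball p s) = 0}"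
  obtain F' where F': "F' \<subseteq> ?F" "countable F'" "\<Union>F' = \<Union>?F"
    using Lindelof[of ?F] by auto
  have "p \<in> \<Union>?F" for p
  proof -
    obtain s where s: "s > 0" "emeasure lborel (A \<inter> ball p s) = 0" using loc by blast
    then show ?thesis by (intro UnionI[of "ball p s"]) auto
  qed
  then have "\<Union>F' = UNIV" unfolding F'(3) by (rule UNIV_eq_I[symmetric])
  then have "A = (\<Union>B\<in>F'. A \<inter> B)" by (metis Int_UNIV_right Int_Union)
  moreover have "(\<Union>B\<in>F'. A \<inter> B) \<in> null_sets lborel"
  proof (rule null_sets_UN'[OF F'(2)])
    fix B assume "B \<in> F'"
    then obtain p s where B: "B = ball p s" "emeasure lborel (A \<inter> ball p s) = 0" using F'(1) by blast
    have "A \<inter> ball p s \<in> sets borel" by simp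
    then show "A \<inter> B \<in> null_sets lborel" using B by (simp add: null_sets_def)
  qed
  ultimately show ?thesis by (simp add: null_sets_def)
qed

lemma AE_zero_outside_ess_support:
  fixes f :: "'a::euclidean_space \<Rightarrow> 'b::zero"
  shows "AE x in lborel. x \<notin> ess_support f \<longrightarrow> f x = 0"
proof -
  let ?F = "{U. open U \<and> (AE x in lborel. x \<in> U \<longrightarrow> f x = 0)}"
  obtain F' where F': "F' \<subseteq> ?F" "countable F'" "\<Union>F' = \<Union>?F"
    using Lindelof[of ?F] by auto
  have "AE x in lborel. \<forall>U\<in>F'. x \<in> U \<longrightarrow> f x = 0"
    using F' by (subst AE_ball_countable) auto
  moreover have "- ess_support f = \<Union>F'"
    unfolding F'(3) by (simp only: ess_support_def AE_completion_iff double_compl)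
  ultimately show ?thesis by (elim AE_mp) (intro AE_I2, blast)
qed

section \<open>Indecomposable sets\<close>

text \<open>
  The measure of \<open>(A - h) \<inter> B\<close>.
\<close>

definition interaction :: "'a::euclidean_space set \<Rightarrow> 'a set \<Rightarrow> 'a \<Rightarrow> ennreal" where
  "interaction A B h = (\<integral>\<^sup>+x. indicator A (x + h) * indicator B x \<partial>lborel)"

lemma interaction_measurable [measurable]:
  assumes [measurable]: "A \<in> sets borel" "B \<in> sets borel"
  shows "interaction A B \<in> borel_measurable borel"
  unfolding interaction_def[abs_def] by measurable

text \<open>
  A point counts twice on the left and not at all in the first term on the right exactly when
  the translation carries it from one set to the other.
\<close>

lemma shift_difference_disjoint_Un:
  fixes A B :: "'a::euclidean_space set"
  assumes [measurable]: "A \<in> sets borel" "B \<in> sets borel" and disj: "A \<inter> B = {}"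
  shows "shift_difference (indicator A) h + shift_difference (indicator B) h
    = shift_difference (indicator (A \<union> B)) h + 2 * (interaction A B h + interaction B A h)"
proof -
  have "shift_difference (indicator A) h + shift_difference (indicator B) h
      = (\<integral>\<^sup>+x. ennreal \<bar>indicator A (x + h) - indicator A x\<bar> + ennreal \<bar>indicator B (x + h) - indicator B x\<bar> \<partial>lborel)"
    unfolding shift_difference_def by (simp add: nn_integral_add)
  also have "\<dots> = (\<integral>\<^sup>+x. ennreal \<bar>indicator (A \<union> B) (x + h) - indicator (A \<union> B) x\<bar>
      + 2 * (indicator A (x + h) * indicator B x + indicator B (x + h) * indicator A x) \<partial>lborel)"
    using disj by (intro nn_integral_cong) (auto simp: indicator_def split: if_splits)
  also have "\<dots> = shift_difference (indicator (A \<union> B)) h + 2 * (interaction A B h + interaction B A h)"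
    unfolding shift_difference_def interaction_def by (simp add: nn_integral_add nn_integral_cmult)
  finally show ?thesis .
qed

lemma additive_energy_imp_no_interaction:
  fixes A B :: "'a::euclidean_space set"
  assumes [measurable]: "\<rho> \<in> borel_measurable borel" "A \<in> sets borel" "B \<in> sets borel" and disj: "A \<inter> B = {}"
    and fin: "nonlocal_energy \<rho> (indicator (A \<union> B)) < top"
    and add: "nonlocal_energy \<rho> (indicator (A \<union> B)) = nonlocal_energy \<rho> (indicator A) + nonlocal_energy \<rho> (indicator B)"
  shows "AE h in lborel. \<rho> h = 0 \<or> interaction A B h = 0"
proof -
  let ?k = "\<lambda>h::'a. ennreal (1 / norm h) * \<rho> h"
  let ?I = "\<lambda>h. ?k h * (2 * (interaction A B h + interaction B A h))"
  have "nonlocal_energy \<rho> (indicator A) + nonlocal_energy \<rho> (indicator B)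
      = (\<integral>\<^sup>+h. ?k h * (shift_difference (indicator A) h + shift_difference (indicator B) h) \<partial>lborel)"
    unfolding nonlocal_energy_def by (simp add: nn_integral_add distrib_left)
  also have "\<dots> = (\<integral>\<^sup>+h. ?k h * shift_difference (indicator (A \<union> B)) h + ?I h \<partial>lborel)"
    unfolding shift_difference_disjoint_Un[OF assms(2,3) disj] by (simp only: distrib_left)
  also have "\<dots> = nonlocal_energy \<rho> (indicator (A \<union> B)) + (\<integral>\<^sup>+h. ?I h \<partial>lborel)"
    unfolding nonlocal_energy_def by (rule nn_integral_add) measurable
  finally have "nonlocal_energy \<rho> (indicator (A \<union> B)) + 0 = nonlocal_energy \<rho> (indicator (A \<union> B)) + (\<integral>\<^sup>+h. ?I h \<partial>lborel)"
    using add by simp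
  then have "(\<integral>\<^sup>+h. ?I h \<partial>lborel) = 0"
    unfolding ennreal_add_left_cancel using fin by auto
  then have "AE h in lborel. ?I h = 0" by (subst (asm) nn_integral_0_iff_AE) auto
  with AE_lborel_nonzero show ?thesis by eventually_elim auto
qed

lemma interaction_perturb:
  fixes A B :: "'a::euclidean_space set"
  assumes [measurable]: "A \<in> sets borel" "B \<in> sets borel"
  shows "interaction A B h \<le> interaction A B h' + shift_difference (indicator A) (h - h')"
proof -
  have "interaction A B h \<le> (\<integral>\<^sup>+x. indicator A (x + h') * indicator B x
      + ennreal \<bar>indicator A ((h' + x) + (h - h')) - indicator A (h' + x)\<bar> \<partial>lborel)"
    unfolding interaction_def by (intro nn_integral_mono) (auto simp: indicator_def add.commute)
  also have "\<dots> = interaction A B h' + (\<integral>\<^sup>+x. ennreal \<bar>indicator A ((h' + x) + (h - h')) - indicator A (h' + x)\<bar> \<partial>lborel)"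
    unfolding interaction_def by (rule nn_integral_add) measurable
  also have "(\<integral>\<^sup>+x. ennreal \<bar>indicator A ((h' + x) + (h - h')) - indicator A (h' + x)\<bar> \<partial>lborel) = shift_difference (indicator A) (h - h')"
    unfolding shift_difference_def
    by (rule nn_integral_lborel_shift[of "\<lambda>y. ennreal \<bar>indicator A (y + (h - h')) - indicator A y\<bar>" h']) measurable
  finally show ?thesis .
qed

lemma nn_integral_interaction:
  fixes A B :: "'a::euclidean_space set"
  assumes [measurable]: "A \<in> sets borel" "B \<in> sets borel"
  shows "(\<integral>\<^sup>+h. interaction A B h \<partial>lborel) = emeasure lborel A * emeasure lborel B"
proof -
  have "(\<integral>\<^sup>+h. interaction A B h \<partial>lborel) = (\<integral>\<^sup>+x. (\<integral>\<^sup>+h. indicator A (x + h) * indicator B x \<partial>lborel) \<partial>lborel)"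
    unfolding interaction_def by (rule lborel_pair.Fubini') measurable
  also have "\<dots> = (\<integral>\<^sup>+x. emeasure lborel A * indicator B x \<partial>lborel)"
    using nn_integral_lborel_shift[of "indicator A"] by (intro nn_integral_cong) (simp add: nn_integral_multc)
  also have "\<dots> = emeasure lborel A * emeasure lborel B" by (simp add: nn_integral_cmult)
  finally show ?thesis .
qed

text \<open>
  If both parts have positive measure near \<open>p\<close>, some \<open>h\<close> with \<open>\<bar>h\<bar> < \<epsilon>\<close> satisfies
  \<open>interaction A B h > 0\<close>, and by continuity so do all nearby vectors. Then the kernel
  vanishes almost everywhere near \<open>h\<close>, although \<open>h\<close> lies in its essential support.
\<close>

lemma no_interaction_imp_far:
  fixes A B :: "'a::euclidean_space set"
  assumes A [measurable]: "A \<in> sets borel" and B [measurable]: "B \<in> sets borel"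
    and no: "AE h in lborel. \<rho> h = 0 \<or> interaction A B h = 0"
    and supp: "cball 0 \<epsilon> \<subseteq> ess_support \<rho>" and "\<epsilon> > 0"
  shows "emeasure lborel (A \<inter> ball p (\<epsilon>/2)) = 0 \<or> emeasure lborel (B \<inter> ball p (\<epsilon>/2)) = 0"
proof (rule ccontr)
  assume contra: "\<not> ?thesis"
  have [measurable]: "ball p (\<epsilon>/2) \<in> sets borel" by simp
  let ?A = "A \<inter> ball p (\<epsilon>/2)" and ?B = "B \<inter> ball p (\<epsilon>/2)"
  have "(\<integral>\<^sup>+h. interaction ?A ?B h \<partial>lborel) \<noteq> 0"
    using contra by (subst nn_integral_interaction) auto
  then obtain h where h: "interaction ?A ?B h \<noteq> 0" by fastforce
  have "\<exists>x. x + h \<in> ?A \<and> x \<in> ?B"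
  proof (rule ccontr)
    assume "\<not> ?thesis"
    then have "(\<lambda>x. indicator ?A (x + h) * indicator ?B x) = (\<lambda>_. 0 :: ennreal)"
      by (auto simp: fun_eq_iff indicator_def)
    then show False using h by (simp add: interaction_def)
  qed
  then obtain x where "x + h \<in> ?A" "x \<in> ?B" by blast
  then have "dist p (x + h) < \<epsilon>/2" "dist p x < \<epsilon>/2" by simp_all
  then have "dist (x + h) x < \<epsilon>" by (rule dist_triangle_half_r)
  then have hn: "norm h < \<epsilon>" by (simp add: dist_norm)
  have fin: "interaction ?A ?B h < top"
  proof -
    have "interaction ?A ?B h \<le> (\<integral>\<^sup>+x. indicator (ball p (\<epsilon>/2)) x \<partial>lborel)"
      unfolding interaction_def by (intro nn_integral_mono) (auto simp: indicator_def)
    then show ?thesis using emeasure_lborel_ball_finite[of p "\<epsilon>/2"] by (auto simp: less_top intro: le_less_trans)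
  qed
  then obtain c where c: "interaction ?A ?B h = ennreal c" "c > 0"
    using h by (cases "interaction ?A ?B h") (auto simp: less_le)
  have "c / 2 > 0" using c by simp
  then obtain d where d: "d > 0" "\<And>z. norm z < d \<Longrightarrow> shift_difference (indicator ?A) z \<le> ennreal (c / 2)"
    using indicator_translation_continuous[of ?A "c/2"] by (auto intro: bounded_Int)
  have pos: "interaction A B h' \<noteq> 0" if "h' \<in> ball h d" for h'
  proof
    assume "interaction A B h' = 0"
    moreover have "interaction ?A ?B h' \<le> interaction A B h'"
      unfolding interaction_def by (intro nn_integral_mono) (auto simp: indicator_def)
    ultimately have i1: "interaction ?A ?B h' = 0" by simp
    have i2: "interaction ?A ?B h \<le> interaction ?A ?B h' + shift_difference (indicator ?A) (h - h')"
      by (rule interaction_perturb) measurable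
    have i3: "shift_difference (indicator ?A) (h - h') \<le> ennreal (c / 2)"
      using that by (intro d(2)) (simp add: dist_norm)
    have "ennreal c \<le> 0 + ennreal (c / 2)"
      using order_trans[OF i2 add_mono[OF order_refl i3]] unfolding i1 c(1) .
    then show False using c by (simp add: ennreal_le_iff)
  qed
  have "AE h' in lborel. h' \<in> ball h d \<longrightarrow> \<rho> h' = 0" using no by eventually_elim (use pos in auto)
  then have "ball h d \<in> {U. open U \<and> (AE x in lebesgue. x \<in> U \<longrightarrow> \<rho> x = 0)}"
    by (simp add: AE_completion_iff)
  then have "h \<notin> ess_support \<rho>" using d(1) unfolding ess_support_def by (metis (no_types, lifting) ComplD UnionI centre_in_ball)
  moreover have "h \<in> cball 0 \<epsilon>" using hn by simp
  ultimately show False using supp by blast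
qed

text \<open>
  The points near which \<open>A\<close> is null form an open set, and likewise for \<open>B\<close>. These two sets
  cover the space and are disjoint, since \<open>A \<union> B\<close> is nowhere null. By connectedness one of
  them is the whole space.
\<close>

lemma ubiquitous_set_not_split:
  fixes A B :: "'a::euclidean_space set"
  assumes A [measurable]: "A \<in> sets borel" and B [measurable]: "B \<in> sets borel" and "\<epsilon> > 0"
    and far: "\<And>p. emeasure lborel (A \<inter> ball p \<epsilon>) = 0 \<or> emeasure lborel (B \<inter> ball p \<epsilon>) = 0"
    and ubi: "\<And>p s. s > 0 \<Longrightarrow> emeasure lborel ((A \<union> B) \<inter> ball p s) > 0"
  shows "emeasure lborel A = 0 \<or> emeasure lborel B = 0"
proof -
  have [measurable]: "ball (p::'a) s \<in> sets borel" for p s by simp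
  have mono: "emeasure lborel (X \<inter> ball q t) = 0" if "emeasure lborel (X \<inter> ball p s) = 0" "ball q t \<subseteq> ball p s" "X \<in> sets borel"
    for X p q s t
  proof -
    have "emeasure lborel (X \<inter> ball q t) \<le> emeasure lborel (X \<inter> ball p s)"
      using that by (intro emeasure_mono) auto
    then show ?thesis using that(1) by simp
  qed
  define N where "N X = {p. \<exists>s>0. emeasure lborel (X \<inter> ball p s) = 0}" for X :: "'a set"
  have op: "open (N X)" if X: "X \<in> sets borel" for X
    unfolding open_contains_ball
  proof
    fix p assume "p \<in> N X"
    then obtain s where s: "s > 0" "emeasure lborel (X \<inter> ball p s) = 0" by (auto simp: N_def)
    have "ball p (s/2) \<subseteq> N X"
    proof
      fix q assume q: "q \<in> ball p (s/2)"
      have "ball q (s/2) \<subseteq> ball p s"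
      proof
        fix z assume "z \<in> ball q (s/2)"
        then show "z \<in> ball p s" using q dist_triangle[of p z q] by auto
      qed
      from mono[OF s(2) this X] s(1) show "q \<in> N X" by (auto simp: N_def intro!: exI[of _ "s/2"])
    qed
    then show "\<exists>e>0. ball p e \<subseteq> N X" using s(1) by (intro exI[of _ "s/2"]) auto
  qed
  have cover: "N A \<union> N B = UNIV" using far \<open>\<epsilon> > 0\<close> by (auto simp: N_def)
  have disj: "N A \<inter> N B = {}"
  proof (rule ccontr)
    assume "N A \<inter> N B \<noteq> {}"
    then obtain p s t where st: "s > 0" "emeasure lborel (A \<inter> ball p s) = 0" "t > 0" "emeasure lborel (B \<inter> ball p t) = 0"
      by (auto simp: N_def)
    let ?m = "min s t"
    have "emeasure lborel (A \<inter> ball p ?m) = 0" "emeasure lborel (B \<inter> ball p ?m) = 0"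
      using mono[OF st(2) _ A, of p ?m] mono[OF st(4) _ B, of p ?m] by (auto simp: subset_ball)
    moreover have "(A \<union> B) \<inter> ball p ?m = (A \<inter> ball p ?m) \<union> (B \<inter> ball p ?m)" by blast
    moreover have "emeasure lborel ((A \<inter> ball p ?m) \<union> (B \<inter> ball p ?m)) \<le> emeasure lborel (A \<inter> ball p ?m) + emeasure lborel (B \<inter> ball p ?m)"
      by (rule emeasure_subadditive) auto
    ultimately show False using ubi[of ?m p] st by simp
  qed
  have "connected (UNIV :: 'a set)" by (rule connected_UNIV)
  from connectedD[OF this op[OF A] op[OF B]] have "N A = {} \<or> N B = {}" using cover disj by auto
  then have "N B = UNIV \<or> N A = UNIV" using cover by auto
  moreover have "emeasure lborel X = 0" if "N X = UNIV" "X \<in> sets borel" for X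
  proof (rule locally_null_imp_null[OF that(2)])
    fix p
    have "p \<in> N X" using that(1) by simp
    then show "\<exists>s>0. emeasure lborel (X \<inter> ball p s) = 0" by (simp add: N_def)
  qed
  ultimately show ?thesis using A B by blast
qed

lemma ubiquitous_set_indecomposable:
  fixes \<rho> :: "'a::euclidean_space \<Rightarrow> ennreal"
  assumes \<rho>: "\<rho> \<in> borel_measurable lebesgue" and supp: "cball 0 \<epsilon> \<subseteq> ess_support \<rho>" and "\<epsilon> > 0"
    and ubi: "\<And>p s. s > 0 \<Longrightarrow> emeasure lebesgue (F \<inter> ball p s) > 0"
  shows "\<not> decomposable \<rho> F"
proof
  assume "decomposable \<rho> F"
  then obtain E1 E2 where E: "E1 \<in> sets lebesgue" "E2 \<in> sets lebesgue" "E1 \<union> E2 = F" "E1 \<inter> E2 = {}"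
    and finF: "nonlocal_perimeter \<rho> F < \<infinity>"
    and pos: "emeasure lebesgue E1 > 0" "emeasure lebesgue E2 > 0"
    and add: "nonlocal_perimeter \<rho> F = nonlocal_perimeter \<rho> E1 + nonlocal_perimeter \<rho> E2"
    unfolding decomposable_def by blast
  obtain \<rho>' where [measurable]: "\<rho>' \<in> borel_measurable borel" and \<rho>': "AE x in lborel. \<rho> x = \<rho>' x"
    using completion_ex_borel_measurable[OF \<rho>] by auto
  obtain A where A [measurable]: "A \<in> sets borel" and AE1: "AE x in lborel. x \<in> E1 \<longleftrightarrow> x \<in> A"
    by (rule lebesgue_set_AE_borel[OF E(1)])
  obtain B0 where [measurable]: "B0 \<in> sets borel" and "AE x in lborel. x \<in> E2 \<longleftrightarrow> x \<in> B0"
    by (rule lebesgue_set_AE_borel[OF E(2)])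
  (* The representatives are made disjoint, as additivity of the energy is exploited pointwise. *)
  define B where "B = B0 - A"
  have B [measurable]: "B \<in> sets borel" by (simp add: B_def)
  have AE2: "AE x in lborel. x \<in> E2 \<longleftrightarrow> x \<in> B"
    using AE1 \<open>AE x in lborel. x \<in> E2 \<longleftrightarrow> x \<in> B0\<close> by eventually_elim (use E(4) in \<open>auto simp: B_def\<close>)
  have AEF: "AE x in lborel. x \<in> F \<longleftrightarrow> x \<in> A \<union> B"
    using AE1 AE2 by eventually_elim (use E(3) in auto)
  have conv: "nonlocal_perimeter \<rho> X = nonlocal_energy \<rho>' (indicator Y)"
    if "AE x in lborel. x \<in> X \<longleftrightarrow> x \<in> Y" "Y \<in> sets borel" for X Y
    using nonlocal_perimeter_cong_AE[OF \<rho>' that(1)] nonlocal_perimeter_eq_energy[OF that(2), of \<rho>'] by simp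
  have cem: "emeasure lebesgue X = emeasure lborel Y"
    if "AE x in lborel. x \<in> X \<longleftrightarrow> x \<in> Y" "X \<in> sets lebesgue" "Y \<in> sets borel" for X Y
  proof -
    have "emeasure lebesgue X = emeasure lebesgue Y"
      using AE_completion[OF that(1)] that(2,3) by (intro emeasure_eq_AE) auto
    then show ?thesis using that(3) by simp
  qed
  have "AE h in lborel. \<rho>' h = 0 \<or> interaction A B h = 0"
  proof (rule additive_energy_imp_no_interaction)
    have AB: "A \<union> B \<in> sets borel" by simp
    show "A \<inter> B = {}" by (auto simp: B_def)
    show "nonlocal_energy \<rho>' (indicator (A \<union> B)) < top" using finF unfolding conv[OF AEF AB] by simp
    show "nonlocal_energy \<rho>' (indicator (A \<union> B)) = nonlocal_energy \<rho>' (indicator A) + nonlocal_energy \<rho>' (indicator B)"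
      using add unfolding conv[OF AEF AB] conv[OF AE1 A] conv[OF AE2 B] .
  qed measurable
  then have no: "AE h in lborel. \<rho> h = 0 \<or> interaction A B h = 0"
    using \<rho>' by eventually_elim auto
  have "emeasure lborel A = 0 \<or> emeasure lborel B = 0"
  proof (rule ubiquitous_set_not_split[OF A B, of "\<epsilon>/2"])
    show "emeasure lborel (A \<inter> ball p (\<epsilon>/2)) = 0 \<or> emeasure lborel (B \<inter> ball p (\<epsilon>/2)) = 0" for p
      by (rule no_interaction_imp_far[OF A B no supp \<open>\<epsilon> > 0\<close>])
    fix p :: 'a and s :: real assume "s > 0"
    have "emeasure lebesgue (F \<inter> ball p s) = emeasure lborel ((A \<union> B) \<inter> ball p s)"
    proof (rule cem)
      show "AE x in lborel. x \<in> F \<inter> ball p s \<longleftrightarrow> x \<in> (A \<union> B) \<inter> ball p s"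
        using AEF by eventually_elim auto
      show "F \<inter> ball p s \<in> sets lebesgue" using E by (auto intro: sets.Int sets.Un)
      show "(A \<union> B) \<inter> ball p s \<in> sets borel" by simp
    qed
    then show "emeasure lborel ((A \<union> B) \<inter> ball p s) > 0" using ubi[OF \<open>s > 0\<close>, of p] by simp
  qed (use \<open>\<epsilon> > 0\<close> in simp)
  then show False using pos cem[OF AE1 E(1) A] cem[OF AE2 E(2) B] by auto
qed

section \<open>The Gamma-limit\<close>

lemma perimeter_cong_AE:
  assumes "AE x in lborel. x \<in> E \<longleftrightarrow> x \<in> E'" "E \<in> sets lebesgue" "E' \<in> sets lebesgue"
  shows "perimeter E = perimeter E'"
proof -
  have "(LINT x:E|lebesgue. divergence p x) = (LINT x:E'|lebesgue. divergence p x)" if p: "p \<in> test_fields" for p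
  proof -
    have "(p has_derivative frechet_derivative p (at x)) (at x)" for x
      using p k_times_cont_diff_has_derivative[of 0 p x] by (auto simp: test_fields_def smooth_def)
    have "continuous_on UNIV (\<lambda>x. frechet_derivative p (at x) b)" for b
    proof -
      have "k_times_cont_diff (Suc 0) p" using p unfolding test_fields_def smooth_def by blast
      then show ?thesis by simp
    qed
    then have "continuous_on UNIV (divergence p)" unfolding divergence_def[abs_def] by (intro continuous_intros)
    then have [measurable]: "divergence p \<in> borel_measurable lebesgue"
      by (intro measurable_completion) (simp add: borel_measurable_continuous_onI)
    show ?thesis
      unfolding set_lebesgue_integral_def
    proof (rule integral_cong_AE)
      show "AE x in lebesgue. indicator E x *\<^sub>R divergence p x = indicator E' x *\<^sub>R divergence p x"
        using AE_completion[OF assms(1)] by eventually_elim (simp add: indicator_def)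
    qed (use assms in measurable)
  qed
  then show ?thesis unfolding perimeter_def by (intro SUP_cong) auto
qed

text \<open>
  A Borel representative of a radial kernel is invariant under each orthogonal map up to a
  null set, which is all that the directional mean requires.
\<close>

lemma borel_kernel_exists:
  fixes \<rho> :: "'a::euclidean_space \<Rightarrow> ennreal" and e :: 'a
  assumes \<rho>: "\<rho> \<in> borel_measurable lebesgue" "radial \<rho>" "ess_support \<rho> = cball 0 \<epsilon>"
    "(\<integral>\<^sup>+h. \<rho> h \<partial>lebesgue) = 1" and e: "e \<in> Basis"
  obtains \<rho>' where "borel_kernel \<rho>' \<epsilon> (sphere_mean_const e)" "AE x in lborel. \<rho> x = \<rho>' x"
proof -
  obtain \<rho>' where [measurable]: "\<rho>' \<in> borel_measurable borel" and AE: "AE x in lborel. \<rho> x = \<rho>' x"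
    using completion_ex_borel_measurable[OF \<rho>(1)] by auto
  have one: "(\<integral>\<^sup>+h. \<rho>' h \<partial>lborel) = 1"
    using \<rho>(4) nn_integral_cong_AE[OF AE] by (simp add: nn_integral_completion)
  have rad: "AE x in lborel. \<rho>' (T x) = \<rho>' x" if T: "orthogonal_transformation T" for T
  proof -
    have [measurable]: "T \<in> borel_measurable borel" by (rule borel_measurable_orthogonal[OF T])
    obtain N where N: "N \<in> null_sets lborel" "{x. \<rho> x \<noteq> \<rho>' x} \<subseteq> N"
      using AE by (auto elim!: AE_E simp: null_sets_def)
    then have [measurable]: "N \<in> sets borel" by auto
    have "AE x in distr lborel borel T. x \<notin> N"
      unfolding distr_lborel_orthogonal[OF T] by (rule AE_not_in[OF N(1)])
    then have "AE x in lborel. T x \<notin> N" by (subst (asm) AE_distr_iff) auto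
    with AE show ?thesis
    proof eventually_elim
      fix x assume "\<rho> x = \<rho>' x" "T x \<notin> N"
      moreover have "\<rho> (T x) = \<rho> x" using \<rho>(2) orthogonal_transformation_norm[OF T] unfolding radial_def by blast
      moreover have "\<rho> (T x) = \<rho>' (T x)" using N(2) \<open>T x \<notin> N\<close> by blast
      ultimately show "\<rho>' (T x) = \<rho>' x" by simp
    qed
  qed
  have supp: "AE h in lborel. norm h > \<epsilon> \<longrightarrow> \<rho>' h = 0"
    using AE_zero_outside_ess_support[of \<rho>] AE by eventually_elim (auto simp: \<rho>(3))
  have "(\<integral>\<^sup>+h. ennreal (\<bar>h \<bullet> v\<bar> / norm h) * \<rho>' h \<partial>lborel) = ennreal (sphere_mean_const e * norm v)" for v
    by (rule spherical_mean_identity(1)) (measurable, erule rad, rule one, rule e)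
  moreover have "sphere_mean_const e > 0"
    by (rule spherical_mean_identity(2)[where \<rho> = \<rho>']) (measurable, erule rad, rule one, rule e)
  ultimately have "borel_kernel \<rho>' \<epsilon> (sphere_mean_const e)" using one supp by (simp add: borel_kernel_def)
  then show ?thesis using AE by (rule that)
qed

text \<open>
  The set is \<open>E\<close> together with balls around a dense sequence of centres, whose measures and
  energies sum to at most \<open>\<tau>\<close>.
\<close>

lemma recovery_set:
  fixes \<rho> :: "'a::euclidean_space \<Rightarrow> ennreal" and e :: 'a
  assumes \<rho>: "\<rho> \<in> borel_measurable lebesgue" "radial \<rho>" "ess_support \<rho> = cball 0 \<epsilon>"
    "(\<integral>\<^sup>+h. \<rho> h \<partial>lebesgue) = 1" and e: "e \<in> Basis" and "\<epsilon> > 0"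
    and E: "E \<in> sets lebesgue" and "\<tau> > 0"
  obtains F where "F \<in> sets lebesgue" "emeasure lebesgue (sym_diff F E) \<le> ennreal \<tau>"
    "connected_perimeter \<rho> F \<le> ennreal (sphere_mean_const e) * perimeter E + ennreal \<tau>"
proof -
  let ?K = "sphere_mean_const e"
  obtain \<rho>' where \<rho>': "borel_kernel \<rho>' \<epsilon> ?K" and AE: "AE x in lborel. \<rho> x = \<rho>' x"
    by (rule borel_kernel_exists[OF \<rho> e])
  note [measurable] = borel_kernelD(1)[OF \<rho>']
  obtain E' where E' [measurable]: "E' \<in> sets borel" and AEE: "AE x in lborel. x \<in> E \<longleftrightarrow> x \<in> E'"
    by (rule lebesgue_set_AE_borel[OF E])
  obtain D :: "'a set" where D: "countable D" "\<And>X :: 'a set. open X \<Longrightarrow> X \<noteq> {} \<Longrightarrow> \<exists>d\<in>D. d \<in> X"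
    by (rule countable_dense_setE) blast
  have "D \<noteq> {}" using D(2)[of UNIV] by auto
  define q where "q = from_nat_into D"
  have q: "\<exists>i. q i \<in> X" if X: "open X" "X \<noteq> {}" for X
  proof -
    obtain d where d: "d \<in> D" "d \<in> X" using D(2)[OF X] by (elim bexE)
    obtain i where "from_nat_into D i = d" using from_nat_into_surj[OF D(1) d(1)] by (elim exE)
    then have "q i \<in> X" using d(2) by (simp add: q_def)
    then show ?thesis by (rule exI)
  qed
  have "\<exists>r>0. nonlocal_energy \<rho>' (indicator (ball (q i) r)) \<le> ennreal (\<tau> * (1/2)^Suc i)
      \<and> emeasure lborel (ball (q i) r) \<le> ennreal (\<tau> * (1/2)^Suc i)" for i
  proof -
    have "\<tau> * (1/2)^Suc i > 0" using \<open>\<tau> > 0\<close> by simp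
    from small_ball_energy[OF borel_kernelD(1,2)[OF \<rho>'] this, of "q i"] show ?thesis by blast
  qed
  then obtain r where r: "\<And>i. r i > 0" "\<And>i. nonlocal_energy \<rho>' (indicator (ball (q i) (r i))) \<le> ennreal (\<tau> * (1/2)^Suc i)"
    "\<And>i. emeasure lborel (ball (q i) (r i)) \<le> ennreal (\<tau> * (1/2)^Suc i)" by metis
  have geo: "(\<Sum>i. ennreal (\<tau> * (1/2)^Suc i)) = ennreal \<tau>"
    by (rule suminf_half_powers) fact
  (* The centres are dense, so U meets every open set in positive measure. *)
  define U where "U = (\<Union>i. ball (q i) (r i))"
  have U [measurable]: "U \<in> sets borel" unfolding U_def by (intro borel_open open_UN) auto
  have UE: "nonlocal_energy \<rho>' (indicator U) \<le> ennreal \<tau>"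
    unfolding U_def geo[symmetric]
    by (rule order_trans[OF nonlocal_energy_UN_le suminf_le[OF r(2)]]) auto
  have UM: "emeasure lborel U \<le> ennreal \<tau>"
    unfolding U_def geo[symmetric]
    by (rule order_trans[OF emeasure_subadditive_countably suminf_le[OF r(3)]]) auto
  show ?thesis
  proof (rule that[of "E \<union> U"])
    show "E \<union> U \<in> sets lebesgue" using E U by (intro sets.Un) auto
    have "emeasure lebesgue (sym_diff (E \<union> U) E) \<le> emeasure lebesgue U"
      using U by (intro emeasure_mono) auto
    then show "emeasure lebesgue (sym_diff (E \<union> U) E) \<le> ennreal \<tau>" using UM U by simp
    have "\<not> decomposable \<rho> (E \<union> U)"
    proof (rule ubiquitous_set_indecomposable[OF \<rho>(1) _ \<open>\<epsilon> > 0\<close>])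
      show "cball 0 \<epsilon> \<subseteq> ess_support \<rho>" using \<rho>(3) by simp
      fix p :: 'a and s :: real assume "s > 0"
      then obtain i where i: "q i \<in> ball p s" using q[of "ball p s"] by auto
      have "q i \<in> ball (q i) (r i) \<inter> ball p s" using i r(1) by simp
      then obtain t where t: "t > 0" "ball (q i) t \<subseteq> ball (q i) (r i) \<inter> ball p s"
        using open_Int[OF open_ball open_ball] by (meson open_contains_ball)
      have "0 < emeasure lborel (ball (q i) t)"
        using t(1) unit_ball_vol_nat_pos[of "DIM('a)"] by (simp add: emeasure_ball)
      also have "\<dots> = emeasure lebesgue (ball (q i) t)" by simp
      also have "\<dots> \<le> emeasure lebesgue ((E \<union> U) \<inter> ball p s)"
      proof (rule emeasure_mono)
        show "ball (q i) t \<subseteq> (E \<union> U) \<inter> ball p s" using t(2) by (auto simp: U_def)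
        show "(E \<union> U) \<inter> ball p s \<in> sets lebesgue" using E U by (intro sets.Int sets.Un) auto
      qed
      finally show "0 < emeasure lebesgue ((E \<union> U) \<inter> ball p s)" .
    qed
    then have "connected_perimeter \<rho> (E \<union> U) = nonlocal_perimeter \<rho> (E \<union> U)"
      by (simp add: connected_perimeter_def)
    also have "\<dots> = nonlocal_perimeter \<rho>' (E' \<union> U)"
    proof (rule nonlocal_perimeter_cong_AE[OF AE])
      show "AE x in lborel. x \<in> E \<union> U \<longleftrightarrow> x \<in> E' \<union> U" using AEE by eventually_elim auto
    qed
    also have "\<dots> = nonlocal_energy \<rho>' (indicator (E' \<union> U))" by (rule nonlocal_perimeter_eq_energy) measurable
    also have "\<dots> \<le> nonlocal_energy \<rho>' (indicator E') + nonlocal_energy \<rho>' (indicator U)"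
      by (rule nonlocal_energy_Un_le) measurable
    also have "\<dots> \<le> ennreal ?K * perimeter E' + ennreal \<tau>"
      by (intro add_mono UE nonlocal_energy_le_perimeter[OF \<rho>']) measurable
    also have "perimeter E' = perimeter E" using perimeter_cong_AE[OF AEE E] by simp
    finally show "connected_perimeter \<rho> (E \<union> U) \<le> ennreal ?K * perimeter E + ennreal \<tau>" .
  qed
qed

theorem theorem3p4:
  fixes \<rho> :: "real \<Rightarrow> 'a::euclidean_space \<Rightarrow> ennreal"
    and e\<^sub>1 :: 'a
  assumes "\<And>\<epsilon>. \<epsilon> > 0 \<Longrightarrow> \<rho> \<epsilon> \<in> borel_measurable lebesgue"
    and "\<And>\<epsilon>. \<epsilon> > 0 \<Longrightarrow> radial (\<rho> \<epsilon>)"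
    and "\<And>\<epsilon>. \<epsilon> > 0 \<Longrightarrow> ess_support (\<rho> \<epsilon>) = cball 0 \<epsilon>"
    and "\<And>\<epsilon>. \<epsilon> > 0 \<Longrightarrow> (\<integral>\<^sup>+ h. \<rho> \<epsilon> h \<partial>lebesgue) = 1"
    and "e\<^sub>1 \<in> Basis"
  shows "Gamma_limit_at_0 (sets lebesgue) converges_in_measure
           (\<lambda>\<epsilon>. connected_perimeter (\<rho> \<epsilon>))
           (\<lambda>E. ennreal (sphere_mean_const e\<^sub>1) * perimeter E)"
  unfolding Gamma_limit_at_0_def Gamma_converges_def
proof (intro allI impI ballI conjI)
  fix \<epsilon> :: "nat \<Rightarrow> real" and E :: "'a set"
  assume "(\<forall>n. \<epsilon> n > 0) \<and> \<epsilon> \<longlonglongrightarrow> 0" and E: "E \<in> sets lebesgue"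
  then have eps: "\<And>n. \<epsilon> n > 0" "\<epsilon> \<longlonglongrightarrow> 0" by auto
  let ?K = "sphere_mean_const e\<^sub>1"
  {
    (* Lower bound: the connected perimeter dominates the nonlocal one; pass to Borel representatives. *)
    fix u assume "(\<forall>n. u n \<in> sets lebesgue) \<and> converges_in_measure u E"
    then have u: "\<And>n. u n \<in> sets lebesgue" and cv: "(\<lambda>n. emeasure lebesgue (sym_diff (u n) E)) \<longlonglongrightarrow> 0"
      by (auto simp: converges_in_measure_def)
    have "\<forall>n. \<exists>\<rho>'. borel_kernel \<rho>' (\<epsilon> n) ?K \<and> (AE x in lborel. \<rho> (\<epsilon> n) x = \<rho>' x)"
    proof
      show "\<exists>\<rho>'. borel_kernel \<rho>' (\<epsilon> n) ?K \<and> (AE x in lborel. \<rho> (\<epsilon> n) x = \<rho>' x)" for n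
        by (rule borel_kernel_exists[OF assms(1,2,3,4)[OF eps(1)] assms(5), of n]) blast
    qed
    from choice[OF this] obtain \<rho>' where \<rho>': "\<And>n. borel_kernel (\<rho>' n) (\<epsilon> n) ?K"
      "\<And>n. AE x in lborel. \<rho> (\<epsilon> n) x = \<rho>' n x" by blast
    obtain E' where E' [measurable]: "E' \<in> sets borel" and AEE: "AE x in lborel. x \<in> E \<longleftrightarrow> x \<in> E'"
      by (rule lebesgue_set_AE_borel[OF E])
    have "\<exists>A. A \<in> sets borel \<and> (AE x in lborel. x \<in> u n \<longleftrightarrow> x \<in> A)" for n
      by (rule lebesgue_set_AE_borel[OF u[of n]]) blast
    then have "\<forall>n. \<exists>A. A \<in> sets borel \<and> (AE x in lborel. x \<in> u n \<longleftrightarrow> x \<in> A)" by (intro allI)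
    from choice[OF this] obtain A where A: "\<And>n. A n \<in> sets borel"
      and AEA: "\<And>n. AE x in lborel. x \<in> u n \<longleftrightarrow> x \<in> A n" by blast
    have sd: "emeasure lborel (sym_diff (A n) E') = emeasure lebesgue (sym_diff (u n) E)" for n
    proof -
      have "emeasure lebesgue (sym_diff (A n) E') = emeasure lebesgue (sym_diff (u n) E)"
      proof (rule emeasure_eq_AE)
        show "AE x in lebesgue. x \<in> sym_diff (A n) E' \<longleftrightarrow> x \<in> sym_diff (u n) E"
          using AE_completion[OF AEE] AE_completion[OF AEA[of n]] by eventually_elim auto
      qed (use A E' u E in \<open>auto intro!: sets.Un sets.Diff\<close>)
      then show ?thesis using A[of n] E' by simp
    qed
    have "ennreal ?K * perimeter E = ennreal ?K * perimeter E'"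
      using perimeter_cong_AE[OF AEE E] by simp
    also have "\<dots> \<le> liminf (\<lambda>n. nonlocal_energy (\<rho>' n) (indicator (A n)))"
      using cv unfolding sd[symmetric]
      by (rule perimeter_le_liminf_nonlocal_energy[OF E' A \<rho>'(1) eps(2)])
    also have "\<dots> \<le> liminf (\<lambda>n. connected_perimeter (\<rho> (\<epsilon> n)) (u n))"
    proof (intro Liminf_mono always_eventually allI)
      fix n
      have "nonlocal_energy (\<rho>' n) (indicator (A n)) = nonlocal_perimeter (\<rho> (\<epsilon> n)) (u n)"
        using nonlocal_perimeter_eq_energy[OF A borel_kernelD(1)[OF \<rho>'(1)]] nonlocal_perimeter_cong_AE[OF \<rho>'(2) AEA] by metis
      then show "nonlocal_energy (\<rho>' n) (indicator (A n)) \<le> connected_perimeter (\<rho> (\<epsilon> n)) (u n)"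
        by (simp add: connected_perimeter_def)
    qed
    finally show "ennreal ?K * perimeter E \<le> liminf (\<lambda>n. connected_perimeter (\<rho> (\<epsilon> n)) (u n))" .
  }
  (* Upper bound: the recovery sets for the tolerances 1 / (n + 1). *)
  have "\<exists>F. F \<in> sets lebesgue \<and> emeasure lebesgue (sym_diff F E) \<le> ennreal (1 / real (Suc n)) \<and>
      connected_perimeter (\<rho> (\<epsilon> n)) F \<le> ennreal ?K * perimeter E + ennreal (1 / real (Suc n))" for n
  proof -
    have "1 / real (Suc n) > 0" by simp
    from recovery_set[OF assms(1,2,3,4)[OF eps(1)] assms(5) eps(1)[of n] E this] show ?thesis by blast
  qed
  then have "\<forall>n. \<exists>F. F \<in> sets lebesgue \<and> emeasure lebesgue (sym_diff F E) \<le> ennreal (1 / real (Suc n)) \<and>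
      connected_perimeter (\<rho> (\<epsilon> n)) F \<le> ennreal ?K * perimeter E + ennreal (1 / real (Suc n))" by (intro allI)
  from choice[OF this] obtain u where u: "\<And>n. u n \<in> sets lebesgue" "\<And>n. emeasure lebesgue (sym_diff (u n) E) \<le> ennreal (1 / real (Suc n))"
    "\<And>n. connected_perimeter (\<rho> (\<epsilon> n)) (u n) \<le> ennreal ?K * perimeter E + ennreal (1 / real (Suc n))" by blast
  have "(\<lambda>n. 1 / real (Suc n)) \<longlonglongrightarrow> 0" by (rule LIMSEQ_Suc[OF lim_1_over_n])
  then have lim: "(\<lambda>n. ennreal (1 / real (Suc n))) \<longlonglongrightarrow> 0" using tendsto_ennrealI by fastforce
  have "converges_in_measure u E"
    unfolding converges_in_measure_def
    by (rule tendsto_sandwich[OF _ _ tendsto_const lim]) (simp, rule always_eventually, rule allI, rule u(2))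
  moreover have "limsup (\<lambda>n. connected_perimeter (\<rho> (\<epsilon> n)) (u n)) \<le> ennreal ?K * perimeter E"
  proof -
    have "limsup (\<lambda>n. connected_perimeter (\<rho> (\<epsilon> n)) (u n)) \<le> limsup (\<lambda>n. ennreal ?K * perimeter E + ennreal (1 / real (Suc n)))"
      by (intro Limsup_mono always_eventually allI u(3))
    also have "\<dots> = ennreal ?K * perimeter E"
    proof (rule lim_imp_Limsup)
      have "(\<lambda>n. ennreal ?K * perimeter E + ennreal (1 / real (Suc n))) \<longlonglongrightarrow> ennreal ?K * perimeter E + 0"
        by (intro tendsto_add tendsto_const lim)
      then show "(\<lambda>n. ennreal ?K * perimeter E + ennreal (1 / real (Suc n))) \<longlonglongrightarrow> ennreal ?K * perimeter E" by simp
    qed simp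
    finally show ?thesis .
  qed
  ultimately show "\<exists>u. (\<forall>n. u n \<in> sets lebesgue) \<and> converges_in_measure u E \<and>
      limsup (\<lambda>n. connected_perimeter (\<rho> (\<epsilon> n)) (u n)) \<le> ennreal ?K * perimeter E"
    using u(1) by blast
qed

end
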